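(* Let $T=(T_t)_{t\in\mathbb{R}_+}$ be a strongly continuous CP-semigroup on a unital $C^*$-algebra $\mathcal{B}$. Then $T$ is spatial if and only if its GNS-system can be embedded into a continuous spatial product system of correspondences over $\mathcal{B}$.
   Context: CP-semigroups. A CP-semigroup on $\mathcal{B}$ is a one-parameter semigroup $T=(T_t)_{t\in\mathbb{R}_+}$ ($\mathbb{R}_+=[0,\infty)$, $T_0=\mathrm{id}$) of completely positive maps on $\mathcal{B}$; it is strongly continuous if $t\mapsto T_t(b)$ is norm continuous for every $b\in\mathcal{B}$. A strongly continuous CP-semigroup $T$ is spatial if there is a norm continuous semigroup $c=(c_t)_{t\in\mathbb{R}_+}$ of elements of $\mathcal{B}$ ($c_sc_t=c_{s+t}$, $c_0=\mathbf{1}$) such that for every $t\in\mathbb{R}_+$ the map $b\mapsto T_t(b)-c_t^*bc_t$ is completely positive. Product systems. A correspondence over $\mathcal{B}$ is a right Hilbert $\mathcal{B}$-module with a nondegenerate (unital) left action of $\mathcal{B}$ by adjointable operators; $\odot$ is the internal tensor product over $\mathcal{B}$; "bilinear" means $\mathcal{B}$-$\mathcal{B}$-bimodule map. A product system is a family $E^\odot=(E_t)_{t\in\mathbb{R}_+}$ of correspondences over $\mathcal{B}$ with bilinear unitaries $u_{s,t}\colon E_s\odot E_t\to E_{s+t}$ such that the product $x_sy_t:=u_{s,t}(x_s\odot y_t)$ is associative, with $E_0=\mathcal{B}$ and $u_{0,t},u_{s,0}$ being left and right multiplication by elements of $\mathcal{B}$. A unit is a family $\xi^\odot=(\xi_t)$,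 $\xi_t\in E_t$, with $\xi_s\xi_t=\xi_{s+t}$, $\xi_0=\mathbf{1}$. It is unital if $\langle\xi_t,\xi_t\rangle=\mathbf{1}$ for all $t$, and central if $b\xi_t=\xi_tb$ for all $b\in\mathcal{B}$ and all $t$. Continuous product systems. A continuous product system is a product system $E^\odot$ together with isometric right $\mathcal{B}$-linear embeddings $i_t\colon E_t\to\widehat{E}$ into a fixed Hilbert $\mathcal{B}$-module $\widehat{E}$ such that, with the set of continuous sections $CS(E^\odot):=\{x=(x_t)_{t\in\mathbb{R}_+}: x_t\in E_t,\ t\mapsto i_tx_t \text{ norm continuous}\}$, one has: (1) for every $s\in\mathbb{R}_+$ and $y_s\in E_s$ there is $x\in CS(E^\odot)$ with $x_s=y_s$; (2) for all $x,y\in CS(E^\odot)$ the function $(s,t)\mapsto i_{s+t}(x_sy_t)$ is norm continuous; moreover $t\mapsto\langle x_t,by_t\rangle$ is norm continuous for all $b\in\mathcal{B}$ and $x,y\in CS(E^\odot)$. A continuous product system is spatial if it has a central unital unit $\omega^\odot\in CS(E^\odot)$. GNS-system. For every CP-semigroup $T$ on $\mathcal{B}$ there is a pair $(E^\odot,\xi^\odot)$, unique up to isomorphism, of a product system $E^\odot$ and a unit $\xi^\odot$ such that $T_t(b)=\langle\xi_t,b\xi_t\rangle$ for all $b\in\mathcal{B}$, $t\in\mathbb{R}_+$, and $E^\odot$ is generated by $\xi^\odot$, i.e. for $t>0$, $E_t$ is the closed linear span of all $b_n\xi_{t_n}\cdots b_1\xi_{t_1}b_0$ with $n\in\mathbb{N}$,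 $t_i>0$, $t_1+\dots+t_n=t$, $b_i\in\mathcal{B}$. $E^\odot$ is called the GNS-system of $T$. An embedding of the GNS-system into a continuous product system $G^\odot$ is a family of bilinear inner-product-preserving maps $v_t\colon E_t\to G_t$ with $v_0=\mathrm{id}_{\mathcal{B}}$ and $v_{s+t}(x_sy_t)=v_s(x_s)v_t(y_t)$, such that the unit $(v_t\xi_t)_{t\in\mathbb{R}_+}$ belongs to $CS(G^\odot)$. *)

theory Defs
  imports "HOL-Analysis.Analysis"
begin

section \<open>Unital C*-algebras\<close>

text \<open>The superclass \<^class>\<open>real_normed_algebra_1\<close> supplies the (nonzero) unit.\<close>

class cstar_algebra = real_normed_algebra_1 + banach +
  fixes scaleC :: "complex \<Rightarrow> 'a \<Rightarrow> 'a" (infixr "*\<^sub>C" 75)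
    and star :: "'a \<Rightarrow> 'a"
  assumes scaleC_of_real: "complex_of_real r *\<^sub>C x = r *\<^sub>R x"
    and scaleC_add_right: "z *\<^sub>C (x + y) = z *\<^sub>C x + z *\<^sub>C y"
    and scaleC_add_left: "(z + w) *\<^sub>C x = z *\<^sub>C x + w *\<^sub>C x"
    and scaleC_scaleC: "z *\<^sub>C w *\<^sub>C x = (z * w) *\<^sub>C x"
    and mult_scaleC_left: "(z *\<^sub>C x) * y = z *\<^sub>C (x * y)"
    and mult_scaleC_right: "x * (z *\<^sub>C y) = z *\<^sub>C (x * y)"
    and norm_scaleC: "norm (z *\<^sub>C x) = cmod z * norm x"
    and star_star: "star (star x) = x"
    and star_add: "star (x + y) = star x + star y"
    and star_scaleC: "star (z *\<^sub>C x) = cnj z *\<^sub>C star x"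
    and star_mult: "star (x * y) = star y * star x"
    and norm_star_mult: "norm (star x * x) = (norm x)\<^sup>2"

definition positive :: "'b::cstar_algebra \<Rightarrow> bool" where
  "positive a \<longleftrightarrow> (\<exists>b. a = star b * b)"


section \<open>Spatial CP-semigroups\<close>

definition clinear :: "('b::cstar_algebra \<Rightarrow> 'b) \<Rightarrow> bool" where
  "clinear f \<longleftrightarrow> (\<forall>x y. f (x + y) = f x + f y) \<and> (\<forall>z x. f (z *\<^sub>C x) = z *\<^sub>C f x)"

text \<open>Elements of the C*-algebra of \<open>n\<close> by \<open>n\<close> matrices over \<open>'b\<close> are given by their entries
  with indices below \<open>n\<close>; the matrix \<open>A\<close> is positive if \<open>A = C\<^sup>* C\<close> for some matrix \<open>C\<close>.\<close>

definition mat_positive :: "nat \<Rightarrow> (nat \<Rightarrow> nat \<Rightarrow> 'b::cstar_algebra) \<Rightarrow> bool" where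
  "mat_positive n A \<longleftrightarrow>
     (\<exists>C. \<forall>i<n. \<forall>j<n. A i j = (\<Sum>k<n. star (C k i) * C k j))"

definition completely_positive :: "('b::cstar_algebra \<Rightarrow> 'b) \<Rightarrow> bool" where
  "completely_positive f \<longleftrightarrow> clinear f \<and>
     (\<forall>n A. mat_positive n A \<longrightarrow> mat_positive n (\<lambda>i j. f (A i j)))"

text \<open>Families indexed by the nonnegative reals are functions on \<^typ>\<open>real\<close> whose values at
  negative arguments are never used.\<close>

definition cp_semigroup :: "(real \<Rightarrow> 'b::cstar_algebra \<Rightarrow> 'b) \<Rightarrow> bool" where
  "cp_semigroup T \<longleftrightarrow>
     (\<forall>t\<ge>0. completely_positive (T t)) \<and>
     (\<forall>b. T 0 b = b) \<and>
     (\<forall>s\<ge>0. \<forall>t\<ge>0. \<forall>b. T (s + t) b = T s (T t b))"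

definition strongly_continuous :: "(real \<Rightarrow> 'b::cstar_algebra \<Rightarrow> 'b) \<Rightarrow> bool" where
  "strongly_continuous T \<longleftrightarrow> (\<forall>b. continuous_on {0..} (\<lambda>t. T t b))"

definition spatial_cp_semigroup :: "(real \<Rightarrow> 'b::cstar_algebra \<Rightarrow> 'b) \<Rightarrow> bool" where
  "spatial_cp_semigroup T \<longleftrightarrow> cp_semigroup T \<and> strongly_continuous T \<and>
     (\<exists>c. continuous_on {0..} c \<and> c 0 = 1 \<and>
          (\<forall>s\<ge>0. \<forall>t\<ge>0. c s * c t = c (s + t)) \<and>
          (\<forall>t\<ge>0. completely_positive (\<lambda>b. T t b - star (c t) * b * c t)))"


section \<open>Hilbert modules and correspondences\<close>

record ('e, 'b) hmod =
  hcarrier :: "'e set"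
  hzero :: 'e
  hadd :: "'e \<Rightarrow> 'e \<Rightarrow> 'e"
  ract :: "'e \<Rightarrow> 'b \<Rightarrow> 'e"
  hinner :: "'e \<Rightarrow> 'e \<Rightarrow> 'b"

definition hdiff :: "('e, 'b::cstar_algebra, 'm) hmod_scheme \<Rightarrow> 'e \<Rightarrow> 'e \<Rightarrow> 'e" where
  "hdiff E x y = hadd E x (ract E y (-1))"

definition hnorm :: "('e, 'b::cstar_algebra, 'm) hmod_scheme \<Rightarrow> 'e \<Rightarrow> real" where
  "hnorm E x = sqrt (norm (hinner E x x))"

text \<open>As \<open>'b\<close> is unital, the scalar multiple of \<open>x\<close> by a complex number \<open>z\<close> is
  \<open>ract E x (z *\<^sub>C 1)\<close>; it needs no separate operation. The inner product is linear in the
  second argument.\<close>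

locale hilbert_module =
  fixes E :: "('e, 'b::cstar_algebra, 'm) hmod_scheme"
  assumes zero_closed: "hzero E \<in> hcarrier E"
    and add_closed: "\<lbrakk>x \<in> hcarrier E; y \<in> hcarrier E\<rbrakk> \<Longrightarrow> hadd E x y \<in> hcarrier E"
    and add_assoc: "\<lbrakk>x \<in> hcarrier E; y \<in> hcarrier E; z \<in> hcarrier E\<rbrakk>
      \<Longrightarrow> hadd E (hadd E x y) z = hadd E x (hadd E y z)"
    and add_commute: "\<lbrakk>x \<in> hcarrier E; y \<in> hcarrier E\<rbrakk> \<Longrightarrow> hadd E x y = hadd E y x"
    and add_zero: "x \<in> hcarrier E \<Longrightarrow> hadd E x (hzero E) = x"
    and add_inverse: "x \<in> hcarrier E \<Longrightarrow> \<exists>y\<in>hcarrier E. hadd E x y = hzero E"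
    and ract_closed: "x \<in> hcarrier E \<Longrightarrow> ract E x b \<in> hcarrier E"
    and ract_one: "x \<in> hcarrier E \<Longrightarrow> ract E x 1 = x"
    and ract_ract: "x \<in> hcarrier E \<Longrightarrow> ract E (ract E x a) b = ract E x (a * b)"
    and ract_add_left: "\<lbrakk>x \<in> hcarrier E; y \<in> hcarrier E\<rbrakk>
      \<Longrightarrow> ract E (hadd E x y) b = hadd E (ract E x b) (ract E y b)"
    and ract_add_right: "x \<in> hcarrier E \<Longrightarrow> ract E x (a + b) = hadd E (ract E x a) (ract E x b)"
    and inner_add: "\<lbrakk>x \<in> hcarrier E; y \<in> hcarrier E; z \<in> hcarrier E\<rbrakk>
      \<Longrightarrow> hinner E x (hadd E y z) = hinner E x y + hinner E x z"
    and inner_ract: "\<lbrakk>x \<in> hcarrier E; y \<in> hcarrier E\<rbrakk>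
      \<Longrightarrow> hinner E x (ract E y b) = hinner E x y * b"
    and inner_star: "\<lbrakk>x \<in> hcarrier E; y \<in> hcarrier E\<rbrakk>
      \<Longrightarrow> star (hinner E x y) = hinner E y x"
    and inner_positive: "x \<in> hcarrier E \<Longrightarrow> positive (hinner E x x)"
    and inner_definite: "\<lbrakk>x \<in> hcarrier E; hinner E x x = 0\<rbrakk> \<Longrightarrow> x = hzero E"
    and complete: "\<lbrakk>\<forall>n::nat. X n \<in> hcarrier E;
        \<forall>\<epsilon>>0. \<exists>N. \<forall>m\<ge>N. \<forall>n\<ge>N. hnorm E (hdiff E (X m) (X n)) < \<epsilon>\<rbrakk>
      \<Longrightarrow> \<exists>x\<in>hcarrier E. (\<lambda>n. hnorm E (hdiff E (X n) x)) \<longlonglongrightarrow> 0"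

record ('e, 'b) corr = "('e, 'b) hmod" +
  lact :: "'b \<Rightarrow> 'e \<Rightarrow> 'e"

locale correspondence = hilbert_module E
  for E :: "('e, 'b::cstar_algebra, 'm) corr_scheme" +
  assumes lact_closed: "x \<in> hcarrier E \<Longrightarrow> lact E b x \<in> hcarrier E"
    and lact_one: "x \<in> hcarrier E \<Longrightarrow> lact E 1 x = x"
    and lact_lact: "x \<in> hcarrier E \<Longrightarrow> lact E a (lact E b x) = lact E (a * b) x"
    and lact_add_left: "x \<in> hcarrier E \<Longrightarrow> lact E (a + b) x = hadd E (lact E a x) (lact E b x)"
    and lact_scaleC: "x \<in> hcarrier E \<Longrightarrow> lact E (z *\<^sub>C b) x = ract E (lact E b x) (z *\<^sub>C 1)"
    and lact_add_right: "\<lbrakk>x \<in> hcarrier E; y \<in> hcarrier E\<rbrakk>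
      \<Longrightarrow> lact E b (hadd E x y) = hadd E (lact E b x) (lact E b y)"
    and lact_ract: "x \<in> hcarrier E \<Longrightarrow> lact E a (ract E x b) = ract E (lact E a x) b"
    and lact_adjoint: "\<lbrakk>x \<in> hcarrier E; y \<in> hcarrier E\<rbrakk>
      \<Longrightarrow> hinner E (lact E b x) y = hinner E x (lact E (star b) y)"

definition self_corr :: "('b::cstar_algebra, 'b) corr" where
  "self_corr = \<lparr>hcarrier = UNIV, hzero = 0, hadd = (+), ract = (*),
     hinner = (\<lambda>x y. star x * y), lact = (*)\<rparr>"

text \<open>An isometry of Hilbert modules is a right linear map preserving inner products.\<close>

definition right_isometry ::
  "('e, 'b::cstar_algebra, 'm) hmod_scheme \<Rightarrow> ('f, 'b, 'n) hmod_scheme \<Rightarrow> ('e \<Rightarrow> 'f) \<Rightarrow> bool" where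
  "right_isometry E F v \<longleftrightarrow>
     (\<forall>x\<in>hcarrier E. v x \<in> hcarrier F) \<and>
     (\<forall>x\<in>hcarrier E. \<forall>y\<in>hcarrier E. v (hadd E x y) = hadd F (v x) (v y)) \<and>
     (\<forall>x\<in>hcarrier E. \<forall>b. v (ract E x b) = ract F (v x) b) \<and>
     (\<forall>x\<in>hcarrier E. \<forall>y\<in>hcarrier E. hinner F (v x) (v y) = hinner E x y)"

definition bilinear_isometry ::
  "('e, 'b::cstar_algebra, 'm) corr_scheme \<Rightarrow> ('f, 'b, 'n) corr_scheme \<Rightarrow> ('e \<Rightarrow> 'f) \<Rightarrow> bool" where
  "bilinear_isometry E F v \<longleftrightarrow> right_isometry E F v \<and>
     (\<forall>x\<in>hcarrier E. \<forall>b. v (lact E b x) = lact F b (v x))"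

definition bilinear_unitary ::
  "('e, 'b::cstar_algebra, 'm) corr_scheme \<Rightarrow> ('f, 'b, 'n) corr_scheme \<Rightarrow> ('e \<Rightarrow> 'f) \<Rightarrow> bool" where
  "bilinear_unitary E F v \<longleftrightarrow> bilinear_isometry E F v \<and> v ` hcarrier E = hcarrier F"

inductive_set hspan :: "('e, 'b::cstar_algebra, 'm) hmod_scheme \<Rightarrow> 'e set \<Rightarrow> 'e set"
  for E :: "('e, 'b::cstar_algebra, 'm) hmod_scheme" and S :: "'e set" where
  hspan_zero: "hzero E \<in> hspan E S"
| hspan_add: "\<lbrakk>s \<in> S; y \<in> hspan E S\<rbrakk> \<Longrightarrow> hadd E (ract E s (z *\<^sub>C 1)) y \<in> hspan E S"

definition closed_hspan :: "('e, 'b::cstar_algebra, 'm) hmod_scheme \<Rightarrow> 'e set \<Rightarrow> 'e set" where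
  "closed_hspan E S =
     {x \<in> hcarrier E. \<forall>\<epsilon>>0. \<exists>y\<in>hspan E S. hnorm E (hdiff E x y) < \<epsilon>}"

definition norm_continuous_on ::
  "('e, 'b::cstar_algebra, 'm) hmod_scheme \<Rightarrow> 'a::topological_space set \<Rightarrow> ('a \<Rightarrow> 'e) \<Rightarrow> bool" where
  "norm_continuous_on E A f \<longleftrightarrow>
     (\<forall>p\<in>A. ((\<lambda>q. hnorm E (hdiff E (f q) (f p))) \<longlongrightarrow> 0) (at p within A))"


section \<open>The internal tensor product\<close>

text \<open>A list \<open>[(x\<^sub>1, y\<^sub>1), \<dots>, (x\<^sub>n, y\<^sub>n)]\<close> stands for the finite sum of elementary tensors
  \<open>x\<^sub>i \<odot> y\<^sub>i\<close>, with semi-inner product determined by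
  \<open>\<langle>x \<odot> y, x' \<odot> y'\<rangle> = \<langle>y, \<langle>x, x'\<rangle> y'\<rangle>\<close>. The internal tensor product is the completion of the
  space of these sums modulo vectors of length zero, i.e. the set of Cauchy sequences of
  finite sums modulo sequences converging to zero. The bilinearity and balancing relations
  between elementary tensors hold because their defects have length zero.\<close>

type_synonym ('e, 'f) tensor = "(nat \<Rightarrow> ('e \<times> 'f) list) set"

definition fsum_inner ::
  "('e, 'b::cstar_algebra) corr \<Rightarrow> ('f, 'b) corr \<Rightarrow> ('e \<times> 'f) list \<Rightarrow> ('e \<times> 'f) list \<Rightarrow> 'b" where
  "fsum_inner E F X Y =
     (\<Sum>(x, y)\<leftarrow>X. \<Sum>(x', y')\<leftarrow>Y. hinner F y (lact F (hinner E x x') y'))"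

definition fsum_dist ::
  "('e, 'b::cstar_algebra) corr \<Rightarrow> ('f, 'b) corr \<Rightarrow> ('e \<times> 'f) list \<Rightarrow> ('e \<times> 'f) list \<Rightarrow> real" where
  "fsum_dist E F X Y =
     (let Z = X @ map (\<lambda>(x, y). (x, ract F y (-1))) Y in sqrt (norm (fsum_inner E F Z Z)))"

definition tensor_cauchy ::
  "('e, 'b::cstar_algebra) corr \<Rightarrow> ('f, 'b) corr \<Rightarrow> (nat \<Rightarrow> ('e \<times> 'f) list) set" where
  "tensor_cauchy E F =
     {X. (\<forall>n. set (X n) \<subseteq> hcarrier E \<times> hcarrier F) \<and>
         (\<forall>\<epsilon>>0. \<exists>N. \<forall>m\<ge>N. \<forall>n\<ge>N. fsum_dist E F (X m) (X n) < \<epsilon>)}"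

definition tensor_class ::
  "('e, 'b::cstar_algebra) corr \<Rightarrow> ('f, 'b) corr \<Rightarrow> (nat \<Rightarrow> ('e \<times> 'f) list) \<Rightarrow> ('e, 'f) tensor" where
  "tensor_class E F X =
     {Y \<in> tensor_cauchy E F. (\<lambda>n. fsum_dist E F (X n) (Y n)) \<longlonglongrightarrow> 0}"

definition tensor_rep :: "('e, 'f) tensor \<Rightarrow> nat \<Rightarrow> ('e \<times> 'f) list" where
  "tensor_rep A = (SOME X. X \<in> A)"

definition internal_tensor ::
  "('e, 'b::cstar_algebra) corr \<Rightarrow> ('f, 'b) corr \<Rightarrow> (('e, 'f) tensor, 'b) corr" where
  "internal_tensor E F =
     \<lparr>hcarrier = tensor_class E F ` tensor_cauchy E F,
      hzero = tensor_class E F (\<lambda>n. []),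
      hadd = (\<lambda>A B. tensor_class E F (\<lambda>n. tensor_rep A n @ tensor_rep B n)),
      ract = (\<lambda>A b. tensor_class E F (\<lambda>n. map (\<lambda>(x, y). (x, ract F y b)) (tensor_rep A n))),
      hinner = (\<lambda>A B. lim (\<lambda>n. fsum_inner E F (tensor_rep A n) (tensor_rep B n))),
      lact = (\<lambda>b A. tensor_class E F (\<lambda>n. map (\<lambda>(x, y). (lact E b x, y)) (tensor_rep A n)))\<rparr>"

definition elem_tensor ::
  "('e, 'b::cstar_algebra) corr \<Rightarrow> ('f, 'b) corr \<Rightarrow> 'e \<Rightarrow> 'f \<Rightarrow> ('e, 'f) tensor" where
  "elem_tensor E F x y = tensor_class E F (\<lambda>n. [(x, y)])"


section \<open>Product systems\<close>

text \<open>The fibres \<open>fibre P t\<close> have carriers in one common type, so the requirement that the fibre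
  at \<open>0\<close> is \<open>'b\<close> is expressed by a bilinear unitary \<open>base P\<close> from \<open>'b\<close> onto \<open>fibre P 0\<close>,
  which is part of the structure.\<close>

record ('e, 'b) prodsys =
  fibre :: "real \<Rightarrow> ('e, 'b) corr"
  base :: "'b \<Rightarrow> 'e"
  psu :: "real \<Rightarrow> real \<Rightarrow> ('e, 'e) tensor \<Rightarrow> 'e"

definition psmult :: "('e, 'b::cstar_algebra) prodsys \<Rightarrow> real \<Rightarrow> real \<Rightarrow> 'e \<Rightarrow> 'e \<Rightarrow> 'e" where
  "psmult P s t x y = psu P s t (elem_tensor (fibre P s) (fibre P t) x y)"

definition product_system :: "('e, 'b::cstar_algebra) prodsys \<Rightarrow> bool" where
  "product_system P \<longleftrightarrow>
     (\<forall>t\<ge>0. correspondence (fibre P t)) \<and>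
     (\<forall>s\<ge>0. \<forall>t\<ge>0. bilinear_unitary
        (internal_tensor (fibre P s) (fibre P t)) (fibre P (s + t)) (psu P s t)) \<and>
     (\<forall>r\<ge>0. \<forall>s\<ge>0. \<forall>t\<ge>0.
        \<forall>x\<in>hcarrier (fibre P r). \<forall>y\<in>hcarrier (fibre P s). \<forall>z\<in>hcarrier (fibre P t).
        psmult P (r + s) t (psmult P r s x y) z = psmult P r (s + t) x (psmult P s t y z)) \<and>
     bilinear_unitary self_corr (fibre P 0) (base P) \<and>
     (\<forall>t\<ge>0. \<forall>x\<in>hcarrier (fibre P t). \<forall>b.
        psmult P 0 t (base P b) x = lact (fibre P t) b x \<and>
        psmult P t 0 x (base P b) = ract (fibre P t) x b)"

definition ps_unit :: "('e, 'b::cstar_algebra) prodsys \<Rightarrow> (real \<Rightarrow> 'e) \<Rightarrow> bool" where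
  "ps_unit P \<xi> \<longleftrightarrow>
     (\<forall>t\<ge>0. \<xi> t \<in> hcarrier (fibre P t)) \<and>
     (\<forall>s\<ge>0. \<forall>t\<ge>0. psmult P s t (\<xi> s) (\<xi> t) = \<xi> (s + t)) \<and>
     \<xi> 0 = base P 1"

definition unital_unit :: "('e, 'b::cstar_algebra) prodsys \<Rightarrow> (real \<Rightarrow> 'e) \<Rightarrow> bool" where
  "unital_unit P \<xi> \<longleftrightarrow> ps_unit P \<xi> \<and> (\<forall>t\<ge>0. hinner (fibre P t) (\<xi> t) (\<xi> t) = 1)"

definition central_unit :: "('e, 'b::cstar_algebra) prodsys \<Rightarrow> (real \<Rightarrow> 'e) \<Rightarrow> bool" where
  "central_unit P \<xi> \<longleftrightarrow> ps_unit P \<xi> \<and>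
     (\<forall>t\<ge>0. \<forall>b. lact (fibre P t) b (\<xi> t) = ract (fibre P t) (\<xi> t) b)"


section \<open>Continuous and spatial product systems\<close>

definition cont_sections ::
  "('e, 'b::cstar_algebra) prodsys \<Rightarrow> ('h, 'b) hmod \<Rightarrow> (real \<Rightarrow> 'e \<Rightarrow> 'h) \<Rightarrow> (real \<Rightarrow> 'e) set" where
  "cont_sections P H i =
     {x. (\<forall>t\<ge>0. x t \<in> hcarrier (fibre P t)) \<and> norm_continuous_on H {0..} (\<lambda>t. i t (x t))}"

definition continuous_product_system ::
  "('e, 'b::cstar_algebra) prodsys \<Rightarrow> ('h, 'b) hmod \<Rightarrow> (real \<Rightarrow> 'e \<Rightarrow> 'h) \<Rightarrow> bool" where
  "continuous_product_system P H i \<longleftrightarrow>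
     product_system P \<and> hilbert_module H \<and>
     (\<forall>t\<ge>0. right_isometry (fibre P t) H (i t)) \<and>
     (\<forall>s\<ge>0. \<forall>y\<in>hcarrier (fibre P s). \<exists>x\<in>cont_sections P H i. x s = y) \<and>
     (\<forall>x\<in>cont_sections P H i. \<forall>y\<in>cont_sections P H i.
        norm_continuous_on H ({0..} \<times> {0..}) (\<lambda>(s, t). i (s + t) (psmult P s t (x s) (y t)))) \<and>
     (\<forall>x\<in>cont_sections P H i. \<forall>y\<in>cont_sections P H i. \<forall>b.
        continuous_on {0..} (\<lambda>t. hinner (fibre P t) (x t) (lact (fibre P t) b (y t))))"

definition continuous_spatial_product_system ::
  "('e, 'b::cstar_algebra) prodsys \<Rightarrow> ('h, 'b) hmod \<Rightarrow> (real \<Rightarrow> 'e \<Rightarrow> 'h) \<Rightarrow> bool" where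
  "continuous_spatial_product_system P H i \<longleftrightarrow> continuous_product_system P H i \<and>
     (\<exists>\<omega>\<in>cont_sections P H i. central_unit P \<omega> \<and> unital_unit P \<omega>)"


section \<open>GNS-systems and their embeddings\<close>

text \<open>For \<open>w = [(b\<^sub>n, t\<^sub>n), \<dots>, (b\<^sub>1, t\<^sub>1)]\<close>, the element \<open>b\<^sub>n \<xi>\<^sub>t\<^sub>n \<cdots> b\<^sub>1 \<xi>\<^sub>t\<^sub>1 b\<^sub>0\<close>.\<close>

primrec unit_word ::
  "('e, 'b::cstar_algebra) prodsys \<Rightarrow> (real \<Rightarrow> 'e) \<Rightarrow> 'b \<Rightarrow> ('b \<times> real) list \<Rightarrow> 'e" where
  "unit_word P \<xi> b0 [] = base P b0"
| "unit_word P \<xi> b0 (p # w) =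
     psmult P (snd p) (sum_list (map snd w))
       (lact (fibre P (snd p)) (fst p) (\<xi> (snd p))) (unit_word P \<xi> b0 w)"

definition generated_by :: "('e, 'b::cstar_algebra) prodsys \<Rightarrow> (real \<Rightarrow> 'e) \<Rightarrow> bool" where
  "generated_by P \<xi> \<longleftrightarrow> (\<forall>t>0. hcarrier (fibre P t) =
     closed_hspan (fibre P t)
       {unit_word P \<xi> b0 w | b0 w. (\<forall>p\<in>set w. snd p > 0) \<and> sum_list (map snd w) = t})"

definition gns_system ::
  "(real \<Rightarrow> 'b::cstar_algebra \<Rightarrow> 'b) \<Rightarrow> ('e, 'b) prodsys \<Rightarrow> (real \<Rightarrow> 'e) \<Rightarrow> bool" where
  "gns_system T P \<xi> \<longleftrightarrow> product_system P \<and> ps_unit P \<xi> \<and>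
     (\<forall>t\<ge>0. \<forall>b. T t b = hinner (fibre P t) (\<xi> t) (lact (fibre P t) b (\<xi> t))) \<and>
     generated_by P \<xi>"

definition gns_embedding ::
  "('e, 'b::cstar_algebra) prodsys \<Rightarrow> (real \<Rightarrow> 'e) \<Rightarrow>
   ('g, 'b) prodsys \<Rightarrow> ('h, 'b) hmod \<Rightarrow> (real \<Rightarrow> 'g \<Rightarrow> 'h) \<Rightarrow> (real \<Rightarrow> 'e \<Rightarrow> 'g) \<Rightarrow> bool" where
  "gns_embedding P \<xi> G H i v \<longleftrightarrow>
     (\<forall>t\<ge>0. bilinear_isometry (fibre P t) (fibre G t) (v t)) \<and>
     (\<forall>b. v 0 (base P b) = base G b) \<and>
     (\<forall>s\<ge>0. \<forall>t\<ge>0. \<forall>x\<in>hcarrier (fibre P s). \<forall>y\<in>hcarrier (fibre P t).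
        v (s + t) (psmult P s t x y) = psmult G s t (v s x) (v t y)) \<and>
     (\<lambda>t. v t (\<xi> t)) \<in> cont_sections G H i"

text \<open>The type arguments are the types in which the fibres of the continuous spatial product
  system and the ambient Hilbert module live, since an existential quantifier cannot range
  over types.\<close>

definition spatially_embeddable ::
  "'g itself \<Rightarrow> 'h itself \<Rightarrow> ('e, 'b::cstar_algebra) prodsys \<Rightarrow> (real \<Rightarrow> 'e) \<Rightarrow> bool" where
  "spatially_embeddable _ _ P \<xi> \<longleftrightarrow>
     (\<exists>(G :: ('g, 'b) prodsys) (H :: ('h, 'b) hmod) i v.
        continuous_spatial_product_system G H i \<and> gns_embedding P \<xi> G H i v)"

end

theory Submission
  imports Defs "HOL-Probability.Discrete_Topology"
begin

text \<open>If \<open>v\<close> embeds the GNS-system into a product system with central unital unit \<open>\<omega>\<close>, put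
  \<open>c\<^sub>t = \<langle>\<omega>\<^sub>t, v\<^sub>t \<xi>\<^sub>t\<rangle>\<close>. Since \<open>\<omega>\<close> is central and unital, the vector \<open>\<eta>\<^sub>t = v\<^sub>t \<xi>\<^sub>t - \<omega>\<^sub>t c\<^sub>t\<close> satisfies
  \<open>\<langle>\<eta>\<^sub>t, b \<eta>\<^sub>t\<rangle> = T\<^sub>t(b) - c\<^sub>t\<^sup>* b c\<^sub>t\<close>, so this map is completely positive.

  Conversely, given \<open>c\<close>, consider formal words \<open>b\<^sub>n \<zeta>\<^sub>n \<cdots> b\<^sub>1 \<zeta>\<^sub>1 d\<close>, each \<open>\<zeta>\<^sub>i\<close> being a member of a unit \<open>\<xi>\<close>
  or of a unit \<open>\<omega>\<close>. The rules \<open>\<langle>\<xi>\<^sub>t, b \<xi>\<^sub>t\<rangle> = T\<^sub>t(b)\<close>, \<open>\<langle>\<omega>\<^sub>t, b \<omega>\<^sub>t\<rangle> = b\<close> and \<open>\<langle>\<omega>\<^sub>t, b \<xi>\<^sub>t\<rangle> = b c\<^sub>t\<close> determine the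
  inner product of any two words of the same duration. It is positive because the matrix
  of maps with entries \<open>T\<^sub>t\<close>, \<open>c\<^sub>t\<^sup>* \<cdot>\<close>, \<open>\<cdot> c\<^sub>t\<close> and \<open>id\<close> is the sum of the positive matrix given by the
  row \<open>(c\<^sub>t, 1)\<close> and of \<open>T\<^sub>t - c\<^sub>t\<^sup>* \<cdot> c\<^sub>t\<close> in one corner. Multiplication by \<open>\<omega>\<close> on the right is isometric,
  so all fibres are submodules of a single Hilbert module, and continuity reduces to
  \<open>\<xi>\<^sub>\<epsilon> - \<omega>\<^sub>\<epsilon> \<rightarrow> 0\<close> for \<open>\<epsilon> \<rightarrow> 0\<close>, which holds because \<open>c\<close> is norm continuous.\<close>

section \<open>Positive elements of a C*-algebra\<close>

text \<open>Positivity means \<open>star b * b\<close> for an element and a square factorisation for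
  a matrix, and neither form is visibly stable under sums or limits. The cone is therefore first
  described by a norm condition, and square roots, also those of matrices over the algebra, come
  from one power series.

  Centrality of \<omega> makes x -> x \<omega> right linear, unitality makes it isometric; so time
  can be prolonged at the right end of a vector. At the left end this fails: \<omega>_r y is in
  general another vector than y. The product thus has to remember the level of its left factor,
  because x and x \<omega>_r are one vector of the common module while x y and x \<omega>_r y are
  not. Its joint continuity rests on \<omega>_r y -> y as r -> 0, which is obtained from the
  continuity of the two units. The norm continuity of c enters through the identity norm (\<xi>_r -
  \<omega>_r) ^ 2 = norm (T_r(1) - star c_r - c_r + 1).

  Hilbert modules and formal tensors are all mapped into Banach spaces of bounded functions, where
  limits can be taken; at the end these functions are coded in a type built from the algebra
  alone.\<close>

lemma star_zero [simp]: "star 0 = (0::'b::cstar_algebra)"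
proof -
  have "star 0 = star 0 + star (0::'b)" by (metis star_add add_0)
  then show ?thesis by simp
qed

lemma star_minus: "star (- x) = - star (x::'b::cstar_algebra)"
proof -
  have "star x + star (-x) = 0" by (simp add: star_add[symmetric])
  then show ?thesis by (simp add: eq_neg_iff_add_eq_0 add.commute)
qed

lemma star_diff: "star (x - y) = star x - star (y::'b::cstar_algebra)"
  using star_add[of x "-y"] by (simp add: star_minus)

lemma star_one [simp]: "star 1 = (1::'b::cstar_algebra)"
proof -
  have "star (star 1 * 1) = star 1 * star (star (1::'b))" by (metis star_mult star_star mult_1_right mult_1)
  then show ?thesis by (simp add: star_star)
qed

lemma star_sum: "star (sum f A) = (\<Sum>i\<in>A. star (f i :: 'b::cstar_algebra))"
  by (induction A rule: infinite_finite_induct) (auto simp: star_add)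

lemma star_scaleR: "star (r *\<^sub>R x) = r *\<^sub>R star (x::'b::cstar_algebra)"
  using star_scaleC[of "of_real r" x] by (simp add: scaleC_of_real)

lemma star_power: "star (x ^ n) = (star x :: 'b::cstar_algebra) ^ n"
  by (induction n) (auto simp: star_mult power_commutes)

lemma norm_star [simp]: "norm (star x) = norm (x::'b::cstar_algebra)"
proof -
  have le: "norm y \<le> norm (star y)" for y :: 'b
  proof (cases "y = 0")
    case False
    have "norm y * norm y \<le> norm (star y) * norm y"
      using norm_mult_ineq[of "star y" y] by (simp add: norm_star_mult power2_eq_square)
    then show ?thesis using False by simp
  qed simp
  show ?thesis using le[of x] le[of "star x"] by (simp add: star_star)
qed

lemma bounded_linear_star: "bounded_linear (star :: 'b::cstar_algebra \<Rightarrow> 'b)"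
  by (rule bounded_linear_intro[of _ 1]) (auto simp: star_add star_scaleR)

lemma norm_selfadjoint_square: "star x = x \<Longrightarrow> norm (x * x) = (norm (x::'b::cstar_algebra))\<^sup>2"
  using norm_star_mult[of x] by simp

lemma scaleC_zero_right [simp]: "z *\<^sub>C 0 = (0::'b::cstar_algebra)"
  using norm_scaleC[of z "0::'b"] by simp

lemma scaleC_one [simp]: "1 *\<^sub>C x = (x::'b::cstar_algebra)"
  using scaleC_of_real[of 1 x] by simp

lemma scaleC_minus_left: "(- z) *\<^sub>C x = - (z *\<^sub>C (x::'b::cstar_algebra))"
proof -
  have "z *\<^sub>C x + (-z) *\<^sub>C x = 0"
    using scaleC_of_real[of 0 x] by (simp add: scaleC_add_left[symmetric])
  then show ?thesis by (simp add: eq_neg_iff_add_eq_0 add.commute)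
qed

lemma scaleC_minus_right: "z *\<^sub>C (- x) = - (z *\<^sub>C (x::'b::cstar_algebra))"
proof -
  have "z *\<^sub>C x + z *\<^sub>C (- x) = 0"
    by (simp add: scaleC_add_right[symmetric])
  then show ?thesis by (simp add: eq_neg_iff_add_eq_0 add.commute)
qed

lemma scaleC_diff_right: "z *\<^sub>C (x - y) = z *\<^sub>C x - z *\<^sub>C (y::'b::cstar_algebra)"
  using scaleC_add_right[of z x "-y"] by (simp add: scaleC_minus_right)

text \<open>The power series coefficients of \<open>1 - sqrt (1 - x)\<close>.\<close>

function sqrt_coeff :: "nat \<Rightarrow> real" where
  "sqrt_coeff n = (if n = 0 then 0 else if n = 1 then 1/2
     else (\<Sum>i\<in>{1..<n}. sqrt_coeff i * sqrt_coeff (n - i)) / 2)"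
  by pat_completeness auto
termination by (relation "Wellfounded.measure id") auto

declare sqrt_coeff.simps [simp del]

lemma sqrt_coeff_nonneg: "sqrt_coeff n \<ge> 0"
proof (induction n rule: less_induct)
  case (less n)
  then show ?case
    by (subst sqrt_coeff.simps) (auto intro!: sum_nonneg mult_nonneg_nonneg)
qed

lemma sqrt_coeff_0 [simp]: "sqrt_coeff 0 = 0" by (simp add: sqrt_coeff.simps)

text \<open>For the power series f with these coefficients this is f^2 = 2 f - x, that is, (1 - f)^2
  = 1 - x.\<close>

lemma sqrt_coeff_convolution:
  "(\<Sum>i\<le>n. sqrt_coeff i * sqrt_coeff (n - i)) = 2 * sqrt_coeff n - of_bool (n = 1)"
proof (cases "n \<le> 1")
  case True
  then consider "n = 0" | "n = 1" by linarith
  then show ?thesis by cases (auto simp: sqrt_coeff.simps)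
next
  case False
  have "(\<Sum>i\<le>n. sqrt_coeff i * sqrt_coeff (n - i)) = (\<Sum>i\<in>{1..<n}. sqrt_coeff i * sqrt_coeff (n - i))"
  proof (rule sum.mono_neutral_right)
    show "\<forall>i\<in>{..n} - {1..<n}. sqrt_coeff i * sqrt_coeff (n - i) = 0"
    proof
      fix i assume "i \<in> {..n} - {1..<n}"
      then have "i = 0 \<or> i = n" by auto
      then show "sqrt_coeff i * sqrt_coeff (n - i) = 0" by auto
    qed
  qed auto
  then show ?thesis using False by (subst (3) sqrt_coeff.simps) auto
qed

text \<open>By the convolution identity, twice the sum up to n + 1 is 1 plus the sum of all products
  of coefficients with i + j <= n + 1. As the coefficient at 0 vanishes, both indices may be taken
  <= n, so the double sum is at most the square of the previous partial sum, hence at most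
  1.\<close>

lemma sqrt_coeff_partial_sum: "(\<Sum>k\<le>n. sqrt_coeff k) \<le> 1"
proof (induction n)
  case (Suc n)
  let ?A = "{(i,j). i + j \<le> Suc n}"
  have fin: "finite ?A"
    by (rule finite_subset[of _ "{..Suc n} \<times> {..Suc n}"]) auto
  have "2 * (\<Sum>k\<le>Suc n. sqrt_coeff k)
      = (\<Sum>k\<le>Suc n. (\<Sum>i\<le>k. sqrt_coeff i * sqrt_coeff (k - i)) + of_bool (k = 1))"
    unfolding sqrt_coeff_convolution by (simp add: sum_distrib_left)
  also have "\<dots> = (\<Sum>k\<le>Suc n. \<Sum>i\<le>k. sqrt_coeff i * sqrt_coeff (k - i)) + (\<Sum>k\<le>Suc n. of_bool (k = 1))"
    by (rule sum.distrib)
  also have "(\<Sum>k\<le>Suc n. of_bool (k = 1)) = (1::real)" by simp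
  also have "(\<Sum>k\<le>Suc n. \<Sum>i\<le>k. sqrt_coeff i * sqrt_coeff (k - i)) = (\<Sum>(i,j)\<in>?A. sqrt_coeff i * sqrt_coeff j)"
    by (rule sum.triangle_reindex_eq[symmetric])
  also have "\<dots> \<le> (\<Sum>(i,j)\<in>{..n}\<times>{..n}. sqrt_coeff i * sqrt_coeff j)"
  proof -
    have "(\<Sum>(i,j)\<in>?A. sqrt_coeff i * sqrt_coeff j) = (\<Sum>(i,j)\<in>?A \<inter> {..n}\<times>{..n}. sqrt_coeff i * sqrt_coeff j)"
    proof (rule sum.mono_neutral_right[OF fin])
      show "\<forall>p\<in>?A - ?A \<inter> {..n}\<times>{..n}. (case p of (i,j) \<Rightarrow> sqrt_coeff i * sqrt_coeff j) = 0"
      proof clarify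
        fix i j assume "i + j \<le> Suc n" "(i,j) \<notin> ?A \<inter> {..n}\<times>{..n}"
        then have "i = 0 \<or> j = 0" by auto
        then show "sqrt_coeff i * sqrt_coeff j = 0" by auto
      qed
    qed auto
    also have "\<dots> \<le> (\<Sum>(i,j)\<in>{..n}\<times>{..n}. sqrt_coeff i * sqrt_coeff j)"
      by (rule sum_mono2) (auto simp: sqrt_coeff_nonneg)
    finally show ?thesis .
  qed
  also have "\<dots> = (\<Sum>k\<le>n. sqrt_coeff k) * (\<Sum>k\<le>n. sqrt_coeff k)"
    by (simp add: sum_product sum.cartesian_product)
  also have "\<dots> \<le> 1 * 1"
    by (intro mult_mono Suc) (auto intro: sum_nonneg sqrt_coeff_nonneg)
  finally show ?case by simp
qed simp

lemma summable_sqrt_coeff: "summable sqrt_coeff"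
  and suminf_sqrt_coeff_le: "suminf sqrt_coeff \<le> 1"
proof -
  have b: "(\<Sum>k<n. sqrt_coeff k) \<le> 1" for n
    using sqrt_coeff_partial_sum[of n] sum_mono2[of "{..n}" "{..<n}" sqrt_coeff] sqrt_coeff_nonneg
    by fastforce
  show s: "summable sqrt_coeff"
    by (rule summableI_nonneg_bounded[OF sqrt_coeff_nonneg b])
  show "suminf sqrt_coeff \<le> 1"
    by (rule suminf_le_const[OF s b])
qed

text \<open>The Taylor coefficients of sqrt (1 - x) itself.\<close>

definition sqrt_series :: "nat \<Rightarrow> real" where
  "sqrt_series k = of_bool (k = 0) - sqrt_coeff k"

lemma sqrt_series_convolution:
  "(\<Sum>i\<le>n. sqrt_series i * sqrt_series (n - i)) = of_bool (n = 0) - of_bool (n = 1)"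
proof -
  have 1: "(\<Sum>i\<le>n. (of_bool (i = 0)::real) * of_bool (n - i = 0)) = of_bool (n = 0)"
    by (simp add: of_bool_def if_distrib if_distribR sum.delta cong: if_cong)
  have 2: "(\<Sum>i\<le>n. (of_bool (i = 0)::real) * sqrt_coeff (n - i)) = sqrt_coeff n"
    by (simp add: of_bool_def if_distrib if_distribR sum.delta cong: if_cong)
  have 3: "(\<Sum>i\<le>n. sqrt_coeff i * (of_bool (n - i = 0)::real)) = sqrt_coeff n"
  proof -
    have "(\<Sum>i\<le>n. sqrt_coeff i * (of_bool (n - i = 0)::real)) = (\<Sum>i\<le>n. if i = n then sqrt_coeff i else 0)"
      by (rule sum.cong) auto
    then show ?thesis by simp
  qed
  have "(\<Sum>i\<le>n. sqrt_series i * sqrt_series (n - i)) =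
     (\<Sum>i\<le>n. of_bool (i = 0) * of_bool (n - i = 0)) - (\<Sum>i\<le>n. of_bool (i = 0) * sqrt_coeff (n - i))
     - (\<Sum>i\<le>n. sqrt_coeff i * of_bool (n - i = 0)) + (\<Sum>i\<le>n. sqrt_coeff i * sqrt_coeff (n - i))"
    by (simp add: sqrt_series_def algebra_simps sum.distrib sum_subtractf)
  then show ?thesis using 1 2 3 sqrt_coeff_convolution[of n] by simp
qed

lemma summable_sqrt_series: "summable (\<lambda>k. \<bar>sqrt_series k\<bar>)"
proof (rule summable_comparison_test)
  show "\<exists>N. \<forall>n\<ge>N. norm \<bar>sqrt_series n\<bar> \<le> sqrt_coeff n"
    by (rule exI[of _ 1]) (auto simp: sqrt_series_def sqrt_coeff_nonneg)
qed (rule summable_sqrt_coeff)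

lemma summable_norm_sqrt_series:
  fixes p :: "nat \<Rightarrow> 'b::cstar_algebra"
  assumes "\<And>k. norm (p k) \<le> 1"
  shows "summable (\<lambda>k. norm (sqrt_series k *\<^sub>R p k))"
  by (rule summable_comparison_test[OF _ summable_sqrt_series])
     (auto intro!: exI[of _ 0] mult_left_le assms)

text \<open>For \<open>n = 1\<close> this is the power series of the square root in the algebra itself.\<close>

lemma matrix_sqrt:
  fixes P :: "nat \<Rightarrow> nat \<Rightarrow> nat \<Rightarrow> 'b::cstar_algebra"
  assumes mult: "\<And>k m i j. i < n \<Longrightarrow> j < n \<Longrightarrow> (\<Sum>l<n. P k i l * P m l j) = P (k + m) i j"
    and bound: "\<And>k i j. i < n \<Longrightarrow> j < n \<Longrightarrow> norm (P k i j) \<le> 1"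
    and "i < n" "j < n"
  defines "S \<equiv> \<lambda>i j. \<Sum>k. sqrt_series k *\<^sub>R P k i j"
  shows "(\<Sum>l<n. S i l * S l j) = P 0 i j - P 1 i j"
proof -
  let ?s = sqrt_series
  have "(\<lambda>k. \<Sum>m\<le>k. (?s m *\<^sub>R P m i l) * (?s (k - m) *\<^sub>R P (k - m) l j)) sums (S i l * S l j)" if "l < n" for l
    unfolding S_def using that assms(3,4)
    by (intro Cauchy_product_sums summable_norm_sqrt_series bound)
  then have "(\<lambda>k. \<Sum>l<n. \<Sum>m\<le>k. (?s m *\<^sub>R P m i l) * (?s (k - m) *\<^sub>R P (k - m) l j)) sums (\<Sum>l<n. S i l * S l j)"
    by (intro sums_sum) auto
  moreover have "(\<Sum>l<n. \<Sum>m\<le>k. (?s m *\<^sub>R P m i l) * (?s (k - m) *\<^sub>R P (k - m) l j))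
      = (of_bool (k = 0) - of_bool (k = 1)) *\<^sub>R P k i j" for k
  proof -
    have "(\<Sum>l<n. \<Sum>m\<le>k. (?s m *\<^sub>R P m i l) * (?s (k - m) *\<^sub>R P (k - m) l j))
      = (\<Sum>m\<le>k. \<Sum>l<n. (?s m *\<^sub>R P m i l) * (?s (k - m) *\<^sub>R P (k - m) l j))"
      by (rule sum.swap)
    also have "\<dots> = (\<Sum>m\<le>k. (?s m * ?s (k - m)) *\<^sub>R (\<Sum>l<n. P m i l * P (k - m) l j))"
      by (simp add: scaleR_sum_right mult.commute)
    also have "\<dots> = (\<Sum>m\<le>k. (?s m * ?s (k - m)) *\<^sub>R P k i j)"
      using assms(3,4) by (intro sum.cong) (auto simp: mult)
    also have "\<dots> = (\<Sum>m\<le>k. ?s m * ?s (k - m)) *\<^sub>R P k i j"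
      by (simp add: scaleR_sum_left)
    finally show ?thesis by (simp only: sqrt_series_convolution)
  qed
  ultimately have 1: "(\<lambda>k. (of_bool (k = 0) - of_bool (k = 1)) *\<^sub>R P k i j) sums (\<Sum>l<n. S i l * S l j)"
    by simp
  have "(\<lambda>k. (of_bool (k = 0) - of_bool (k = 1)) *\<^sub>R P k i j) sums
     (\<Sum>k\<in>{0,1}. (of_bool (k = 0) - of_bool (k = 1)) *\<^sub>R P k i j)"
    by (rule sums_finite) auto
  then have 2: "(\<lambda>k. (of_bool (k = 0) - of_bool (k = 1)) *\<^sub>R P k i j) sums (P 0 i j - P 1 i j)" by simp
  show ?thesis using sums_unique2[OF 1 2] .
qed

text \<open>The coefficients of 1 - s are nonnegative with sum at most 1, which gives the norm
  bound; through it the root turns out to be positive as well. Whatever commutes with x commutes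
  with s, a limit of polynomials in x.\<close>

lemma sqrt_one_minus:
  assumes x: "norm (x::'b::cstar_algebra) \<le> 1" "star x = x"
  obtains s where "star s = s" "s * s = 1 - x" "norm (1 - s) \<le> 1"
    "\<And>y. y * x = x * y \<Longrightarrow> y * s = s * y"
proof -
  define s where "s = (\<Sum>k. sqrt_series k *\<^sub>R x ^ k)"
  have pow: "norm (x ^ k) \<le> 1" for k
    using norm_power_ineq[of x k] power_le_one[of "norm x" k] x by simp
  have summ: "summable (\<lambda>k. sqrt_series k *\<^sub>R x ^ k)"
    by (rule summable_norm_cancel[OF summable_norm_sqrt_series[OF pow]])
  have 1: "star s = s"
    unfolding s_def bounded_linear.suminf[OF bounded_linear_star summ]
    by (simp add: star_scaleR star_power x)
  have "(\<Sum>l<1::nat. s * s) = x ^ 0 - x ^ 1"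
    unfolding s_def by (rule matrix_sqrt[where n = 1 and P = "\<lambda>k i j. x ^ k" and i = 0 and j = 0])
      (auto simp: pow power_add)
  then have 2: "s * s = 1 - x" by simp
  have 3: "y * s = s * y" if "y * x = x * y" for y
  proof -
    have c: "y * x ^ k = x ^ k * y" for k
      by (induction k) (simp_all, metis mult.assoc that)
    show ?thesis
      unfolding s_def bounded_linear.suminf[OF bounded_linear_mult_right summ]
        bounded_linear.suminf[OF bounded_linear_mult_left summ]
      by (simp add: c)
  qed
  have sc: "summable (\<lambda>k. norm (sqrt_coeff k *\<^sub>R x ^ k))"
    by (rule summable_comparison_test[OF _ summable_sqrt_coeff])
      (auto intro!: exI[of _ 0] mult_left_le pow sqrt_coeff_nonneg simp: abs_mult abs_of_nonneg[OF sqrt_coeff_nonneg])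
  have "(\<lambda>k. of_bool (k = 0) *\<^sub>R x ^ k - sqrt_series k *\<^sub>R x ^ k) sums (1 - s)"
    unfolding s_def
    by (rule sums_diff[OF _ summable_sums[OF summ]])
       (use sums_finite[of "{0}" "\<lambda>k. of_bool (k = 0) *\<^sub>R x ^ k"] in auto)
  then have "1 - s = (\<Sum>k. sqrt_coeff k *\<^sub>R x ^ k)"
    by (simp add: sums_iff sqrt_series_def algebra_simps)
  then have "norm (1 - s) \<le> (\<Sum>k. norm (sqrt_coeff k *\<^sub>R x ^ k))"
    using summable_norm[OF sc] by simp
  also have "\<dots> \<le> (\<Sum>k. sqrt_coeff k)"
    by (rule suminf_le[OF _ sc summable_sqrt_coeff])
      (auto intro!: mult_left_le pow sqrt_coeff_nonneg simp: abs_of_nonneg[OF sqrt_coeff_nonneg])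
  also have "\<dots> \<le> 1" by (rule suminf_sqrt_coeff_le)
  finally show ?thesis using that 1 2 3 by blast
qed

text \<open>The hypothesis puts a into the ball of radius t around t, so 1 - a / t is a self-adjoint
  contraction, and the root found for it is rescaled. The root lies in the ball of radius sqrt t
  around sqrt t, which is the same condition again.\<close>

lemma sqrt_exists:
  assumes "star (a::'b::cstar_algebra) = a" "norm (t *\<^sub>R 1 - a) \<le> t"
  obtains s where "star s = s" "s * s = a" "norm (sqrt t *\<^sub>R 1 - s) \<le> sqrt t"
    "\<And>y. y * a = a * y \<Longrightarrow> y * s = s * y"
proof (cases "t = 0")
  case True
  then have "a = 0" using assms by simp
  then show ?thesis using that[of 0] True by simp
next
  case False
  then have t: "t > 0" using assms(2) norm_ge_zero[of "t *\<^sub>R 1 - a"] by linarith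
  define x where "x = 1 - (1/t) *\<^sub>R a"
  have "x = (1/t) *\<^sub>R (t *\<^sub>R 1 - a)" using t by (simp add: x_def scaleR_diff_right)
  then have "norm x \<le> 1" using assms(2) t by simp
  moreover have "star x = x" by (simp add: x_def star_diff star_scaleR assms(1))
  ultimately obtain s where s: "star s = s" "s * s = 1 - x" "norm (1 - s) \<le> 1"
    "\<And>y. y * x = x * y \<Longrightarrow> y * s = s * y" by (blast intro: sqrt_one_minus)
  show ?thesis
  proof (rule that[of "sqrt t *\<^sub>R s"])
    show "star (sqrt t *\<^sub>R s) = sqrt t *\<^sub>R s" by (simp add: star_scaleR s(1))
    show "(sqrt t *\<^sub>R s) * (sqrt t *\<^sub>R s) = a"
      using t by (simp add: s(2)) (simp add: x_def)
    have "sqrt t *\<^sub>R 1 - sqrt t *\<^sub>R s = sqrt t *\<^sub>R (1 - s)" by (simp add: scaleR_diff_right)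
    then show "norm (sqrt t *\<^sub>R 1 - sqrt t *\<^sub>R s) \<le> sqrt t" using s(3) t by (simp add: mult_left_le)
    fix y assume "y * a = a * y"
    then have "y * x = x * y" by (simp add: x_def algebra_simps)
    from s(4)[OF this] show "y * (sqrt t *\<^sub>R s) = (sqrt t *\<^sub>R s) * y" by simp
  qed
qed

text \<open>Pairs of commuting self-adjoint \<open>c\<close>, \<open>s\<close> with \<open>c\<^sup>2 + s\<^sup>2 = r\<close> are real and imaginary part
  of the multiple \<open>c + \<i>s\<close> of a unitary.\<close>

lemma norm_le_of_square_sum:
  assumes "star (c::'b::cstar_algebra) = c" "star s = s" "c * s = s * c" "c * c + s * s = r *\<^sub>R 1"
  shows "(norm c)\<^sup>2 \<le> \<bar>r\<bar>" "(norm s)\<^sup>2 \<le> \<bar>r\<bar>"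
proof -
  define u where "u = c + \<i> *\<^sub>C s"
  have su: "star u = c - \<i> *\<^sub>C s"
    by (simp add: u_def star_add star_scaleC assms scaleC_minus_left)
  have i: "\<i> *\<^sub>C \<i> *\<^sub>C y = - y" for y :: 'b
    by (simp add: scaleC_scaleC scaleC_minus_left)
  have "star u * u = c * c + s * s"
    by (simp only: su) (simp add: u_def algebra_simps mult_scaleC_left mult_scaleC_right
        scaleC_add_right scaleC_diff_right assms(3) i)
  then have nu: "(norm u)\<^sup>2 = \<bar>r\<bar>"
    using norm_star_mult[of u] assms(4) by simp
  have "2 *\<^sub>R c = u + star u" by (simp only: su) (simp add: u_def scaleR_2)
  then have "norm (2 *\<^sub>R c) \<le> norm u + norm u" using norm_triangle_ineq[of u "star u"] by simp
  then have "norm c \<le> norm u" by simp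
  then show "(norm c)\<^sup>2 \<le> \<bar>r\<bar>" unfolding nu[symmetric] by (rule power_mono) simp
  have "2 *\<^sub>R (\<i> *\<^sub>C s) = u - star u" by (simp only: su) (simp add: u_def scaleR_2)
  then have "norm (2 *\<^sub>R (\<i> *\<^sub>C s)) \<le> norm u + norm u" using norm_triangle_ineq4[of u "star u"] by simp
  then have "norm s \<le> norm u" by (simp add: norm_scaleC)
  then show "(norm s)\<^sup>2 \<le> \<bar>r\<bar>" unfolding nu[symmetric] by (rule power_mono) simp
qed

section \<open>The cone of positive elements, described by the norm\<close>

text \<open>For self-adjoint a the norm condition says that the spectrum is contained in
  [0, norm a]. In this form sums cause no difficulty and square roots are at hand;
  \<open>positive_iff_nonneg\<close> identifies it with the form \<open>star b * b\<close>.\<close>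

definition nonneg :: "'b::cstar_algebra \<Rightarrow> bool" where
  "nonneg a \<longleftrightarrow> star a = a \<and> norm (norm a *\<^sub>R 1 - a) \<le> norm a"

text \<open>Normalise c to d and take the root s of 1 - d^2. It commutes with d and d^2 + s^2 = 1,
  so d + i s is unitary, s is a contraction, and so is s^2 = 1 - d^2.\<close>

lemma nonneg_square:
  assumes "star c = c" shows "nonneg (c * c)"
proof (cases "c = 0")
  case False
  define x where "x = (1 / (norm c)\<^sup>2) *\<^sub>R (c * c)"
  have nc: "norm (c * c) = (norm c)\<^sup>2" by (rule norm_selfadjoint_square[OF assms])
  have "norm x \<le> 1" "star x = x"
    using False by (auto simp: x_def nc star_scaleR star_mult assms)
  then obtain s where s: "star s = s" "s * s = 1 - x" "\<And>y. y * x = x * y \<Longrightarrow> y * s = s * y"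
    by (blast intro: sqrt_one_minus)
  define d where "d = (1 / norm c) *\<^sub>R c"
  have dd: "d * d = x" by (simp add: d_def x_def power2_eq_square)
  have "d * x = x * d" by (simp add: dd[symmetric] mult.assoc)
  then have ds: "d * s = s * d" by (rule s(3))
  have "star d = d" by (simp add: d_def star_scaleR assms)
  then have "(norm s)\<^sup>2 \<le> \<bar>1\<bar>"
    by (rule norm_le_of_square_sum(2)[OF _ s(1) ds]) (simp add: dd s(2))
  then have "norm (1 - x) \<le> 1" using norm_selfadjoint_square[OF s(1)] s(2) by simp
  moreover have "(norm c)\<^sup>2 *\<^sub>R 1 - c * c = (norm c)\<^sup>2 *\<^sub>R (1 - x)"
    using False by (simp add: x_def scaleR_diff_right)
  ultimately have "norm ((norm c)\<^sup>2 *\<^sub>R 1 - c * c) \<le> (norm c)\<^sup>2" by (simp add: mult_left_le)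
  then show ?thesis by (simp add: nonneg_def nc star_mult assms)
qed (simp add: nonneg_def)

text \<open>Any radius t will do in place of norm a, because a then has a self-adjoint square
  root.\<close>

lemma nonnegI:
  assumes "star a = a" "norm (t *\<^sub>R 1 - a) \<le> t" shows "nonneg a"
  by (rule sqrt_exists[OF assms]) (use nonneg_square in blast)

lemma nonneg_norm_diff: "nonneg (a::'b::cstar_algebra) \<Longrightarrow> norm a \<le> t \<Longrightarrow> norm (t *\<^sub>R 1 - a) \<le> t"
proof -
  assume a: "nonneg a" "norm a \<le> t"
  have "t *\<^sub>R 1 - a = (t - norm a) *\<^sub>R 1 + (norm a *\<^sub>R 1 - a)" by (simp add: algebra_simps)
  then have "norm (t *\<^sub>R 1 - a) \<le> norm ((t - norm a) *\<^sub>R (1::'b)) + norm (norm a *\<^sub>R 1 - a)"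
    by (simp only: norm_triangle_ineq)
  then show ?thesis using a by (simp add: nonneg_def)
qed

lemma nonneg_selfadjoint: "nonneg a \<Longrightarrow> star a = a" by (simp add: nonneg_def)

lemma nonneg_sqrt:
  assumes "nonneg a"
  obtains s where "nonneg s" "star s = s" "s * s = a" "\<And>y. y * a = a * y \<Longrightarrow> y * s = s * y"
proof -
  have "star a = a" "norm (norm a *\<^sub>R 1 - a) \<le> norm a" using assms by (auto simp: nonneg_def)
  then obtain s where s: "star s = s" "s * s = a" "norm (sqrt (norm a) *\<^sub>R 1 - s) \<le> sqrt (norm a)"
    "\<And>y. y * a = a * y \<Longrightarrow> y * s = s * y" using sqrt_exists by blast
  then show ?thesis using that nonnegI by blast
qed

lemma nonneg_add:
  assumes "nonneg a" "nonneg b" shows "nonneg (a + b)"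
proof (rule nonnegI)
  show "star (a + b) = a + b" using assms by (simp add: star_add nonneg_def)
  have "(norm a + norm b) *\<^sub>R 1 - (a + b) = (norm a *\<^sub>R 1 - a) + (norm b *\<^sub>R 1 - b)"
    by (simp add: algebra_simps)
  then have "norm ((norm a + norm b) *\<^sub>R 1 - (a + b)) \<le> norm (norm a *\<^sub>R 1 - a) + norm (norm b *\<^sub>R 1 - b)"
    by (simp only: norm_triangle_ineq)
  then show "norm ((norm a + norm b) *\<^sub>R 1 - (a + b)) \<le> norm a + norm b"
    using assms by (simp add: nonneg_def)
qed

lemma nonneg_scaleR:
  assumes "nonneg a" "r \<ge> 0" shows "nonneg (r *\<^sub>R a)"
proof (rule nonnegI)
  show "star (r *\<^sub>R a) = r *\<^sub>R a" using assms by (simp add: star_scaleR nonneg_def)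
  have "(r * norm a) *\<^sub>R 1 - r *\<^sub>R a = r *\<^sub>R (norm a *\<^sub>R 1 - a)" by (simp add: algebra_simps)
  then show "norm ((r * norm a) *\<^sub>R 1 - r *\<^sub>R a) \<le> r * norm a"
    using assms by (simp add: nonneg_def mult_left_mono)
qed

lemma nonneg_norm_minus:
  assumes "star a = a" "norm a \<le> r" shows "nonneg (r *\<^sub>R 1 - a)"
  by (rule nonnegI[where t = r]) (auto simp: star_diff star_scaleR assms)

text \<open>The root of r - a commutes with a, hence with the root of a, and the two squares add up
  to r: real and imaginary part of a multiple of a unitary.\<close>

lemma nonneg_norm_le:
  assumes "nonneg a" "nonneg (r *\<^sub>R 1 - a)" "r \<ge> 0"
  shows "norm a \<le> r"
proof -
  obtain s where s: "star s = s" "s * s = a" "\<And>y. y * a = a * y \<Longrightarrow> y * s = s * y"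
    using nonneg_sqrt[OF assms(1)] by metis
  obtain v where v: "star v = v" "v * v = r *\<^sub>R 1 - a" using nonneg_sqrt[OF assms(2)] by metis
  have a: "a = r *\<^sub>R 1 - v * v" using v by simp
  have "v * a = a * v" unfolding a by (simp add: algebra_simps)
  then have "s * v = v * s" using s(3) by metis
  then have "(norm s)\<^sup>2 \<le> \<bar>r\<bar>" by (rule norm_le_of_square_sum(1)[OF s(1) v(1)]) (simp add: s(2) v(2))
  then show ?thesis using assms(3) norm_selfadjoint_square[OF s(1)] s(2) by simp
qed

lemma nonneg_norm_mono:
  assumes "nonneg a" "nonneg (b - a)" shows "norm a \<le> norm b"
proof (rule nonneg_norm_le[OF assms(1)])
  have "nonneg b" using nonneg_add[OF assms] by simp
  then have "nonneg (norm b *\<^sub>R 1 - b)" by (intro nonneg_norm_minus) (auto simp: nonneg_def)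
  from nonneg_add[OF this assms(2)] show "nonneg (norm b *\<^sub>R 1 - a)" by simp
qed simp

lemma nonneg_power:
  assumes "nonneg p" shows "nonneg (p ^ k)"
proof -
  obtain s where s: "star s = s" "s * s = p" using nonneg_sqrt[OF assms] by metis
  have "p ^ k = s ^ k * s ^ k"
    unfolding s(2)[symmetric] power2_eq_square[symmetric] power_mult[symmetric]
    by (simp only: mult_2 mult_2_right power_add[symmetric])
  then show ?thesis using nonneg_square[of "s ^ k"] by (simp add: star_power s)
qed

text \<open>If \<open>d\<^sup>*d = -p\<close> with \<open>p \<ge> 0\<close>, then \<open>q = dd\<^sup>* = 2x\<^sup>2 + 2y\<^sup>2 + p\<close> is nonnegative, too
  (\<open>x\<close>, \<open>y\<close> being real and imaginary part of \<open>d\<close>). Now \<open>(1 - q/t) d = d (1 + p/t)\<close> and iterating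
  this, the left-hand side remains bounded while the right-hand side does not, unless \<open>p = 0\<close>.\<close>

lemma nonneg_minus_star_mult:
  assumes "nonneg (- (star d * d))" shows "d = 0"
proof -
  define p where "p = - (star d * d)"
  define q where "q = d * star d"
  have p: "nonneg p" using assms by (simp add: p_def)
  define x where "x = (1/2) *\<^sub>R (d + star d)"
  define y where "y = (- \<i> / 2) *\<^sub>C (d - star d)"
  have sx: "star x = x" by (simp add: x_def star_scaleR star_add star_star add.commute)
  have sy: "star y = y"
    by (simp add: y_def star_scaleC star_diff star_star scaleC_diff_right scaleC_minus_left)
  have xx: "x * x = (1/4) *\<^sub>R (d * d + d * star d + star d * d + star d * star d)"
    by (simp add: x_def algebra_simps)
  have "y * y = ((- \<i> / 2) * (- \<i> / 2)) *\<^sub>C ((d - star d) * (d - star d))"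
    by (simp add: y_def mult_scaleC_left mult_scaleC_right scaleC_scaleC)
  also have "(- \<i> / 2) * (- \<i> / 2) = complex_of_real (- 1 / 4)" by simp
  finally have yy: "y * y = (- 1/4) *\<^sub>R (d * d - d * star d - star d * d + star d * star d)"
    unfolding scaleC_of_real by (simp add: algebra_simps)
  have "2 *\<^sub>R (x * x) + 2 *\<^sub>R (y * y) =
      (1/2) *\<^sub>R ((d * d + d * star d + star d * d + star d * star d)
        - (d * d - d * star d - star d * d + star d * star d))"
    unfolding xx yy scaleR_right_diff_distrib[of "1/2"] by simp
  also have "(d * d + d * star d + star d * d + star d * star d)
      - (d * d - d * star d - star d * d + star d * star d) = 2 *\<^sub>R (q - p)"
    by (simp add: p_def q_def scaleR_2)
  finally have "2 *\<^sub>R (x * x) + 2 *\<^sub>R (y * y) = q - p" by simp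
  then have q_eq: "q = 2 *\<^sub>R (x * x) + 2 *\<^sub>R (y * y) + p" by simp
  have q: "nonneg q" unfolding q_eq by (intro nonneg_add nonneg_scaleR nonneg_square sx sy p) auto
  \<comment> \<open>The summand 1 keeps the denominator t positive even for q = 0.\<close>
  define t where "t = norm q + 1"
  have t: "t > 0" by (simp add: t_def add_nonneg_pos)
  define r where "r = 1 - (1/t) *\<^sub>R q"
  define e where "e = 1 + (1/t) *\<^sub>R p"
  have "r = (1/t) *\<^sub>R (t *\<^sub>R 1 - q)" using t by (simp add: r_def scaleR_diff_right)
  then have r: "norm r \<le> 1" using nonneg_norm_diff[OF q, of t] t by (simp add: t_def)
  have rd: "r * d = d * e"
    by (simp add: r_def e_def p_def q_def algebra_simps mult.assoc)
  have rdn: "r ^ n * d = d * e ^ n" for n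
  proof (induction n)
    case (Suc n)
    have "r ^ Suc n * d = r ^ n * (r * d)" by (metis mult.assoc power_Suc2)
    also have "\<dots> = (r ^ n * d) * e" by (simp add: rd mult.assoc)
    also have "\<dots> = d * e ^ Suc n" by (simp only: Suc mult.assoc power_Suc2)
    finally show ?case .
  qed simp
  have bound: "norm (d * e ^ n) \<le> norm d" for n
  proof -
    have "norm (d * e ^ n) \<le> norm (r ^ n) * norm d" by (metis rdn norm_mult_ineq)
    moreover have "norm (r ^ n) \<le> 1"
      using norm_power_ineq[of r n] power_le_one[of "norm r" n] r by simp
    ultimately show ?thesis using mult_right_mono[of "norm (r ^ n)" 1 "norm d"] by simp
  qed
  have se: "star e = e" by (simp add: e_def star_add star_scaleR nonneg_selfadjoint[OF p])
  have pe: "p * e = e * p" by (simp add: e_def algebra_simps)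
  have pen: "e ^ n * p = p * e ^ n" for n
    by (induction n) (simp_all, metis mult.assoc pe)
  have z: "norm (p * e ^ (2 * n)) \<le> (norm d)\<^sup>2" for n
  proof -
    have "star (d * e ^ n) * (d * e ^ n) = - (e ^ n * p * e ^ n)"
      by (simp add: star_mult star_power se p_def mult.assoc)
    also have "\<dots> = - (p * e ^ (2 * n))"
      by (simp add: pen mult.assoc mult_2 power_add)
    finally have "norm (p * e ^ (2 * n)) = (norm (d * e ^ n))\<^sup>2"
      by (metis norm_star_mult norm_minus_cancel)
    also have "\<dots> \<le> (norm d)\<^sup>2" by (intro power_mono bound) simp
    finally show ?thesis .
  qed
  have step: "p ^ k * e ^ Suc n = p ^ k * e ^ n + (1/t) *\<^sub>R (p ^ Suc k * e ^ n)" for k n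
  proof -
    have "p ^ k * e ^ Suc n = p ^ k * e ^ n + (1/t) *\<^sub>R (p ^ k * (e ^ n * p))"
      by (simp add: power_Suc2 e_def algebra_simps del: power_Suc)
    then show ?thesis unfolding pen by (metis mult.assoc power_Suc2)
  qed
  have pk: "nonneg (p ^ k * e ^ n)" for k n
  proof (induction n arbitrary: k)
    case 0 then show ?case using nonneg_power[OF p] by simp
  next
    case (Suc n)
    show ?case unfolding step using t by (intro nonneg_add nonneg_scaleR Suc) auto
  qed
  have p2: "nonneg (p ^ 2 * e ^ n - p ^ 2)" for n
  proof (induction n)
    case 0 then show ?case by (simp add: nonneg_def)
  next
    case (Suc n)
    have "p ^ 2 * e ^ Suc n - p ^ 2 = (p ^ 2 * e ^ n - p ^ 2) + (1/t) *\<^sub>R (p ^ Suc 2 * e ^ n)"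
      unfolding step by (rule diff_add_eq[symmetric])
    moreover have "nonneg ((1/t) *\<^sub>R (p ^ Suc 2 * e ^ n))" using t by (intro nonneg_scaleR pk) simp
    ultimately show ?case using nonneg_add[OF Suc] by metis
  qed
  \<comment> \<open>Bernoulli's inequality for e = 1 + p / t, multiplied by p and with the constant
    term dropped. Since the norm of p e^(2 n) is bounded independently of n, it forces p^2 =
    0.\<close>
  have low: "nonneg (p * e ^ n - (n / t) *\<^sub>R p ^ 2)" for n
  proof (induction n)
    case 0 then show ?case using p by simp
  next
    case (Suc n)
    have eq: "p * e ^ Suc n = p * e ^ n + (1/t) *\<^sub>R (p ^ 2 * e ^ n)"
      using step[of 1 n] by (simp only: power_Suc0_right numeral_2_eq_2 One_nat_def)
    have c: "real (Suc n) / t = n / t + 1 / t" by (simp add: add_divide_distrib)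
    have arith: "w + x - (y + z) = w - y + (x - z)" for w x y z :: 'a by simp
    have "p * e ^ Suc n - (Suc n / t) *\<^sub>R p ^ 2 =
        (p * e ^ n - (n / t) *\<^sub>R p ^ 2) + (1/t) *\<^sub>R (p ^ 2 * e ^ n - p ^ 2)"
      unfolding eq c scaleR_add_left scaleR_right_diff_distrib by (rule arith)
    moreover have "nonneg ((1/t) *\<^sub>R (p ^ 2 * e ^ n - p ^ 2))" using t by (intro nonneg_scaleR p2) simp
    ultimately show ?case using nonneg_add[OF Suc] by metis
  qed
  have arch: "real n * norm (p ^ 2) \<le> t * (norm d)\<^sup>2" for n
  proof -
    have "norm ((2 * n / t) *\<^sub>R p ^ 2) \<le> norm (p * e ^ (2 * n))"
      using low[of "2 * n"] t by (intro nonneg_norm_mono nonneg_scaleR nonneg_power p) auto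
    then have "2 * n / t * norm (p ^ 2) \<le> (norm d)\<^sup>2"
      using z[of n] t by simp
    then have "2 * n * norm (p ^ 2) \<le> t * (norm d)\<^sup>2"
      using t by (simp add: field_simps)
    then have "2 * (real n * norm (p ^ 2)) \<le> t * (norm d)\<^sup>2"
      by (simp only: of_nat_mult of_nat_numeral mult.assoc)
    moreover have "0 \<le> real n * norm (p ^ 2)" by simp
    ultimately show ?thesis by linarith
  qed
  have "norm (p ^ 2) = 0"
  proof (rule ccontr)
    assume "norm (p ^ 2) \<noteq> 0"
    then have "norm (p ^ 2) > 0" by simp
    then obtain n where "real n * norm (p ^ 2) > t * (norm d)\<^sup>2" using ex_less_of_nat_mult by blast
    then show False using arch[of n] by linarith
  qed
  then have "norm p = 0"
    using norm_selfadjoint_square[OF nonneg_selfadjoint[OF p]] by (simp add: power2_eq_square)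
  then have "norm d = 0" using norm_star_mult[of d] by (simp add: p_def)
  then show ?thesis by simp
qed

text \<open>Let m be the absolute value of c = \<open>star b * b\<close> and n = m - c, which is
  twice the negative part of c. Then \<open>star (b * n) * (b * n)\<close> is n c n = - (m^(1/2)
  n)^2, so \<open>nonneg_minus_star_mult\<close> gives b n = 0. Hence c n = 0, and n^2 = - 2 c n =
  0.\<close>

lemma nonneg_star_mult: "nonneg (star b * b)"
proof -
  define c where "c = star b * b"
  have c: "star c = c" by (simp add: c_def star_mult star_star)
  obtain m where m: "nonneg m" "star m = m" "m * m = c * c"
    and mc: "\<And>y. y * (c * c) = c * c * y \<Longrightarrow> y * m = m * y"
    using nonneg_sqrt[OF nonneg_square[OF c]] by metis
  have cm: "c * m = m * c" by (rule mc) (simp add: mult.assoc)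
  obtain r where r: "star r = r" "r * r = m" and rm: "\<And>y. y * m = m * y \<Longrightarrow> y * r = r * y"
    using nonneg_sqrt[OF m(1)] by metis
  have cr: "c * r = r * c" by (rule rm[OF cm])
  have mr: "m * r = r * m" by (rule rm) simp
  define n where "n = m - c"
  have n: "star n = n" by (simp add: n_def star_diff m c)
  have nr: "n * r = r * n" by (simp add: n_def algebra_simps cr mr)
  have nc: "n * c = - (m * n)" by (simp add: n_def algebra_simps m)
  have "star (b * n) * (b * n) = n * c * n" by (simp add: star_mult n c_def mult.assoc)
  also have ncn: "\<dots> = - ((r * n) * (r * n))"
    by (simp add: nc mult.assoc r(2)[symmetric]) (metis mult.assoc nr)
  finally have "nonneg (- (star (b * n) * (b * n)))"
    using nonneg_square[of "r * n"] by (simp add: star_mult n r nr)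
  then have "b * n = 0" by (rule nonneg_minus_star_mult)
  then have cn: "c * n = 0" by (simp add: c_def mult.assoc)
  then have "n * c = 0" by (metis n c star_mult star_zero)
  have "n * n = m * m - m * c - c * m + c * c" by (simp add: n_def algebra_simps)
  also have "\<dots> = - (2 *\<^sub>R (c * n))" by (simp add: n_def m cm scaleR_2 algebra_simps)
  finally have "n * n = 0" using cn by simp
  then have "n = 0" using norm_selfadjoint_square[OF n] by simp
  then have "c = m" by (simp add: n_def)
  then show ?thesis using m(1) by (simp add: c_def)
qed

lemma positive_iff_nonneg: "positive a \<longleftrightarrow> nonneg (a::'b::cstar_algebra)"
  by (metis positive_def nonneg_star_mult nonneg_sqrt)

lemma positive_selfadjoint: "positive a \<Longrightarrow> star a = (a::'b::cstar_algebra)"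
  by (simp add: positive_iff_nonneg nonneg_def)

lemma positive_star_mult [simp]: "positive (star b * (b::'b::cstar_algebra))"
  by (auto simp: positive_def)

lemma positive_zero [simp]: "positive (0::'b::cstar_algebra)" by (simp add: positive_iff_nonneg nonneg_def)

lemma positive_add: "positive a \<Longrightarrow> positive b \<Longrightarrow> positive (a + b :: 'b::cstar_algebra)"
  by (simp add: positive_iff_nonneg nonneg_add)

lemma positive_sum: "(\<And>i. i \<in> I \<Longrightarrow> positive (f i :: 'b::cstar_algebra)) \<Longrightarrow> positive (sum f I)"
  by (induction I rule: infinite_finite_induct) (auto intro: positive_add)

lemma positive_scaleR: "positive (a::'b::cstar_algebra) \<Longrightarrow> r \<ge> 0 \<Longrightarrow> positive (r *\<^sub>R a)"
  by (simp add: positive_iff_nonneg nonneg_scaleR)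

lemma positive_conj: "positive (a::'b::cstar_algebra) \<Longrightarrow> positive (star x * a * x)"
  unfolding positive_def by (metis star_mult mult.assoc)

lemma positive_norm_mono: "positive a \<Longrightarrow> positive (b - a) \<Longrightarrow> norm a \<le> norm (b::'b::cstar_algebra)"
  by (simp add: positive_iff_nonneg nonneg_norm_mono)

lemma positive_norm_minus: "star a = a \<Longrightarrow> norm (a::'b::cstar_algebra) \<le> r \<Longrightarrow> positive (r *\<^sub>R 1 - a)"
  by (simp add: positive_iff_nonneg nonneg_norm_minus)

lemma positive_limit:
  assumes "\<And>n. positive (f n)" "f \<longlonglongrightarrow> (a::'b::cstar_algebra)" shows "positive a"
  unfolding positive_iff_nonneg nonneg_def
proof
  have "(\<lambda>n. star (f n)) \<longlonglongrightarrow> star a" by (rule bounded_linear.tendsto[OF bounded_linear_star assms(2)])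
  moreover have "star (f n) = f n" for n using assms(1) by (rule positive_selfadjoint)
  ultimately have "f \<longlonglongrightarrow> star a" by simp
  then show "star a = a" using LIMSEQ_unique assms(2) by blast
  show "norm (norm a *\<^sub>R 1 - a) \<le> norm a"
  proof (rule LIMSEQ_le)
    show "(\<lambda>n. norm (norm (f n) *\<^sub>R 1 - f n)) \<longlonglongrightarrow> norm (norm a *\<^sub>R 1 - a)"
      by (intro tendsto_intros assms(2))
    show "(\<lambda>n. norm (f n)) \<longlonglongrightarrow> norm a" by (intro tendsto_intros assms(2))
    show "\<exists>N. \<forall>n\<ge>N. norm (norm (f n) *\<^sub>R 1 - f n) \<le> norm (f n)"
      using assms(1) by (auto simp: positive_iff_nonneg nonneg_def)
  qed
qed

section \<open>Extension by continuity\<close>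

text \<open>Two sequences with the same limit under p are interlaced; the images under q form a
  Cauchy sequence, so both parts have the same limit. The map q need not be known to factor through
  p, which suits formal sums.\<close>

lemma cauchy_extension:
  fixes p :: "'s \<Rightarrow> 'x::metric_space" and q :: "'s \<Rightarrow> 'y::complete_space"
  assumes cauchy: "\<And>U. (\<And>n. U n \<in> S) \<Longrightarrow> Cauchy (\<lambda>n. p (U n)) \<Longrightarrow> Cauchy (\<lambda>n. q (U n))"
  shows "\<exists>v. \<forall>U x. (\<forall>n. U n \<in> S) \<longrightarrow> (\<lambda>n. p (U n)) \<longlonglongrightarrow> x \<longrightarrow> (\<lambda>n. q (U n)) \<longlonglongrightarrow> v x"
proof (intro exI allI impI)
  define s where "s x = (SOME U. (\<forall>n. U n \<in> S) \<and> (\<lambda>n. p (U n)) \<longlonglongrightarrow> x)" for x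
  fix U x assume U: "\<forall>n. U n \<in> S" "(\<lambda>n. p (U n)) \<longlonglongrightarrow> x"
  then have "(\<forall>n. s x n \<in> S) \<and> (\<lambda>n. p (s x n)) \<longlonglongrightarrow> x"
    unfolding s_def by (intro someI[of "\<lambda>U. (\<forall>n. U n \<in> S) \<and> (\<lambda>n. p (U n)) \<longlonglongrightarrow> x" U]) auto
  then have W: "\<And>n. s x n \<in> S" "(\<lambda>n. p (s x n)) \<longlonglongrightarrow> x" by auto
  define Z where "Z n = (if even n then U (n div 2) else s x (n div 2))" for n
  have ZS: "Z n \<in> S" for n by (simp add: Z_def U(1) W(1))
  have div: "filterlim (\<lambda>n::nat. n div 2) sequentially sequentially"
    unfolding filterlim_at_top eventually_sequentially by (metis div_le_mono div_mult_self_is_m zero_less_numeral)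
  have "(\<lambda>n. p (Z n)) \<longlonglongrightarrow> x"
  proof (rule tendstoI)
    fix e :: real assume e: "e > 0"
    have "\<forall>\<^sub>F n in sequentially. dist (p (U (n div 2))) x < e"
      using filterlim_compose[OF U(2) div] e by (rule tendstoD)
    moreover have "\<forall>\<^sub>F n in sequentially. dist (p (s x (n div 2))) x < e"
      using filterlim_compose[OF W(2) div] e by (rule tendstoD)
    ultimately show "\<forall>\<^sub>F n in sequentially. dist (p (Z n)) x < e"
      by eventually_elim (simp add: Z_def)
  qed
  then have "Cauchy (\<lambda>n. q (Z n))" by (intro cauchy ZS) (rule LIMSEQ_imp_Cauchy)
  then obtain l where l: "(\<lambda>n. q (Z n)) \<longlonglongrightarrow> l" by (auto simp: Cauchy_convergent_iff convergent_def)
  have "strict_mono (\<lambda>n::nat. 2 * n)" "strict_mono (\<lambda>n::nat. 2 * n + 1)" by (auto intro: strict_monoI)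
  from this[THEN LIMSEQ_subseq_LIMSEQ[OF l]]
  have "(\<lambda>n. q (U n)) \<longlonglongrightarrow> l" and "(\<lambda>n. q (s x n)) \<longlonglongrightarrow> l"
    by (simp_all add: o_def Z_def)
  then show "(\<lambda>n. q (U n)) \<longlonglongrightarrow> lim (\<lambda>n. q (s x n))" using limI by blast
qed

text \<open>Pairs are treated as single arguments. Cauchy sequences are bounded, so the two
  one-sided estimates turn Cauchy arguments into Cauchy values.\<close>

lemma bilinear_extension:
  fixes p1 :: "'s \<Rightarrow> 'x::banach" and p2 :: "'t \<Rightarrow> 'y::banach" and \<beta> :: "'s \<Rightarrow> 't \<Rightarrow> 'z::banach"
  assumes l: "\<And>U U' V. U \<in> S \<Longrightarrow> U' \<in> S \<Longrightarrow> V \<in> R \<Longrightarrow>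
      norm (\<beta> U V - \<beta> U' V) \<le> norm (p1 U - p1 U') * norm (p2 V)"
    and r: "\<And>U V V'. U \<in> S \<Longrightarrow> V \<in> R \<Longrightarrow> V' \<in> R \<Longrightarrow>
      norm (\<beta> U V - \<beta> U V') \<le> norm (p1 U) * norm (p2 V - p2 V')"
  shows "\<exists>B. \<forall>U V x y. (\<forall>n. U n \<in> S) \<longrightarrow> (\<forall>n. V n \<in> R) \<longrightarrow> (\<lambda>n. p1 (U n)) \<longlonglongrightarrow> x \<longrightarrow>
      (\<lambda>n. p2 (V n)) \<longlonglongrightarrow> y \<longrightarrow> (\<lambda>n. \<beta> (U n) (V n)) \<longlonglongrightarrow> B x y"
proof -
  let ?p = "\<lambda>(U, V). (p1 U, p2 V)" and ?q = "\<lambda>(U, V). \<beta> U V"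
  have cauchy: "Cauchy (\<lambda>n. ?q (Z n))" if Z: "\<And>n. Z n \<in> S \<times> R" "Cauchy (\<lambda>n. ?p (Z n))" for Z
  proof -
    define U where "U = fst \<circ> Z"
    define V where "V = snd \<circ> Z"
    have Zn: "Z n = (U n, V n)" for n by (simp add: U_def V_def)
    have S: "U n \<in> S" "V n \<in> R" for n using Z(1)[of n] by (auto simp: Zn)
    have c: "Cauchy (\<lambda>n. p1 (U n))" "Cauchy (\<lambda>n. p2 (V n))"
      using Cauchy_fst[OF Z(2)] Cauchy_snd[OF Z(2)] by (simp_all add: Zn)
    obtain K where K: "K > 0" "\<And>n. norm (p1 (U n)) \<le> K"
      using Cauchy_Bseq[OF c(1)] by (auto simp: Bseq_def)
    obtain L where L: "L > 0" "\<And>n. norm (p2 (V n)) \<le> L"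
      using Cauchy_Bseq[OF c(2)] by (auto simp: Bseq_def)
    show ?thesis
    proof (rule CauchyI)
      fix e :: real assume e: "e > 0"
      obtain M where M: "\<And>m n. m \<ge> M \<Longrightarrow> n \<ge> M \<Longrightarrow> norm (p1 (U m) - p1 (U n)) < e / (2 * L)"
        using CauchyD[OF c(1), of "e / (2 * L)"] e L by auto
      obtain N where N: "\<And>m n. m \<ge> N \<Longrightarrow> n \<ge> N \<Longrightarrow> norm (p2 (V m) - p2 (V n)) < e / (2 * K)"
        using CauchyD[OF c(2), of "e / (2 * K)"] e K by auto
      show "\<exists>M. \<forall>m\<ge>M. \<forall>n\<ge>M. norm (?q (Z m) - ?q (Z n)) < e"
      proof (intro exI allI impI)
        fix m n assume mn: "m \<ge> max M N" "n \<ge> max M N"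
        have "norm (?q (Z m) - ?q (Z n)) \<le> norm (\<beta> (U m) (V m) - \<beta> (U n) (V m)) + norm (\<beta> (U n) (V m) - \<beta> (U n) (V n))"
          using norm_triangle_ineq[of "\<beta> (U m) (V m) - \<beta> (U n) (V m)" "\<beta> (U n) (V m) - \<beta> (U n) (V n)"]
          by (simp add: Zn)
        also have "\<dots> \<le> norm (p1 (U m) - p1 (U n)) * norm (p2 (V m)) + norm (p1 (U n)) * norm (p2 (V m) - p2 (V n))"
          by (intro add_mono l r S)
        also have "\<dots> \<le> norm (p1 (U m) - p1 (U n)) * L + K * norm (p2 (V m) - p2 (V n))"
          by (intro add_mono mult_left_mono mult_right_mono K L) auto
        also have "\<dots> < e / (2 * L) * L + K * (e / (2 * K))"
          using mn K L by (intro add_strict_mono mult_strict_right_mono mult_strict_left_mono M N) auto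
        also have "\<dots> = e" using K L by simp
        finally show "norm (?q (Z m) - ?q (Z n)) < e" .
      qed
    qed
  qed
  have "\<exists>v. \<forall>Z x. (\<forall>n. Z n \<in> S \<times> R) \<longrightarrow> (\<lambda>n. ?p (Z n)) \<longlonglongrightarrow> x \<longrightarrow> (\<lambda>n. ?q (Z n)) \<longlonglongrightarrow> v x"
    by (rule cauchy_extension) (rule cauchy)
  then obtain v where v: "\<forall>Z x. (\<forall>n. Z n \<in> S \<times> R) \<longrightarrow> (\<lambda>n. ?p (Z n)) \<longlonglongrightarrow> x \<longrightarrow> (\<lambda>n. ?q (Z n)) \<longlonglongrightarrow> v x" ..
  show ?thesis
  proof (intro exI allI impI)
    fix U V x y assume "\<forall>n. U n \<in> S" "\<forall>n. V n \<in> R" "(\<lambda>n. p1 (U n)) \<longlonglongrightarrow> x" "(\<lambda>n. p2 (V n)) \<longlonglongrightarrow> y"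
    then have "\<forall>n. (U n, V n) \<in> S \<times> R" "(\<lambda>n. ?p (U n, V n)) \<longlonglongrightarrow> (x, y)" by (auto intro: tendsto_Pair)
    then have "(\<lambda>n. ?q (U n, V n)) \<longlonglongrightarrow> v (x, y)"
      using v[THEN spec[of _ "\<lambda>n. (U n, V n)"], THEN spec[of _ "(x, y)"]] by simp
    then show "(\<lambda>n. \<beta> (U n) (V n)) \<longlonglongrightarrow> v (x, y)" by simp
  qed
qed

section \<open>Semi-inner products with values in a C*-algebra\<close>

instance bcontfun :: (metric_space, banach) banach ..

text \<open>The pointwise right action on bounded functions; \<open>emb\<close> will carry the right
  action of a module to it.\<close>

definition bract :: "('a::topological_space \<Rightarrow>\<^sub>C 'b::real_normed_algebra) \<Rightarrow> 'b \<Rightarrow> ('a \<Rightarrow>\<^sub>C 'b)" where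
  "bract f b = Bcontfun (\<lambda>x. f x * b)"

lemma apply_bract [simp]: "apply_bcontfun (bract f b) x = apply_bcontfun f x * b"
proof -
  have "(\<lambda>x. apply_bcontfun f x * b) \<in> bcontfun"
    by (rule bcontfun_normI[where b = "norm f * norm b"])
      (auto intro!: continuous_intros order_trans[OF norm_mult_ineq] mult_right_mono norm_bounded)
  then show ?thesis by (simp add: bract_def Bcontfun_inverse)
qed

interpretation bract: bounded_bilinear bract
proof
  show "\<exists>K. \<forall>a b. norm (bract a b) \<le> norm a * norm b * K"
  proof (intro exI allI)
    show "norm (bract f b) \<le> norm f * norm b * 1" for f b
      by (rule norm_bound) (auto intro!: order_trans[OF norm_mult_ineq] mult_right_mono norm_bounded)
  qed
qed (auto intro!: bcontfun_eqI simp: algebra_simps)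

lemma bract_bract: "bract (bract f a) b = bract f (a * b)"
  and bract_one [simp]: "bract f (1::'b::{real_normed_algebra_1}) = f"
  by (auto intro!: bcontfun_eqI simp: mult.assoc)

text \<open>No axioms are imposed on \<open>add\<close> and \<open>rm\<close> beyond their effect on \<open>Q\<close>, so that lists representing formal
  sums can be used without passing to a quotient.\<close>

locale semi_module =
  fixes S :: "'v set" and Q :: "'v \<Rightarrow> 'v \<Rightarrow> 'b::cstar_algebra"
    and add :: "'v \<Rightarrow> 'v \<Rightarrow> 'v" and rm :: "'v \<Rightarrow> 'b \<Rightarrow> 'v"
  assumes nonempty: "S \<noteq> {}"
    and add_in: "\<lbrakk>x \<in> S; y \<in> S\<rbrakk> \<Longrightarrow> add x y \<in> S"
    and rm_in: "x \<in> S \<Longrightarrow> rm x b \<in> S"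
    and Q_add: "\<lbrakk>x \<in> S; y \<in> S; z \<in> S\<rbrakk> \<Longrightarrow> Q x (add y z) = Q x y + Q x z"
    and Q_rm: "\<lbrakk>x \<in> S; y \<in> S\<rbrakk> \<Longrightarrow> Q x (rm y b) = Q x y * b"
    and Q_star: "\<lbrakk>x \<in> S; y \<in> S\<rbrakk> \<Longrightarrow> star (Q x y) = Q y x"
    and Q_pos: "x \<in> S \<Longrightarrow> positive (Q x x)"
begin

lemma Q_add_left: "\<lbrakk>x \<in> S; y \<in> S; z \<in> S\<rbrakk> \<Longrightarrow> Q (add y z) x = Q y x + Q z x"
  by (metis Q_star Q_add add_in star_add)

lemma Q_rm_left: "\<lbrakk>x \<in> S; y \<in> S\<rbrakk> \<Longrightarrow> Q (rm y b) x = star b * Q y x"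
  by (metis Q_star Q_rm rm_in star_mult)

text \<open>Expand the positive element Q z z for z = y - x Q(x, y) / N and replace Q x x by its
  bound N.\<close>

lemma cauchy_schwarz_order:
  assumes x: "x \<in> S" and y: "y \<in> S" and N: "norm (Q x x) \<le> N" "N > 0"
  shows "positive (N *\<^sub>R Q y y - Q y x * Q x y)"
proof -
  let ?p = "Q y y" and ?q = "Q x x" and ?r = "Q y x" and ?s = "Q x y"
  define b where "b = (- 1 / N) *\<^sub>R ?s"
  have sb: "star b = (- 1 / N) *\<^sub>R ?r" using x y by (simp add: b_def star_scaleR Q_star star_minus)
  have sr: "star ?s = ?r" using x y by (simp add: Q_star)
  have "Q (add y (rm x b)) (add y (rm x b)) = ?p + ?r * b + star b * ?s + star b * ?q * b"
    using x y by (simp add: Q_add Q_add_left Q_rm Q_rm_left add_in rm_in algebra_simps)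
  also have "\<dots> = ?p - (1 / N) *\<^sub>R (?r * ?s) - (1 / N) *\<^sub>R (?r * ?s) + (1 / N\<^sup>2) *\<^sub>R (?r * ?q * ?s)"
    unfolding sb by (simp add: b_def power2_eq_square)
  finally have 1: "positive (?p - (1 / N) *\<^sub>R (?r * ?s) - (1 / N) *\<^sub>R (?r * ?s) + (1 / N\<^sup>2) *\<^sub>R (?r * ?q * ?s))"
    using Q_pos[of "add y (rm x b)"] x y by (simp add: add_in rm_in)
  have "positive (star ?s * (N *\<^sub>R 1 - ?q) * ?s)"
    using x N by (intro positive_conj positive_norm_minus) (auto simp: Q_star)
  then have "positive ((1 / N\<^sup>2) *\<^sub>R (?r * (N *\<^sub>R 1 - ?q) * ?s))"
    unfolding sr by (rule positive_scaleR) simp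
  from positive_add[OF 1 this] have "positive (?p - (1 / N) *\<^sub>R (?r * ?s))"
  proof (rule back_subst[of positive])
    have "?r * (N *\<^sub>R 1 - ?q) * ?s = N *\<^sub>R (?r * ?s) - ?r * ?q * ?s"
      by (simp add: algebra_simps)
    then have c: "(1 / N\<^sup>2) *\<^sub>R (?r * (N *\<^sub>R 1 - ?q) * ?s) = (1 / N) *\<^sub>R (?r * ?s) - (1 / N\<^sup>2) *\<^sub>R (?r * ?q * ?s)"
      using N by (simp add: scaleR_right_diff_distrib power2_eq_square)
    have arith: "p - h - h + k + (h - k) = p - h" for p h k :: 'b by simp
    show "?p - (1 / N) *\<^sub>R (?r * ?s) - (1 / N) *\<^sub>R (?r * ?s) + (1 / N\<^sup>2) *\<^sub>R (?r * ?q * ?s)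
          + (1 / N\<^sup>2) *\<^sub>R (?r * (N *\<^sub>R 1 - ?q) * ?s)
        = ?p - (1 / N) *\<^sub>R (?r * ?s)"
      unfolding c by (rule arith)
  qed
  from positive_scaleR[OF this, of N] show ?thesis
    using N by (simp add: scaleR_right_diff_distrib)
qed

text \<open>The order inequality is used for every N above \<open>norm (Q x x)\<close>, followed by
  passing to the infimum: N has to be positive, while \<open>norm (Q x x)\<close> may
  vanish.\<close>

lemma cauchy_schwarz:
  assumes x: "x \<in> S" and y: "y \<in> S"
  shows "(norm (Q x y))\<^sup>2 \<le> norm (Q x x) * norm (Q y y)"
proof -
  have *: "(norm (Q x y))\<^sup>2 \<le> N * norm (Q y y)" if "norm (Q x x) < N" for N
  proof -
    have N: "N > 0" using that norm_ge_zero[of "Q x x"] by linarith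
    have "Q y x = star (Q x y)" using x y by (simp add: Q_star)
    then have "norm (Q y x * Q x y) \<le> norm (N *\<^sub>R Q y y)"
      using cauchy_schwarz_order[OF x y _ N] that by (intro positive_norm_mono) auto
    then show ?thesis
      using N x y by (simp add: norm_star_mult flip: Q_star[of x y])
  qed
  show ?thesis
  proof (cases "norm (Q y y) = 0")
    case True
    then show ?thesis using *[of "norm (Q x x) + 1"] by simp
  next
    case False
    then have pos: "norm (Q y y) > 0" by simp
    have "(norm (Q x y))\<^sup>2 / norm (Q y y) \<le> norm (Q x x)"
      by (rule dense_ge) (use * pos in \<open>simp add: field_simps\<close>)
    then show ?thesis using pos by (simp add: field_simps)
  qed
qed

text \<open>By the Cauchy-Schwarz inequality, restricting \<open>z \<mapsto> Q z x\<close> to the unit ball is isometric. The discrete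
  topology makes every bounded function continuous, hence the target is a Banach space.\<close>

definition emb :: "'v \<Rightarrow> ('v discrete \<Rightarrow>\<^sub>C 'b)" where
  "emb x = Bcontfun (\<lambda>z. if of_discrete z \<in> S \<and> norm (Q (of_discrete z) (of_discrete z)) \<le> 1
     then Q (of_discrete z) x else 0)"

lemma apply_emb:
  assumes x: "x \<in> S"
  shows "apply_bcontfun (emb x) z = (if of_discrete z \<in> S \<and> norm (Q (of_discrete z) (of_discrete z)) \<le> 1
     then Q (of_discrete z) x else 0)" (is "_ = ?f z")
    and "norm (apply_bcontfun (emb x) z) \<le> sqrt (norm (Q x x))"
proof -
  have b: "norm (?f z) \<le> sqrt (norm (Q x x))" for z
  proof (cases "of_discrete z \<in> S \<and> norm (Q (of_discrete z) (of_discrete z)) \<le> 1")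
    case True
    let ?z = "of_discrete z"
    have "(norm (Q ?z x))\<^sup>2 \<le> norm (Q ?z ?z) * norm (Q x x)" using True x by (simp add: cauchy_schwarz)
    also have "\<dots> \<le> 1 * norm (Q x x)" using True by (intro mult_right_mono) auto
    finally show ?thesis using True by (simp add: real_le_rsqrt)
  qed auto
  have "?f \<in> bcontfun"
    by (rule bcontfun_normI[OF _ b])
      (auto simp only: continuous_on_open_vimage[OF open_UNIV] intro: open_discrete)
  then show e: "apply_bcontfun (emb x) z = ?f z" by (simp add: emb_def Bcontfun_inverse)
  show "norm (apply_bcontfun (emb x) z) \<le> sqrt (norm (Q x x))" unfolding e by (rule b)
qed

lemma norm_emb:
  assumes x: "x \<in> S" shows "norm (emb x) = sqrt (norm (Q x x))"
proof (rule antisym)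
  show "norm (emb x) \<le> sqrt (norm (Q x x))" by (rule norm_bound) (rule apply_emb(2)[OF x])
  show "sqrt (norm (Q x x)) \<le> norm (emb x)"
  proof (cases "norm (Q x x) = 0")
    case False
    define r where "r = sqrt (norm (Q x x))"
    have r: "r > 0" "r * r = norm (Q x x)" using False by (auto simp: r_def)
    \<comment> \<open>The normalised x is a point of the unit ball at which the bound for
      \<open>emb x\<close> is attained.\<close>
    define z where "z = rm x ((1 / r) *\<^sub>R 1)"
    have z: "z \<in> S" by (simp add: z_def rm_in x)
    have "Q z z = (1 / (r * r)) *\<^sub>R Q x x"
      using x by (simp add: z_def Q_rm Q_rm_left rm_in star_scaleR)
    then have "norm (Q z z) \<le> 1" using r by simp
    then have "apply_bcontfun (emb x) (discrete z) = Q z x" using z x by (simp add: apply_emb discrete_inverse)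
    also have "\<dots> = (1 / r) *\<^sub>R Q x x" using x by (simp add: z_def Q_rm_left star_scaleR)
    finally have "norm (apply_bcontfun (emb x) (discrete z)) = r"
      using r by (simp add: nonzero_divide_eq_eq)
    then show ?thesis using norm_bounded[of "emb x" "discrete z"] by (simp add: r_def)
  qed simp
qed

lemma norm_emb_sq: "x \<in> S \<Longrightarrow> (norm (emb x))\<^sup>2 = norm (Q x x)"
  by (simp add: norm_emb)

lemma emb_add: "\<lbrakk>x \<in> S; y \<in> S\<rbrakk> \<Longrightarrow> emb (add x y) = emb x + emb y"
  by (rule bcontfun_eqI) (simp add: apply_emb add_in Q_add)

lemma emb_rm: "x \<in> S \<Longrightarrow> emb (rm x b) = bract (emb x) b"
  by (rule bcontfun_eqI) (simp add: apply_emb rm_in Q_rm)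

lemma emb_minus: "x \<in> S \<Longrightarrow> emb (rm x (-1)) = - emb x"
  by (simp add: emb_rm bract.minus_right)

lemma emb_diff: "\<lbrakk>x \<in> S; y \<in> S\<rbrakk> \<Longrightarrow> emb (add x (rm y (-1))) = emb x - emb y"
  by (simp add: emb_add rm_in emb_minus)

lemma norm_Q_le: "\<lbrakk>x \<in> S; y \<in> S\<rbrakk> \<Longrightarrow> norm (Q x y) \<le> norm (emb x) * norm (emb y)"
  using cauchy_schwarz[of x y] by (simp add: norm_emb real_le_rsqrt flip: real_sqrt_mult)

lemma norm_Q_diff_left:
  "\<lbrakk>x \<in> S; x' \<in> S; y \<in> S\<rbrakk> \<Longrightarrow> norm (Q x y - Q x' y) \<le> norm (emb x - emb x') * norm (emb y)"
  using norm_Q_le[of "add x (rm x' (-1))" y]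
  by (simp add: emb_diff add_in rm_in Q_add_left Q_rm_left star_minus)

lemma norm_Q_diff_right:
  "\<lbrakk>x \<in> S; y \<in> S; y' \<in> S\<rbrakk> \<Longrightarrow> norm (Q x y - Q x y') \<le> norm (emb x) * norm (emb y - emb y')"
  using norm_Q_le[of x "add y (rm y' (-1))"]
  by (simp add: emb_diff add_in rm_in Q_add Q_rm)

definition ip :: "('v discrete \<Rightarrow>\<^sub>C 'b) \<Rightarrow> ('v discrete \<Rightarrow>\<^sub>C 'b) \<Rightarrow> 'b" where
  "ip = (SOME B. \<forall>U V x y. (\<forall>n. U n \<in> S) \<longrightarrow> (\<forall>n. V n \<in> S) \<longrightarrow> (\<lambda>n. emb (U n)) \<longlonglongrightarrow> x \<longrightarrow>
     (\<lambda>n. emb (V n)) \<longlonglongrightarrow> y \<longrightarrow> (\<lambda>n. Q (U n) (V n)) \<longlonglongrightarrow> B x y)"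

lemma ip_tendsto:
  assumes "\<And>n. U n \<in> S" "\<And>n. V n \<in> S" "(\<lambda>n. emb (U n)) \<longlonglongrightarrow> x" "(\<lambda>n. emb (V n)) \<longlonglongrightarrow> y"
  shows "(\<lambda>n. Q (U n) (V n)) \<longlonglongrightarrow> ip x y"
proof -
  have "\<exists>B. \<forall>U V x y. (\<forall>n. U n \<in> S) \<longrightarrow> (\<forall>n. V n \<in> S) \<longrightarrow> (\<lambda>n. emb (U n)) \<longlonglongrightarrow> x \<longrightarrow>
     (\<lambda>n. emb (V n)) \<longlonglongrightarrow> y \<longrightarrow> (\<lambda>n. Q (U n) (V n)) \<longlonglongrightarrow> B x y"
  proof (rule bilinear_extension)
    fix U U' V assume "U \<in> S" "U' \<in> S" "V \<in> S"
    then show "norm (Q U V - Q U' V) \<le> norm (emb U - emb U') * norm (emb V)" by (rule norm_Q_diff_left)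
  next
    fix U V V' assume "U \<in> S" "V \<in> S" "V' \<in> S"
    then show "norm (Q U V - Q U V') \<le> norm (emb U) * norm (emb V - emb V')" by (rule norm_Q_diff_right)
  qed
  from someI_ex[OF this, folded ip_def, THEN spec[of _ U], THEN spec[of _ V], THEN spec[of _ x], THEN spec[of _ y]]
  show ?thesis using assms by simp
qed

lemma ip_emb:
  assumes "x \<in> S" "y \<in> S" shows "ip (emb x) (emb y) = Q x y"
proof -
  have "(\<lambda>n::nat. Q x y) \<longlonglongrightarrow> ip (emb x) (emb y)"
    by (rule ip_tendsto[where U = "\<lambda>_. x" and V = "\<lambda>_. y"]) (simp_all add: assms)
  then show ?thesis by (rule LIMSEQ_unique) simp
qed

definition completion :: "('v discrete \<Rightarrow>\<^sub>C 'b) set" where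
  "completion = closure (emb ` S)"

lemma completion_seq:
  assumes "x \<in> closure (emb ` R)"
  obtains U where "\<And>n. U n \<in> R" "(\<lambda>n. emb (U n)) \<longlonglongrightarrow> x"
proof -
  obtain X where X: "\<And>n. X n \<in> emb ` R" "X \<longlonglongrightarrow> x" using assms unfolding closure_sequential by blast
  then have "\<exists>U. \<forall>n. U n \<in> R \<and> X n = emb (U n)" by (intro choice) blast
  then obtain U where U: "\<And>n. U n \<in> R" "\<And>n. X n = emb (U n)" by blast
  show ?thesis using that[of U] U(1) X(2) unfolding U(2) by blast
qed

lemma completion_limI:
  assumes "\<And>n. U n \<in> R" "(\<lambda>n. emb (U n)) \<longlonglongrightarrow> x"
  shows "x \<in> closure (emb ` R)"
proof -
  have "\<forall>n. emb (U n) \<in> emb ` R" using assms(1) by blast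
  then show ?thesis using assms(2) unfolding closure_sequential by (intro exI[of _ "\<lambda>n. emb (U n)"] conjI)
qed

lemma emb_in: "x \<in> S \<Longrightarrow> emb x \<in> completion"
  unfolding completion_def by (rule subsetD[OF closure_subset]) simp

end

text \<open>A Gram matrix \<open>G\<close> satisfies \<open>\<bar>G y\<bar>\<^sup>2 \<le> M \<langle>y, G y\<rangle>\<close> for large \<open>M\<close>. Hence \<open>1 - G/M\<close> is a
  contraction, and the power series for the square root of \<open>G/M\<close> converges entrywise.\<close>

primrec matrix_power :: "nat \<Rightarrow> (nat \<Rightarrow> nat \<Rightarrow> 'b::cstar_algebra) \<Rightarrow> nat \<Rightarrow> nat \<Rightarrow> nat \<Rightarrow> 'b" where
  "matrix_power n X 0 = (\<lambda>i j. of_bool (i = j))"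
| "matrix_power n X (Suc k) = (\<lambda>i j. \<Sum>l<n. X i l * matrix_power n X k l j)"

lemma sum_of_bool_mult:
  fixes f :: "nat \<Rightarrow> 'b::ring_1"
  assumes "i < n"
  shows "(\<Sum>l<n. of_bool (i = l) * f l) = f i" "(\<Sum>l<n. f l * of_bool (l = i)) = f i"
proof -
  have "(\<Sum>l<n. of_bool (i = l) * f l) = (\<Sum>l<n. if l = i then f l else 0)"
    by (rule sum.cong) auto
  then show "(\<Sum>l<n. of_bool (i = l) * f l) = f i" using assms by simp
  have "(\<Sum>l<n. f l * of_bool (l = i)) = (\<Sum>l<n. if l = i then f l else 0)"
    by (rule sum.cong) auto
  then show "(\<Sum>l<n. f l * of_bool (l = i)) = f i" using assms by simp
qed

lemma matrix_power_add:
  assumes "i < n"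
  shows "(\<Sum>l<n. matrix_power n X k i l * matrix_power n X m l j) = matrix_power n X (k + m) i j"
  using assms
proof (induction k arbitrary: i)
  case 0
  then show ?case by (simp add: sum_of_bool_mult)
next
  case (Suc k)
  have "(\<Sum>l<n. matrix_power n X (Suc k) i l * matrix_power n X m l j)
      = (\<Sum>l<n. \<Sum>r<n. X i r * matrix_power n X k r l * matrix_power n X m l j)"
    by (simp add: sum_distrib_right)
  also have "\<dots> = (\<Sum>r<n. X i r * (\<Sum>l<n. matrix_power n X k r l * matrix_power n X m l j))"
    by (subst sum.swap) (simp add: sum_distrib_left mult.assoc)
  also have "\<dots> = matrix_power n X (Suc k + m) i j" using Suc by simp
  finally show ?case .
qed

lemma matrix_power_star:
  assumes "\<And>i j. i < n \<Longrightarrow> j < n \<Longrightarrow> star (X i j) = X j i" "i < n" "j < n"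
  shows "star (matrix_power n X k i j) = matrix_power n X k j i"
  using assms(2,3)
proof (induction k arbitrary: i j)
  case 0
  then show ?case by auto
next
  case (Suc k)
  have "star (matrix_power n X (Suc k) i j) = (\<Sum>l<n. matrix_power n X k j l * X l i)"
    using Suc assms(1) by (simp add: star_sum star_mult)
  also have "\<dots> = (\<Sum>l<n. matrix_power n X k j l * matrix_power n X 1 l i)"
    using Suc.prems by (simp add: sum_of_bool_mult)
  also have "\<dots> = matrix_power n X (Suc k) j i" using Suc.prems by (subst matrix_power_add) simp_all
  finally show ?case .
qed

context semi_module
begin

text \<open>As \<open>add\<close> and \<open>rm\<close> obey no algebraic laws, the combination of
  the x i is pinned down only by its pairings. The empty combination is some element times 0, for
  which the module has to be nonempty.\<close>

lemma combination_exists: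
  fixes n :: nat
  assumes "\<And>i. i < n \<Longrightarrow> x i \<in> S"
  shows "\<exists>z\<in>S. \<forall>w\<in>S. Q w z = (\<Sum>i<n. Q w (x i) * y i)"
  using assms
proof (induction n)
  case 0
  obtain x0 where "x0 \<in> S" using nonempty by blast
  then show ?case by (intro bexI[of _ "rm x0 0"]) (auto simp: Q_rm rm_in)
next
  case (Suc n)
  then obtain z where "z \<in> S" "\<forall>w\<in>S. Q w z = (\<Sum>i<n. Q w (x i) * y i)" by (metis less_Suc_eq)
  then show ?case using Suc.prems[of n]
    by (intro bexI[of _ "add z (rm (x n) (y n))"]) (auto simp: Q_rm Q_add rm_in add_in)
qed

theorem gram_mat_positive:
  assumes x: "\<And>i. i < n \<Longrightarrow> x i \<in> S"
  shows "mat_positive n (\<lambda>i j. Q (x i) (x j))"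
proof (cases "n = 0")
  case True
  then show ?thesis by (simp add: mat_positive_def)
next
  case False
  \<comment> \<open>The order form of the Cauchy-Schwarz inequality asks for positive bounds; their
    sum M then bounds the Gram matrix.\<close>
  define N where "N i = norm (Q (x i) (x i)) + 1" for i
  define M where "M = (\<Sum>i<n. N i)"
  have Npos: "N i > 0" for i by (simp add: N_def add_nonneg_pos)
  have M: "M > 0" unfolding M_def using False Npos by (intro sum_pos) auto
  define X where "X i j = of_bool (i = j) - (1 / M) *\<^sub>R Q (x i) (x j)" for i j
  let ?P = "matrix_power n X"
  have starX: "star (X i j) = X j i" if "i < n" "j < n" for i j
    using that x by (auto simp: X_def star_diff star_scaleR Q_star)
  \<comment> \<open>For z the combination of the x l with coefficients y l, the vector X y has the
    entries y i - Q(x i, z) / M. The difference of the squares is 2 Q(z, z) / M minus the sum of the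
    \<open>Q z (x i) * Q (x i) z\<close> divided by M^2, and that sum is at most M Q(z, z).\<close>
  have contraction: "positive ((\<Sum>i<n. star (y i) * y i) -
      (\<Sum>i<n. star (\<Sum>l<n. X i l * y l) * (\<Sum>l<n. X i l * y l)))" for y
  proof -
    obtain z where z: "z \<in> S" "\<And>w. w \<in> S \<Longrightarrow> Q w z = (\<Sum>i<n. Q w (x i) * y i)"
      using combination_exists[of n x y] x by blast
    have Xy: "(\<Sum>l<n. X i l * y l) = y i - (1 / M) *\<^sub>R Q (x i) z" if "i < n" for i
    proof -
      have "(\<Sum>l<n. X i l * y l) = (\<Sum>l<n. of_bool (i = l) * y l) - (1 / M) *\<^sub>R (\<Sum>l<n. Q (x i) (x l) * y l)"
        by (simp add: X_def left_diff_distrib sum_subtractf scaleR_sum_right)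
      then show ?thesis using that z x by (simp add: sum_of_bool_mult)
    qed
    have zz: "Q z z = (\<Sum>i<n. Q z (x i) * y i)" using z by blast
    then have zz': "Q z z = (\<Sum>i<n. star (y i) * Q (x i) z)"
      using Q_star[OF z(1) z(1)] z x by (simp add: star_sum star_mult Q_star)
    have "(\<Sum>i<n. star (\<Sum>l<n. X i l * y l) * (\<Sum>l<n. X i l * y l))
        = (\<Sum>i<n. star (y i) * y i - (1 / M) *\<^sub>R (star (y i) * Q (x i) z) - (1 / M) *\<^sub>R (Q z (x i) * y i)
            + (1 / M\<^sup>2) *\<^sub>R (Q z (x i) * Q (x i) z))"
    proof (rule sum.cong)
      fix i assume "i \<in> {..<n}"
      then have i: "i < n" by simp
      have st: "star (\<Sum>l<n. X i l * y l) = star (y i) - (1 / M) *\<^sub>R Q z (x i)"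
        unfolding Xy[OF i] using z(1) x[OF i] by (simp add: star_diff star_scaleR Q_star)
      show "star (\<Sum>l<n. X i l * y l) * (\<Sum>l<n. X i l * y l)
        = star (y i) * y i - (1 / M) *\<^sub>R (star (y i) * Q (x i) z) - (1 / M) *\<^sub>R (Q z (x i) * y i)
            + (1 / M\<^sup>2) *\<^sub>R (Q z (x i) * Q (x i) z)"
        unfolding st unfolding Xy[OF i] by (simp add: algebra_simps power2_eq_square)
    qed simp
    also have "\<dots> = (\<Sum>i<n. star (y i) * y i) - (1 / M) *\<^sub>R Q z z - (1 / M) *\<^sub>R Q z z
        + (1 / M\<^sup>2) *\<^sub>R (\<Sum>i<n. Q z (x i) * Q (x i) z)"
      by (simp add: sum.distrib sum_subtractf scaleR_sum_right[symmetric] zz[symmetric] zz'[symmetric])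
    finally have eq: "(\<Sum>i<n. star (y i) * y i) - (\<Sum>i<n. star (\<Sum>l<n. X i l * y l) * (\<Sum>l<n. X i l * y l))
        = (1 / M) *\<^sub>R Q z z + ((1 / M) *\<^sub>R Q z z - (1 / M\<^sup>2) *\<^sub>R (\<Sum>i<n. Q z (x i) * Q (x i) z))"
      by simp
    have "positive (\<Sum>i<n. N i *\<^sub>R Q z z - Q z (x i) * Q (x i) z)"
      using x z by (intro positive_sum cauchy_schwarz_order Npos) (auto simp: N_def)
    then have "positive (M *\<^sub>R Q z z - (\<Sum>i<n. Q z (x i) * Q (x i) z))"
      by (simp add: M_def sum_subtractf scaleR_sum_left)
    then have "positive ((1 / M\<^sup>2) *\<^sub>R (M *\<^sub>R Q z z - (\<Sum>i<n. Q z (x i) * Q (x i) z)))"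
      by (rule positive_scaleR) simp
    also have "(1 / M\<^sup>2) *\<^sub>R (M *\<^sub>R Q z z - (\<Sum>i<n. Q z (x i) * Q (x i) z))
        = (1 / M) *\<^sub>R Q z z - (1 / M\<^sup>2) *\<^sub>R (\<Sum>i<n. Q z (x i) * Q (x i) z)"
      using M by (simp add: scaleR_right_diff_distrib power2_eq_square)
    finally show ?thesis unfolding eq using M z(1)
      by (intro positive_add positive_scaleR Q_pos) auto
  qed
  \<comment> \<open>Applying the contraction repeatedly to the columns of the powers of X bounds
    every entry by 1, as the power series requires.\<close>
  have column: "positive (1 - (\<Sum>i<n. star (?P k i j) * ?P k i j))" if "j < n" for k j
  proof (induction k)
    case 0
    have "(\<Sum>i<n. star (?P 0 i j) * ?P 0 i j) = (\<Sum>i<n. star (of_bool (i = j)) * of_bool (i = j))"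
      by simp
    then show ?case using that by (simp only: sum_of_bool_mult) simp
  next
    case (Suc k)
    from positive_add[OF Suc contraction[of "\<lambda>i. ?P k i j"]] show ?case by simp
  qed
  have bound: "norm (?P k i j) \<le> 1" if "i < n" "j < n" for k i j
  proof -
    have "(\<Sum>i<n. star (?P k i j) * ?P k i j) = star (?P k i j) * ?P k i j + (\<Sum>i\<in>{..<n}-{i}. star (?P k i j) * ?P k i j)"
      using that by (intro sum.remove) auto
    then have "norm (star (?P k i j) * ?P k i j) \<le> norm (\<Sum>i<n. star (?P k i j) * ?P k i j)"
      by (intro positive_norm_mono) (auto intro: positive_sum)
    also have "\<dots> \<le> norm (1::'b)"
      using column[OF that(2)] by (intro positive_norm_mono positive_sum) auto
    finally have "(norm (?P k i j))\<^sup>2 \<le> 1" by (simp add: norm_star_mult)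
    then show ?thesis by (simp add: power_le_one_iff abs_square_le_1)
  qed
  define R where "R i j = (\<Sum>k. sqrt_series k *\<^sub>R ?P k i j)" for i j
  have starR: "star (R i j) = R j i" if "i < n" "j < n" for i j
  proof -
    have "summable (\<lambda>k. sqrt_series k *\<^sub>R ?P k i j)"
      by (rule summable_norm_cancel[OF summable_norm_sqrt_series[OF bound[OF that]]])
    then show ?thesis
      unfolding R_def by (subst bounded_linear.suminf[OF bounded_linear_star])
        (simp_all add: star_scaleR matrix_power_star[OF starX that])
  qed
  have RR: "(\<Sum>l<n. R i l * R l j) = (1 / M) *\<^sub>R Q (x i) (x j)" if "i < n" "j < n" for i j
  proof -
    have "(\<Sum>l<n. R i l * R l j) = ?P 0 i j - ?P 1 i j"
      unfolding R_def using that by (intro matrix_sqrt matrix_power_add bound)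
    also have "\<dots> = (1 / M) *\<^sub>R Q (x i) (x j)" using that by (simp add: sum_of_bool_mult) (simp add: X_def)
    finally show ?thesis .
  qed
  have gram: "Q (x i) (x j) = (\<Sum>k<n. star (sqrt M *\<^sub>R R k i) * (sqrt M *\<^sub>R R k j))" if "i < n" "j < n" for i j
  proof -
    have "(\<Sum>k<n. star (sqrt M *\<^sub>R R k i) * (sqrt M *\<^sub>R R k j)) = M *\<^sub>R (\<Sum>k<n. R i k * R k j)"
      using M that by (simp add: star_scaleR starR scaleR_sum_right)
    then show ?thesis using M RR[OF that] by simp
  qed
  show ?thesis unfolding mat_positive_def
    by (intro exI[of _ "\<lambda>k i. sqrt M *\<^sub>R R k i"] allI impI gram)
qed

text \<open>The direct sum of m copies, in which a sum of m Gram matrices is again one Gram matrix.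
  Values at indices from m on do not count; Q only has to be semidefinite.\<close>

lemma function_module:
  "semi_module {f::nat \<Rightarrow> 'v. \<forall>k. f k \<in> S} (\<lambda>f g. \<Sum>k<m. Q (f k) (g k))
     (\<lambda>f g k. add (f k) (g k)) (\<lambda>f b k. rm (f k) b)"
proof
  let ?F = "{f::nat \<Rightarrow> 'v. \<forall>k. f k \<in> S}"
  obtain s where "s \<in> S" using nonempty by blast
  then have s: "(\<lambda>_::nat. s) \<in> ?F" by simp
  show "?F \<noteq> {}"
  proof
    assume "?F = {}"
    from equals0D[OF this] s show False by (rule notE)
  qed
  fix x y z b assume x: "x \<in> ?F" and y: "y \<in> ?F" and z: "z \<in> ?F"
  show "(\<lambda>k. add (x k) (y k)) \<in> ?F" "(\<lambda>k. rm (x k) b) \<in> ?F" using x y by (auto simp: add_in rm_in)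
  show "(\<Sum>k<m. Q (x k) (add (y k) (z k))) = (\<Sum>k<m. Q (x k) (y k)) + (\<Sum>k<m. Q (x k) (z k))"
    using x y z by (simp add: Q_add sum.distrib)
  show "(\<Sum>k<m. Q (x k) (rm (y k) b)) = (\<Sum>k<m. Q (x k) (y k)) * b"
    using x y by (simp add: Q_rm sum_distrib_right)
  show "star (\<Sum>k<m. Q (x k) (y k)) = (\<Sum>k<m. Q (y k) (x k))"
    using x y by (simp add: Q_star star_sum)
  show "positive (\<Sum>k<m. Q (x k) (x k))"
    using x by (intro positive_sum Q_pos) simp
qed

end

section \<open>Hilbert modules\<close>

sublocale hilbert_module \<subseteq> semi_module "hcarrier E" "hinner E" "hadd E" "ract E"
  by unfold_locales
    (use zero_closed add_closed ract_closed inner_add inner_ract inner_star inner_positive in auto)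

context hilbert_module
begin

lemma hdiff_closed: "\<lbrakk>x \<in> hcarrier E; y \<in> hcarrier E\<rbrakk> \<Longrightarrow> hdiff E x y \<in> hcarrier E"
  by (simp add: hdiff_def add_closed ract_closed)

lemma emb_hadd: "\<lbrakk>x \<in> hcarrier E; y \<in> hcarrier E\<rbrakk> \<Longrightarrow> emb (hadd E x y) = emb x + emb y"
  by (rule emb_add)

lemma emb_hdiff: "\<lbrakk>x \<in> hcarrier E; y \<in> hcarrier E\<rbrakk> \<Longrightarrow> emb (hdiff E x y) = emb x - emb y"
  unfolding hdiff_def by (rule emb_diff)

lemma hnorm_emb: "x \<in> hcarrier E \<Longrightarrow> hnorm E x = norm (emb x)"
  by (simp add: hnorm_def norm_emb)

lemma hnorm_hdiff: "\<lbrakk>x \<in> hcarrier E; y \<in> hcarrier E\<rbrakk> \<Longrightarrow> hnorm E (hdiff E x y) = norm (emb x - emb y)"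
  by (simp add: hnorm_emb hdiff_closed emb_hdiff)

lemma emb_zero: "emb (hzero E) = 0"
  using emb_hadd[OF zero_closed zero_closed] add_zero[OF zero_closed] by simp

lemma emb_eq_zero: "x \<in> hcarrier E \<Longrightarrow> emb x = 0 \<Longrightarrow> x = hzero E"
  using norm_emb[of x] by (intro inner_definite) auto

lemma emb_inject:
  assumes x: "x \<in> hcarrier E" and y: "y \<in> hcarrier E" and eq: "emb x = emb y"
  shows "x = y"
proof -
  have y1: "ract E y (- 1) \<in> hcarrier E" using y by (rule ract_closed)
  have "hdiff E x y = hzero E" using assms by (intro emb_eq_zero hdiff_closed) (simp_all add: emb_hdiff)
  then have 1: "hadd E x (ract E y (- 1)) = hzero E" by (simp add: hdiff_def)
  have 2: "hadd E y (ract E y (- 1)) = hzero E"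
    using y by (intro emb_eq_zero) (simp_all add: emb_hadd ract_closed emb_minus add_closed)
  have "x = hadd E x (hadd E (ract E y (- 1)) y)"
    using add_zero[OF x] 2 add_commute[OF y y1] by simp
  also have "\<dots> = hadd E (hzero E) y" using add_assoc[OF x y1 y] 1 by simp
  also have "\<dots> = y" using add_commute[OF zero_closed y] add_zero[OF y] by simp
  finally show ?thesis .
qed

lemma hinner_tendsto:
  assumes "\<And>n. X n \<in> hcarrier E" "\<And>n. Y n \<in> hcarrier E" "x \<in> hcarrier E" "y \<in> hcarrier E"
    "(\<lambda>n. emb (X n)) \<longlonglongrightarrow> emb x" "(\<lambda>n. emb (Y n)) \<longlonglongrightarrow> emb y"
  shows "(\<lambda>n. hinner E (X n) (Y n)) \<longlonglongrightarrow> hinner E x y"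
proof -
  have "(\<lambda>n. hinner E (X n) (Y n)) \<longlonglongrightarrow> ip (emb x) (emb y)"
    by (rule ip_tendsto) (fact assms)+
  then show ?thesis using assms(3,4) by (simp add: ip_emb)
qed

end

context correspondence
begin

lemma lact_sum_inner:
  assumes "x \<in> hcarrier E" "y \<in> hcarrier E"
  shows "hinner E x (lact E (sum a I) y) = (\<Sum>i\<in>I. hinner E x (lact E (a i) y))"
proof -
  have add: "hinner E x (lact E (a + b) y) = hinner E x (lact E a y) + hinner E x (lact E b y)" for a b
    using assms by (simp add: lact_add_left inner_add lact_closed)
  interpret additive "\<lambda>a. hinner E x (lact E a y)" by unfold_locales (rule add)
  show ?thesis by (rule sum)
qed

lemma lact_star_mult_inner:
  assumes "x \<in> hcarrier E" "y \<in> hcarrier E"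
  shows "hinner E x (lact E (star a * b) y) = hinner E (lact E a x) (lact E b y)"
  using assms by (simp add: lact_adjoint lact_lact lact_closed)

text \<open>If A = \<open>star C * C\<close>, the image has as entries the sums over k of the inner
  products of C k i x and C k j x. It is the Gram matrix of n vectors in the n-fold direct
  sum.\<close>

lemma completely_positive_vector:
  assumes x: "x \<in> hcarrier E"
  shows "completely_positive (\<lambda>b. hinner E x (lact E b x))"
  unfolding completely_positive_def
proof (intro conjI allI impI)
  show "clinear (\<lambda>b. hinner E x (lact E b x))"
    unfolding clinear_def using x
    by (simp add: lact_add_left inner_add lact_closed lact_scaleC inner_ract mult_scaleC_right)
next
  fix n and A :: "nat \<Rightarrow> nat \<Rightarrow> 'b" assume "mat_positive n A"
  then obtain C where C: "\<And>i j. i < n \<Longrightarrow> j < n \<Longrightarrow> A i j = (\<Sum>k<n. star (C k i) * C k j)"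
    unfolding mat_positive_def by blast
  interpret f: semi_module "{f::nat \<Rightarrow> 'e. \<forall>k. f k \<in> hcarrier E}" "\<lambda>f g. \<Sum>k<n. hinner E (f k) (g k)"
    "\<lambda>f g k. hadd E (f k) (g k)" "\<lambda>f b k. ract E (f k) b"
    by (rule function_module)
  have "mat_positive n (\<lambda>i j. \<Sum>k<n. hinner E (lact E (C k i) x) (lact E (C k j) x))"
    using f.gram_mat_positive[of n "\<lambda>i k. lact E (C k i) x"] x by (simp add: lact_closed)
  moreover have "hinner E x (lact E (A i j) x) = (\<Sum>k<n. hinner E (lact E (C k i) x) (lact E (C k j) x))"
    if "i < n" "j < n" for i j
    using x that by (simp add: C lact_sum_inner lact_star_mult_inner)
  ultimately show "mat_positive n (\<lambda>i j. hinner E x (lact E (A i j) x))"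
    unfolding mat_positive_def by simp
qed

end

section \<open>The internal tensor product\<close>

lemma fsum_inner_nth:
  "fsum_inner E F X Y = (\<Sum>i<length X. \<Sum>j<length Y.
     hinner F (snd (X ! i)) (lact F (hinner E (fst (X ! i)) (fst (Y ! j))) (snd (Y ! j))))"
  unfolding fsum_inner_def sum_list_sum_nth
  by (simp add: case_prod_beta atLeast0LessThan sum_list_sum_nth)

locale correspondence_tensor = E: correspondence E + F: correspondence F
  for E :: "('e, 'b::cstar_algebra) corr" and F :: "('f, 'b) corr"
begin

text \<open>Factor the Gram matrix of the left components as \<open>star C * C\<close>. The
  expression becomes the sum over k of the squares of z k, where z k is the sum over i of the C k i
  y i.\<close>

lemma fsum_inner_positive:
  assumes X: "set X \<subseteq> hcarrier E \<times> hcarrier F"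
  shows "positive (fsum_inner E F X X)"
proof -
  define n where "n = length X"
  define x where "x i = fst (X ! i)" for i
  define y where "y i = snd (X ! i)" for i
  have XY: "x i \<in> hcarrier E" "y i \<in> hcarrier F" if "i < n" for i
  proof -
    have "X ! i \<in> hcarrier E \<times> hcarrier F" using X that nth_mem unfolding n_def by blast
    then show "x i \<in> hcarrier E" "y i \<in> hcarrier F" by (auto simp: x_def y_def)
  qed
  have "mat_positive n (\<lambda>i j. hinner E (x i) (x j))" using XY by (intro E.gram_mat_positive) auto
  then obtain C where C: "\<And>i j. i < n \<Longrightarrow> j < n \<Longrightarrow> hinner E (x i) (x j) = (\<Sum>k<n. star (C k i) * C k j)"
    unfolding mat_positive_def by blast
  have "\<exists>z\<in>hcarrier F. \<forall>w\<in>hcarrier F. hinner F w z = (\<Sum>i<n. hinner F w (lact F (C k i) (y i)))" for k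
    using F.combination_exists[of n "\<lambda>i. lact F (C k i) (y i)" "\<lambda>_. 1"] XY by (simp add: F.lact_closed)
  then obtain z where z: "\<And>k. z k \<in> hcarrier F"
    "\<And>k w. w \<in> hcarrier F \<Longrightarrow> hinner F w (z k) = (\<Sum>i<n. hinner F w (lact F (C k i) (y i)))"
    by metis
  have "fsum_inner E F X X = (\<Sum>i<n. \<Sum>j<n. \<Sum>k<n. hinner F (lact F (C k i) (y i)) (lact F (C k j) (y j)))"
    unfolding fsum_inner_nth n_def[symmetric] x_def[symmetric] y_def[symmetric] using XY
    by (intro sum.cong refl) (simp add: C F.lact_sum_inner F.lact_star_mult_inner)
  also have "\<dots> = (\<Sum>i<n. \<Sum>k<n. hinner F (lact F (C k i) (y i)) (z k))"
  proof (rule sum.cong[OF refl])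
    fix i assume "i \<in> {..<n}"
    then show "(\<Sum>j<n. \<Sum>k<n. hinner F (lact F (C k i) (y i)) (lact F (C k j) (y j)))
      = (\<Sum>k<n. hinner F (lact F (C k i) (y i)) (z k))"
      using XY by (subst sum.swap) (simp add: z F.lact_closed)
  qed
  also have "\<dots> = (\<Sum>k<n. \<Sum>i<n. star (hinner F (z k) (lact F (C k i) (y i))))"
    using XY z(1) by (subst sum.swap) (simp add: F.inner_star F.lact_closed)
  also have "\<dots> = (\<Sum>k<n. hinner F (z k) (z k))"
    by (intro sum.cong refl) (metis z star_sum F.inner_star)
  finally show ?thesis using z(1) by (simp add: positive_sum F.inner_positive)
qed

sublocale T: semi_module "{X. set X \<subseteq> hcarrier E \<times> hcarrier F}" "fsum_inner E F" "(@)"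
  "\<lambda>X b. map (\<lambda>(x, y). (x, ract F y b)) X"
proof
  let ?S = "{X. set X \<subseteq> hcarrier E \<times> hcarrier F}"
  have "[] \<in> ?S" by simp
  then show "?S \<noteq> {}" by blast
  fix X Y Z b assume X: "X \<in> ?S" and Y: "Y \<in> ?S" and Z: "Z \<in> ?S"
  show "X @ Y \<in> ?S" using X Y by simp
  show "map (\<lambda>(x, y). (x, ract F y b)) X \<in> ?S" using X by (auto simp: F.ract_closed)
  show "fsum_inner E F X (Y @ Z) = fsum_inner E F X Y + fsum_inner E F X Z"
    by (induction X) (auto simp: fsum_inner_def algebra_simps)
  have m: "hinner F y (lact F a (ract F y' b)) = hinner F y (lact F a y') * b"
    if "y \<in> hcarrier F" "y' \<in> hcarrier F" for y y' a
    using that by (simp add: F.lact_ract F.inner_ract F.lact_closed)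
  show "fsum_inner E F X (map (\<lambda>(x, y). (x, ract F y b)) Y) = fsum_inner E F X Y * b"
  proof -
    have XY: "snd (X ! i) \<in> hcarrier F" "snd (Y ! j) \<in> hcarrier F" if "i < length X" "j < length Y" for i j
      using X Y nth_mem[OF that(1)] nth_mem[OF that(2)] by (auto simp: mem_Times_iff)
    show ?thesis
      unfolding fsum_inner_nth sum_distrib_right length_map
      by (intro sum.cong refl) (simp add: case_prod_beta m XY)
  qed
  show "star (fsum_inner E F X Y) = fsum_inner E F Y X"
  proof -
    have "star (hinner F (snd (X ! i)) (lact F (hinner E (fst (X ! i)) (fst (Y ! j))) (snd (Y ! j))))
       = hinner F (snd (Y ! j)) (lact F (hinner E (fst (Y ! j)) (fst (X ! i))) (snd (X ! i)))"
      if "i < length X" "j < length Y" for i j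
    proof -
      have "X ! i \<in> hcarrier E \<times> hcarrier F" "Y ! j \<in> hcarrier E \<times> hcarrier F"
        using X Y nth_mem[OF that(1)] nth_mem[OF that(2)] by auto
      then show ?thesis
        by (simp add: mem_Times_iff F.inner_star F.lact_closed F.lact_adjoint E.inner_star)
    qed
    then show ?thesis
      unfolding fsum_inner_nth star_sum by (subst sum.swap) simp
  qed
  show "positive (fsum_inner E F X X)" using X by (intro fsum_inner_positive) simp
qed

lemma fsum_dist_eq:
  assumes "set X \<subseteq> hcarrier E \<times> hcarrier F" "set Y \<subseteq> hcarrier E \<times> hcarrier F"
  shows "fsum_dist E F X Y = norm (T.emb X - T.emb Y)"
proof -
  have "fsum_dist E F X Y = norm (T.emb (X @ map (\<lambda>(x, y). (x, ract F y (- 1))) Y))"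
    unfolding fsum_dist_def Let_def using assms T.rm_in[of Y "-1"] by (subst T.norm_emb) auto
  then show ?thesis using assms T.emb_diff[of X Y] by simp
qed

lemma tensor_cauchy_iff:
  "X \<in> tensor_cauchy E F \<longleftrightarrow> (\<forall>n. set (X n) \<subseteq> hcarrier E \<times> hcarrier F) \<and> Cauchy (\<lambda>n. T.emb (X n))"
  unfolding tensor_cauchy_def Cauchy_iff using fsum_dist_eq by auto

text \<open>A class of Cauchy sequences amounts to a point of the completed space of formal sums. In
  particular the representative picked by \<open>tensor_rep\<close> has the same limit as any
  other.\<close>

lemma tensor_class_iff:
  assumes X: "\<And>n. set (X n) \<subseteq> hcarrier E \<times> hcarrier F" "(\<lambda>n. T.emb (X n)) \<longlonglongrightarrow> l"
  shows "Y \<in> tensor_class E F X \<longleftrightarrow> (\<forall>n. set (Y n) \<subseteq> hcarrier E \<times> hcarrier F) \<and> (\<lambda>n. T.emb (Y n)) \<longlonglongrightarrow> l"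
proof (cases "\<forall>n. set (Y n) \<subseteq> hcarrier E \<times> hcarrier F")
  case True
  have "(\<lambda>n. fsum_dist E F (X n) (Y n)) \<longlonglongrightarrow> 0 \<longleftrightarrow> (\<lambda>n. T.emb (X n) - T.emb (Y n)) \<longlonglongrightarrow> 0"
    using X True by (simp add: fsum_dist_eq tendsto_norm_zero_iff)
  also have "\<dots> \<longleftrightarrow> (\<lambda>n. T.emb (Y n)) \<longlonglongrightarrow> l"
  proof
    assume "(\<lambda>n. T.emb (X n) - T.emb (Y n)) \<longlonglongrightarrow> 0"
    from tendsto_diff[OF X(2) this] show "(\<lambda>n. T.emb (Y n)) \<longlonglongrightarrow> l" by simp
  next
    assume "(\<lambda>n. T.emb (Y n)) \<longlonglongrightarrow> l"
    from tendsto_diff[OF X(2) this] show "(\<lambda>n. T.emb (X n) - T.emb (Y n)) \<longlonglongrightarrow> 0" by simp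
  qed
  finally show ?thesis using True LIMSEQ_imp_Cauchy
    unfolding tensor_class_def by (auto simp: tensor_cauchy_iff)
next
  case False
  then show ?thesis unfolding tensor_class_def tensor_cauchy_iff by blast
qed

lemma tensor_rep_class:
  assumes "\<And>n. set (X n) \<subseteq> hcarrier E \<times> hcarrier F" "(\<lambda>n. T.emb (X n)) \<longlonglongrightarrow> l"
  shows "set (tensor_rep (tensor_class E F X) n) \<subseteq> hcarrier E \<times> hcarrier F"
    "(\<lambda>n. T.emb (tensor_rep (tensor_class E F X) n)) \<longlonglongrightarrow> l"
proof -
  have "X \<in> tensor_class E F X" using assms by (subst tensor_class_iff) auto
  then have "tensor_rep (tensor_class E F X) \<in> tensor_class E F X"
    unfolding tensor_rep_def by (rule someI[of "\<lambda>Y. Y \<in> tensor_class E F X"])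
  then show "set (tensor_rep (tensor_class E F X) n) \<subseteq> hcarrier E \<times> hcarrier F"
    "(\<lambda>n. T.emb (tensor_rep (tensor_class E F X) n)) \<longlonglongrightarrow> l"
    by (subst (asm) tensor_class_iff[OF assms]; simp)+
qed

lemma tensor_cauchyI:
  assumes "\<And>n. set (X n) \<subseteq> hcarrier E \<times> hcarrier F" "(\<lambda>n. T.emb (X n)) \<longlonglongrightarrow> l"
  shows "X \<in> tensor_cauchy E F"
  using assms LIMSEQ_imp_Cauchy by (auto simp: tensor_cauchy_iff)

lemma tensor_hinner:
  assumes "\<And>n. set (X n) \<subseteq> hcarrier E \<times> hcarrier F" "(\<lambda>n. T.emb (X n)) \<longlonglongrightarrow> l"
    "\<And>n. set (Y n) \<subseteq> hcarrier E \<times> hcarrier F" "(\<lambda>n. T.emb (Y n)) \<longlonglongrightarrow> m"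
  shows "hinner (internal_tensor E F) (tensor_class E F X) (tensor_class E F Y) = T.ip l m"
proof -
  have "(\<lambda>n. fsum_inner E F (tensor_rep (tensor_class E F X) n) (tensor_rep (tensor_class E F Y) n)) \<longlonglongrightarrow> T.ip l m"
    using tensor_rep_class[OF assms(1,2)] tensor_rep_class[OF assms(3,4)]
    by (intro T.ip_tendsto) simp_all
  then show ?thesis by (simp add: internal_tensor_def limI)
qed

lemma elem_tensor_in:
  "\<lbrakk>x \<in> hcarrier E; y \<in> hcarrier F\<rbrakk> \<Longrightarrow> elem_tensor E F x y \<in> hcarrier (internal_tensor E F)"
  unfolding elem_tensor_def internal_tensor_def by (auto intro!: tensor_cauchyI)

lemma elem_tensor_inner:
  assumes "x \<in> hcarrier E" "y \<in> hcarrier F" "x' \<in> hcarrier E" "y' \<in> hcarrier F"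
  shows "hinner (internal_tensor E F) (elem_tensor E F x y) (elem_tensor E F x' y')
    = hinner F y (lact F (hinner E x x') y')"
proof -
  have "hinner (internal_tensor E F) (elem_tensor E F x y) (elem_tensor E F x' y')
      = T.ip (T.emb [(x, y)]) (T.emb [(x', y')])"
    unfolding elem_tensor_def by (rule tensor_hinner) (use assms in auto)
  also have "\<dots> = fsum_inner E F [(x, y)] [(x', y')]" by (rule T.ip_emb) (use assms in auto)
  finally show ?thesis by (simp add: fsum_inner_def)
qed

end

lemma psmult_closed:
  assumes P: "product_system P" and st: "s \<ge> 0" "t \<ge> 0"
    and "x \<in> hcarrier (fibre P s)" "y \<in> hcarrier (fibre P t)"
  shows "psmult P s t x y \<in> hcarrier (fibre P (s + t))"
proof -
  interpret correspondence_tensor "fibre P s" "fibre P t"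
    using P st by (simp add: product_system_def correspondence_tensor_def)
  have "right_isometry (internal_tensor (fibre P s) (fibre P t)) (fibre P (s + t)) (psu P s t)"
    using P st by (simp add: product_system_def bilinear_unitary_def bilinear_isometry_def)
  then show ?thesis unfolding psmult_def using assms(4,5) elem_tensor_in by (simp add: right_isometry_def)
qed

lemma psmult_inner:
  assumes P: "product_system P" and st: "s \<ge> 0" "t \<ge> 0"
    and x: "x \<in> hcarrier (fibre P s)" "x' \<in> hcarrier (fibre P s)"
    and y: "y \<in> hcarrier (fibre P t)" "y' \<in> hcarrier (fibre P t)"
  shows "hinner (fibre P (s + t)) (psmult P s t x y) (psmult P s t x' y')
    = hinner (fibre P t) y (lact (fibre P t) (hinner (fibre P s) x x') y')"
proof -
  interpret correspondence_tensor "fibre P s" "fibre P t"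
    using P st by (simp add: product_system_def correspondence_tensor_def)
  have "right_isometry (internal_tensor (fibre P s) (fibre P t)) (fibre P (s + t)) (psu P s t)"
    using P st by (simp add: product_system_def bilinear_unitary_def bilinear_isometry_def)
  then have "hinner (fibre P (s + t)) (psmult P s t x y) (psmult P s t x' y')
    = hinner (internal_tensor (fibre P s) (fibre P t)) (elem_tensor (fibre P s) (fibre P t) x y)
        (elem_tensor (fibre P s) (fibre P t) x' y')"
    unfolding psmult_def using elem_tensor_in x y by (simp add: right_isometry_def)
  then show ?thesis using elem_tensor_inner x y by simp
qed

section \<open>Embeddability implies spatiality\<close>

theorem spatial_if_embeddable:
  fixes T :: "real \<Rightarrow> 'b::cstar_algebra \<Rightarrow> 'b"
  assumes T: "cp_semigroup T" "strongly_continuous T" and gns: "gns_system T P \<xi>"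
    and G: "continuous_spatial_product_system G H i" and v: "gns_embedding P \<xi> G H i v"
  shows "spatial_cp_semigroup T"
proof -
  have cps: "continuous_product_system G H i" using G by (simp add: continuous_spatial_product_system_def)
  obtain \<omega> where \<omega>: "\<omega> \<in> cont_sections G H i" "central_unit G \<omega>" "unital_unit G \<omega>"
    using G by (auto simp: continuous_spatial_product_system_def)
  have psG: "product_system G" using cps by (simp add: continuous_product_system_def)
  have corrG: "correspondence (fibre G t)" if "t \<ge> 0" for t
    using psG that by (simp add: product_system_def)
  define \<zeta> where "\<zeta> t = v t (\<xi> t)" for t
  define c where "c t = hinner (fibre G t) (\<omega> t) (\<zeta> t)" for t
  have unit\<xi>: "\<xi> t \<in> hcarrier (fibre P t)" if "t \<ge> 0" for t
    using gns that by (simp add: gns_system_def ps_unit_def)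
  have \<zeta>in: "\<zeta> t \<in> hcarrier (fibre G t)" and \<omega>in: "\<omega> t \<in> hcarrier (fibre G t)" if "t \<ge> 0" for t
    using v \<omega> that by (auto simp: gns_embedding_def cont_sections_def \<zeta>_def)
  have T\<zeta>: "T t b = hinner (fibre G t) (\<zeta> t) (lact (fibre G t) b (\<zeta> t))" if t: "t \<ge> 0" for t b
  proof -
    interpret P: correspondence "fibre P t" using gns t by (simp add: gns_system_def product_system_def)
    have "bilinear_isometry (fibre P t) (fibre G t) (v t)" using v t by (simp add: gns_embedding_def)
    moreover have "T t b = hinner (fibre P t) (\<xi> t) (lact (fibre P t) b (\<xi> t))"
      using gns t by (simp add: gns_system_def)
    moreover have "lact (fibre P t) b (\<xi> t) \<in> hcarrier (fibre P t)" using unit\<xi>[OF t] by (rule P.lact_closed)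
    ultimately show ?thesis using unit\<xi>[OF t]
      unfolding \<zeta>_def bilinear_isometry_def right_isometry_def by metis
  qed
  have \<zeta>mult: "psmult G s t (\<zeta> s) (\<zeta> t) = \<zeta> (s + t)" if "s \<ge> 0" "t \<ge> 0" for s t
  proof -
    have "psmult P s t (\<xi> s) (\<xi> t) = \<xi> (s + t)" using gns that by (simp add: gns_system_def ps_unit_def)
    moreover have "v (s + t) (psmult P s t (\<xi> s) (\<xi> t)) = psmult G s t (v s (\<xi> s)) (v t (\<xi> t))"
      using v unit\<xi> that by (simp add: gns_embedding_def)
    ultimately show ?thesis by (simp add: \<zeta>_def)
  qed
  have \<zeta>section: "\<zeta> \<in> cont_sections G H i" using v by (simp add: gns_embedding_def \<zeta>_def[abs_def])
  have 1: "continuous_on {0..} c"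
  proof -
    \<comment> \<open>The definition provides continuity of inner products with a left action in
      between; here it is that of 1.\<close>
    have "continuous_on {0..} (\<lambda>t. hinner (fibre G t) (\<omega> t) (lact (fibre G t) 1 (\<zeta> t)))"
      using cps \<omega>(1) \<zeta>section by (simp add: continuous_product_system_def)
    then show ?thesis
      by (rule continuous_on_eq) (simp add: c_def correspondence.lact_one[OF corrG] \<zeta>in)
  qed
  have 2: "c 0 = 1"
  proof -
    have "\<xi> 0 = base P 1" using gns by (simp add: gns_system_def ps_unit_def)
    then have "\<zeta> 0 = base G 1" using v by (simp add: \<zeta>_def gns_embedding_def)
    then show ?thesis using \<omega>(3) by (auto simp: c_def unital_unit_def ps_unit_def)
  qed
  have 3: "c s * c t = c (s + t)" if st: "s \<ge> 0" "t \<ge> 0" for s t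
  proof -
    interpret t: correspondence "fibre G t" by (rule corrG[OF st(2)])
    have "psmult G s t (\<omega> s) (\<omega> t) = \<omega> (s + t)" using \<omega> st by (simp add: central_unit_def ps_unit_def)
    then have "c (s + t) = hinner (fibre G (s + t)) (psmult G s t (\<omega> s) (\<omega> t)) (psmult G s t (\<zeta> s) (\<zeta> t))"
      by (simp add: c_def \<zeta>mult st)
    also have "\<dots> = hinner (fibre G t) (\<omega> t) (lact (fibre G t) (c s) (\<zeta> t))"
      using st \<omega>in \<zeta>in by (simp add: psmult_inner[OF psG] c_def)
    also have "\<dots> = hinner (fibre G t) (lact (fibre G t) (star (c s)) (\<omega> t)) (\<zeta> t)"
      using st \<omega>in \<zeta>in by (simp add: t.lact_adjoint star_star)
    \<comment> \<open>Centrality of \<omega> turns the left coefficient into a right one, which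
      comes out of the inner product.\<close>
    also have "\<dots> = hinner (fibre G t) (ract (fibre G t) (\<omega> t) (star (c s))) (\<zeta> t)"
      using \<omega>(2) st by (simp add: central_unit_def)
    also have "\<dots> = c s * c t"
      using st \<omega>in \<zeta>in by (simp add: t.Q_rm_left star_star c_def)
    finally show ?thesis ..
  qed
  have 4: "completely_positive (\<lambda>b. T t b - star (c t) * b * c t)" if t: "t \<ge> 0" for t
  proof -
    interpret t: correspondence "fibre G t" by (rule corrG[OF t])
    let ?G = "fibre G t"
    define \<eta> where "\<eta> = hadd ?G (\<zeta> t) (ract ?G (\<omega> t) (- c t))"
    note in' = \<zeta>in[OF t] \<omega>in[OF t] t.ract_closed t.lact_closed t.add_closed
    have \<eta>: "\<eta> \<in> hcarrier ?G" by (simp add: \<eta>_def in')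
    have c': "hinner ?G (\<zeta> t) (\<omega> t) = star (c t)" using in' by (simp add: c_def t.inner_star)
    have oo: "hinner ?G (\<omega> t) (\<omega> t) = 1" using \<omega>(3) t by (simp add: unital_unit_def)
    have central: "lact ?G b (\<omega> t) = ract ?G (\<omega> t) b" for b using \<omega>(2) t by (simp add: central_unit_def)
    have ob: "hinner ?G (\<omega> t) (lact ?G b (\<zeta> t)) = b * c t" for b
    proof -
      have "hinner ?G (\<omega> t) (lact ?G b (\<zeta> t)) = hinner ?G (lact ?G (star b) (\<omega> t)) (\<zeta> t)"
        using in' by (simp add: t.lact_adjoint star_star)
      then show ?thesis using in' by (simp add: central t.Q_rm_left star_star c_def)
    qed
    have "hinner ?G \<eta> (lact ?G b \<eta>) = T t b - star (c t) * b * c t" for b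
      unfolding \<eta>_def T\<zeta>[OF t]
      by (simp add: in' t.lact_add_right t.lact_ract central t.inner_add t.Q_add_left t.inner_ract
          t.Q_rm_left ob c' oo t.ract_ract star_minus mult.assoc)
    then show ?thesis using t.completely_positive_vector[OF \<eta>] by simp
  qed
  show ?thesis unfolding spatial_cp_semigroup_def using T 1 2 3 4 by blast
qed

section \<open>Positive matrices\<close>

text \<open>Unlike in the definition of positive matrices, \<open>C\<close> need not be a square matrix.\<close>

definition mat_psd :: "nat \<Rightarrow> (nat \<Rightarrow> nat \<Rightarrow> 'b::cstar_algebra) \<Rightarrow> bool" where
  "mat_psd n A \<longleftrightarrow> (\<exists>m::nat. \<exists>C. \<forall>i<n. \<forall>j<n. A i j = (\<Sum>k<m. star (C k i) * C k j))"

lemma mat_psd_cong: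
  assumes "mat_psd n A" "\<And>i j. i < n \<Longrightarrow> j < n \<Longrightarrow> B i j = A i j"
  shows "mat_psd n B"
  using assms unfolding mat_psd_def by metis

lemma mat_psd_conj:
  assumes "mat_psd n A" shows "mat_psd n (\<lambda>i j. star (b i) * A i j * b j)"
proof -
  obtain m :: nat and C where C: "\<And>i j. i < n \<Longrightarrow> j < n \<Longrightarrow> A i j = (\<Sum>k<m. star (C k i) * C k j)"
    using assms unfolding mat_psd_def by blast
  have "star (b i) * A i j * b j = (\<Sum>k<m. star (C k i * b i) * (C k j * b j))" if "i < n" "j < n" for i j
    using that by (simp add: C sum_distrib_left sum_distrib_right star_mult mult.assoc)
  then show ?thesis unfolding mat_psd_def by (intro exI[of _ m] exI[of _ "\<lambda>k i. C k i * b i"]) simp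
qed

lemma mat_psd_add:
  assumes "mat_psd n A" "mat_psd n B" shows "mat_psd n (\<lambda>i j. A i j + B i j)"
proof -
  obtain m :: nat and C where C: "\<And>i j. i < n \<Longrightarrow> j < n \<Longrightarrow> A i j = (\<Sum>k<m. star (C k i) * C k j)"
    using assms(1) unfolding mat_psd_def by blast
  obtain l :: nat and D where D: "\<And>i j. i < n \<Longrightarrow> j < n \<Longrightarrow> B i j = (\<Sum>k<l. star (D k i) * D k j)"
    using assms(2) unfolding mat_psd_def by blast
  define F where "F k = (if k < m then C k else D (k - m))" for k
  have "A i j + B i j = (\<Sum>k<m + l. star (F k i) * F k j)" if "i < n" "j < n" for i j
  proof -
    have "(\<Sum>k<m + l. g k) = (\<Sum>k<m. g k) + (\<Sum>k<l. g (m + k))" for g :: "nat \<Rightarrow> 'a"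
      by (induction l) (auto simp: add.assoc)
    then show ?thesis using that by (simp add: C D F_def)
  qed
  then show ?thesis unfolding mat_psd_def by blast
qed

text \<open>Complete positivity speaks of square factors. Rows of zeros or additional columns bring
  the factor to the size max m n.\<close>

lemma mat_psd_cp:
  assumes f: "completely_positive f" and A: "mat_psd n A" shows "mat_psd n (\<lambda>i j. f (A i j))"
proof -
  obtain m :: nat and C where C: "\<And>i j. i < n \<Longrightarrow> j < n \<Longrightarrow> A i j = (\<Sum>k<m. star (C k i) * C k j)"
    using A unfolding mat_psd_def by blast
  define N where "N = max m n"
  define D where "D k i = (if k < m then C k i else 0)" for k i
  define B where "B i j = (\<Sum>k<N. star (D k i) * D k j)" for i j
  have AB: "A i j = B i j" if "i < n" "j < n" for i j
  proof -
    have "B i j = (\<Sum>k<m. star (D k i) * D k j)"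
      unfolding B_def by (rule sum.mono_neutral_right) (auto simp: N_def D_def)
    then show ?thesis using that by (simp add: C D_def)
  qed
  have "mat_positive N B" unfolding mat_positive_def B_def by (intro exI[of _ D] allI impI refl)
  then have "mat_positive N (\<lambda>i j. f (B i j))" using f unfolding completely_positive_def by blast
  then obtain F where F: "\<And>i j. i < N \<Longrightarrow> j < N \<Longrightarrow> f (B i j) = (\<Sum>k<N. star (F k i) * F k j)"
    unfolding mat_positive_def by blast
  have "f (A i j) = (\<Sum>k<N. star (F k i) * F k j)" if "i < n" "j < n" for i j
    using that F[of i j] by (simp add: AB N_def)
  then show ?thesis unfolding mat_psd_def by blast
qed

lemma mat_psd_positive:
  assumes "mat_psd n A" shows "positive (\<Sum>i<n. \<Sum>j<n. star (b i) * A i j * b j)"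
proof -
  obtain m :: nat and C where C: "\<And>i j. i < n \<Longrightarrow> j < n \<Longrightarrow> A i j = (\<Sum>k<m. star (C k i) * C k j)"
    using assms unfolding mat_psd_def by blast
  have "(\<Sum>i<n. \<Sum>j<n. star (b i) * A i j * b j)
      = (\<Sum>i<n. \<Sum>j<n. \<Sum>k<m. star (C k i * b i) * (C k j * b j))"
    by (intro sum.cong refl) (simp add: C sum_distrib_left sum_distrib_right star_mult mult.assoc)
  also have "\<dots> = (\<Sum>i<n. \<Sum>k<m. \<Sum>j<n. star (C k i * b i) * (C k j * b j))"
    by (rule sum.cong[OF refl]) (rule sum.swap)
  also have "\<dots> = (\<Sum>k<m. \<Sum>i<n. \<Sum>j<n. star (C k i * b i) * (C k j * b j))"
    by (rule sum.swap)
  also have "\<dots> = (\<Sum>k<m. star (\<Sum>i<n. C k i * b i) * (\<Sum>i<n. C k i * b i))"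
    by (simp add: star_sum sum_product)
  finally show ?thesis by (simp add: positive_sum)
qed

text \<open>The matrix with the rows 1, a and star a, \<open>star a * a\<close> is positive; so is
  its image, whose off-diagonal entries are therefore adjoint to each other.\<close>

lemma completely_positive_star:
  assumes f: "completely_positive f" shows "f (star a) = star (f a)"
proof -
  define C where "C k = (\<lambda>i::nat. if k = 0 then (if i = 0 then 1 else a) else 0)" for k :: nat
  have "mat_positive 2 (\<lambda>i j. \<Sum>k<2. star (C k i) * C k j)" unfolding mat_positive_def
    by (intro exI[of _ C] allI impI refl)
  then have "mat_positive 2 (\<lambda>i j. f (\<Sum>k<2. star (C k i) * C k j))"
    using f unfolding completely_positive_def by blast
  then obtain D where D: "\<And>i j. i < 2 \<Longrightarrow> j < 2 \<Longrightarrow> f (\<Sum>k<2. star (C k i) * C k j) = (\<Sum>k<2::nat. star (D k i) * D k j)"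
    unfolding mat_positive_def by blast
  have "f a = (\<Sum>k<2::nat. star (D k 0) * D k 1)" and "f (star a) = (\<Sum>k<2::nat. star (D k 1) * D k 0)"
    using D[of 0 1] D[of 1 0] by (simp_all add: C_def numeral_2_eq_2)
  then show ?thesis by (simp add: star_sum star_mult star_star)
qed

section \<open>The kernel on words\<close>

locale spatial_cp =
  fixes T :: "real \<Rightarrow> 'b::cstar_algebra \<Rightarrow> 'b" and c :: "real \<Rightarrow> 'b"
  assumes T: "cp_semigroup T" and strong: "strongly_continuous T"
    and c_cont: "continuous_on {0..} c" and c_0: "c 0 = 1"
    and c_mult: "\<And>s t. \<lbrakk>s \<ge> 0; t \<ge> 0\<rbrakk> \<Longrightarrow> c s * c t = c (s + t)"
    and c_cp: "\<And>t. t \<ge> 0 \<Longrightarrow> completely_positive (\<lambda>b. T t b - star (c t) * b * c t)"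
begin

text \<open>In the product system to be constructed there are a central unital unit \<open>\<omega>\<close> and a unit \<open>\<xi>\<close>.
  With \<open>\<zeta>(False) = \<omega>\<close> and \<open>\<zeta>(True) = \<xi>\<close> one has \<open>\<langle>\<zeta>(e)\<^sub>t, a \<zeta>(e')\<^sub>t\<rangle> = transfer e e' t a\<close>.\<close>

definition transfer :: "bool \<Rightarrow> bool \<Rightarrow> real \<Rightarrow> 'b \<Rightarrow> 'b" where
  "transfer e e' t a = (if e \<and> e' then T t a else star (if e then c t else 1) * a * (if e' then c t else 1))"

lemma T_cp: "t \<ge> 0 \<Longrightarrow> completely_positive (T t)"
  and T_0: "T 0 a = a"
  and T_semigroup: "s \<ge> 0 \<Longrightarrow> t \<ge> 0 \<Longrightarrow> T (s + t) a = T s (T t a)"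
  using T by (auto simp: cp_semigroup_def)

lemma T_add: "t \<ge> 0 \<Longrightarrow> T t (a + b) = T t a + T t b"
  and T_scaleC: "t \<ge> 0 \<Longrightarrow> T t (z *\<^sub>C a) = z *\<^sub>C T t a"
  using T_cp[of t] by (auto simp: completely_positive_def clinear_def)

lemma transfer_add: "t \<ge> 0 \<Longrightarrow> transfer e e' t (a + b) = transfer e e' t a + transfer e e' t b"
  by (simp add: transfer_def T_add algebra_simps)

lemma transfer_scaleC: "t \<ge> 0 \<Longrightarrow> transfer e e' t (z *\<^sub>C a) = z *\<^sub>C transfer e e' t a"
  by (simp add: transfer_def T_scaleC mult_scaleC_left mult_scaleC_right)

lemma transfer_star: "t \<ge> 0 \<Longrightarrow> star (transfer e e' t a) = transfer e' e t (star a)"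
  by (auto simp: transfer_def completely_positive_star[OF T_cp] star_mult star_star mult.assoc)

lemma transfer_0 [simp]: "transfer e e' 0 a = a"
  by (simp add: transfer_def T_0 c_0)

lemma transfer_transfer:
  assumes "s \<ge> 0" "t \<ge> 0" shows "transfer e e' t (transfer e e' s a) = transfer e e' (s + t) a"
proof -
  have "c (s + t) = c s * c t" "T (s + t) a = T t (T s a)"
    using assms T_semigroup[of t s a] by (simp_all add: c_mult add.commute)
  then show ?thesis by (cases e; cases e') (simp_all add: transfer_def star_mult mult.assoc)
qed

lemma transfer_mult_right: "transfer e False t (a * b) = transfer e False t a * b"
  by (simp add: transfer_def mult.assoc)

lemma transfer_FF [simp]: "transfer False False t a = a"
  by (simp add: transfer_def)

lemma mat_psd_transfer:
  assumes t: "t \<ge> 0" and A: "mat_psd n A"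
  shows "mat_psd n (\<lambda>i j. transfer (e i) (e j) t (A i j))"
proof (rule mat_psd_cong)
  define \<gamma> where "\<gamma> i = (if e i then c t else 1)" for i
  define \<delta> where "\<delta> i = (if e i then 1 else 0 :: 'b)" for i
  show "mat_psd n (\<lambda>i j. star (\<delta> i) * (T t (A i j) - star (c t) * A i j * c t) * \<delta> j + star (\<gamma> i) * A i j * \<gamma> j)"
    by (intro mat_psd_add mat_psd_conj A mat_psd_cp[OF c_cp[OF t] A])
  show "transfer (e i) (e j) t (A i j) = star (\<delta> i) * (T t (A i j) - star (c t) * A i j * c t) * \<delta> j + star (\<gamma> i) * A i j * \<gamma> j" for i j
    by (auto simp: transfer_def \<gamma>_def \<delta>_def)
qed

text \<open>The word \<open>[(b\<^sub>n, e\<^sub>n, t\<^sub>n), \<dots>, (b\<^sub>1, e\<^sub>1, t\<^sub>1)]\<close> stands for \<open>b\<^sub>n \<zeta>(e\<^sub>n)\<^sub>t\<^sub>n \<cdots> b\<^sub>1 \<zeta>(e\<^sub>1)\<^sub>t\<^sub>1\<close> and,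
  at the same time, for the product of this vector with \<open>\<omega>\<close> at all later times. Then
  \<open>\<langle>u, a w\<rangle> = kern u w a\<close> makes sense for words \<open>u\<close> and \<open>w\<close> of different duration.\<close>

fun kern :: "('b \<times> bool \<times> real) list \<Rightarrow> ('b \<times> bool \<times> real) list \<Rightarrow> 'b \<Rightarrow> 'b" where
  "kern [] [] = (\<lambda>a. a)"
| "kern ((b, e, s) # u) [] = (\<lambda>a. kern u [] (transfer e False s (star b * a)))"
| "kern [] ((b', e', s') # w) = (\<lambda>a. kern [] w (transfer False e' s' (a * b')))"
| "kern ((b, e, s) # u) ((b', e', s') # w) =
    (if s = s' then (\<lambda>a. kern u w (transfer e e' s (star b * a * b')))
     else if s < s' then (\<lambda>a. kern u ((1, e', s' - s) # w) (transfer e e' s (star b * a * b')))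
     else (\<lambda>a. kern ((1, e, s - s') # u) w (transfer e e' s' (star b * a * b'))))"

definition valid :: "('b \<times> bool \<times> real) list \<Rightarrow> bool" where
  "valid w \<longleftrightarrow> (\<forall>(b, e, t)\<in>set w. t \<ge> 0)"

definition duration :: "('b \<times> bool \<times> real) list \<Rightarrow> real" where
  "duration w = (\<Sum>(b, e, t)\<leftarrow>w. t)"

lemma valid_simps [simp]: "valid []" "valid ((b, e, t) # w) \<longleftrightarrow> t \<ge> 0 \<and> valid w" "valid (u @ w) \<longleftrightarrow> valid u \<and> valid w"
  by (auto simp: valid_def ball_Un)

lemma duration_simps [simp]: "duration [] = 0" "duration ((b, e, t) # w) = t + duration w"
  "duration (u @ w) = duration u + duration w"
  by (auto simp: duration_def)

lemma duration_nonneg: "valid w \<Longrightarrow> duration w \<ge> 0"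
  by (induction w) auto

lemma kern_add: "valid u \<Longrightarrow> valid w \<Longrightarrow> kern u w (a + b) = kern u w a + kern u w b"
proof (induction u w arbitrary: a b rule: kern.induct)
  case (4 b e s u b' e' s' w)
  then show ?case by (cases s s' rule: linorder_cases) (auto simp: transfer_add algebra_simps)
qed (auto simp: transfer_add algebra_simps)

lemma kern_scaleC: "valid u \<Longrightarrow> valid w \<Longrightarrow> kern u w (z *\<^sub>C a) = z *\<^sub>C kern u w a"
proof (induction u w arbitrary: a rule: kern.induct)
  case (4 b e s u b' e' s' w)
  then show ?case
    by (cases s s' rule: linorder_cases) (auto simp: transfer_scaleC mult_scaleC_left mult_scaleC_right)
qed (auto simp: transfer_scaleC mult_scaleC_left mult_scaleC_right)

lemma kern_star: "valid u \<Longrightarrow> valid w \<Longrightarrow> star (kern u w a) = kern w u (star a)"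
proof (induction u w arbitrary: a rule: kern.induct)
  case (4 b e s u b' e' s' w)
  then show ?case
    by (cases s s' rule: linorder_cases) (auto simp: transfer_star star_mult star_star mult.assoc)
qed (auto simp: transfer_star star_mult star_star)

lemma kern_coeff_right: "kern u ((b, e, s) # w) a = kern u ((1, e, s) # w) (a * b)"
  by (cases u) (auto simp: mult.assoc)

lemma kern_coeff_left: "kern ((b, e, s) # u) w a = kern ((1, e, s) # u) w (star b * a)"
  by (cases w) (auto simp: mult.assoc)

text \<open>A letter of duration 0 acts by its coefficient alone. Both halves are proved together:
  when the other word starts with duration 0 as well, the recursion strips both letters at once, and
  each half needs the other one for a shorter word.\<close>

lemma kern_zero:
  assumes "valid u" "valid w"
  shows "kern ((b, e, 0) # u) w a = kern u w (star b * a)" "kern u ((b, e, 0) # w) a = kern u w (a * b)"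
proof -
  have "(\<forall>b e a. kern ((b, e, 0) # u) w a = kern u w (star b * a)) \<and>
        (\<forall>b e a. kern u ((b, e, 0) # w) a = kern u w (a * b))"
    using assms
  proof (induction "length u + length w" arbitrary: u w rule: less_induct)
    case less
    have right: "kern u ((b, e, 0) # w) a = kern u w (a * b)"
      if left: "\<And>d f r u' b e a. u = (d, f, r) # u' \<Longrightarrow> kern ((b, e, 0) # u') w a = kern u' w (star b * a)" for b e a
    proof (cases u)
      case (Cons l u')
      obtain d f r where l: "l = (d, f, r)" by (cases l)
      show ?thesis
      proof (cases "r = 0")
        case True
        then show ?thesis using Cons l left[of d f r u'] by (simp add: mult.assoc)
      next
        case False
        then show ?thesis using Cons l less.prems
          by (simp add: mult.assoc) (subst (2) kern_coeff_left, simp add: mult.assoc)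
      qed
    qed simp
    have left: "kern ((b, e, 0) # u) w a = kern u w (star b * a)"
      if right: "\<And>d f r w' b e a. w = (d, f, r) # w' \<Longrightarrow> kern u ((b, e, 0) # w') a = kern u w' (a * b)" for b e a
    proof (cases w)
      case (Cons l w')
      obtain d f r where l: "l = (d, f, r)" by (cases l)
      show ?thesis
      proof (cases "r = 0")
        case True
        then show ?thesis using Cons l right[of d f r w'] by (simp add: mult.assoc)
      next
        case False
        then show ?thesis using Cons l less.prems
          by (simp add: mult.assoc) (subst (2) kern_coeff_right, simp add: mult.assoc)
      qed
    qed simp
    have "kern ((b, e, 0) # u') w a = kern u' w (star b * a)" if "u = (d, f, r) # u'" for d f r u' b e a
      using less.hyps[of u' w] less.prems that by auto
    moreover have "kern u ((b, e, 0) # w') a = kern u w' (a * b)" if "w = (d, f, r) # w'" for d f r w' b e a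
      using less.hyps[of u w'] less.prems that by auto
    ultimately show ?case using left right by blast
  qed
  then show "kern ((b, e, 0) # u) w a = kern u w (star b * a)" "kern u ((b, e, 0) # w) a = kern u w (a * b)"
    by auto
qed

text \<open>The formula for the inner product of elementary tensors, on the level of words. With
  unequal durations, letters of w or w' would be paired with the rest of the longer word. When one
  of u, u' is exhausted, the other has only letters of duration 0 left.\<close>

lemma kern_append:
  assumes "valid u" "valid u'" "valid w" "valid w'" "duration u = duration u'"
  shows "kern (u @ w) (u' @ w') a = kern w w' (kern u u' a)"
  using assms(1,2,5)
proof (induction u u' arbitrary: a rule: kern.induct)
  case (2 b e s u)
  then have s: "s = 0" "duration u = 0" using duration_nonneg[of u] by auto
  then show ?case using 2 assms by (simp add: kern_zero)
next
  case (3 b' e' s' u')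
  then have s: "s' = 0" "duration u' = 0" using duration_nonneg[of u'] by auto
  then show ?case using 3 assms by (simp add: kern_zero)
next
  case (4 b e s u b' e' s' u')
  then show ?case by (cases s s' rule: linorder_cases) auto
qed (use assms in simp)

text \<open>The unit property \<zeta>_s \<zeta>_t = \<zeta>_(s + t) for both colours. The first
  letter of the other word may end before s, at s, between s and s + t, at s + t, or later.\<close>

lemma kern_split:
  assumes "s \<ge> 0" "t \<ge> 0" "valid w" and u: "valid u"
  shows "kern ((b, e, s) # (1, e, t) # u) w a = kern ((b, e, s + t) # u) w a"
  using assms(1,3)
proof (induction w arbitrary: s b a)
  case Nil
  then show ?case using assms by (simp add: transfer_transfer)
next
  case (Cons l w)
  obtain d f r where l: "l = (d, f, r)" by (cases l)
  have r: "r \<ge> 0" "valid w" using Cons.prems l by auto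
  consider "r < s" | "r = s" | "s < r" "r < s + t" | "s < r" "r = s + t" | "r > s + t" by linarith
  then show ?case
  proof cases
    case 1
    then show ?thesis
      using Cons.IH[of "s - r" 1 "transfer e f r (star b * a * d)"] Cons.prems assms(2) r
      by (simp add: l diff_add_eq)
  next
    case 2
    then show ?thesis using Cons.prems assms(2) r u
      by (cases "t = 0") (simp_all add: l kern_zero)
  next
    case 3
    then show ?thesis using Cons.prems assms(2) r
      by (simp add: l transfer_transfer) (simp add: algebra_simps)
  next
    case 4
    then show ?thesis using Cons.prems assms(2) r by (simp add: l transfer_transfer)
  next
    case 5
    then show ?thesis using Cons.prems assms(2) r
      by (simp add: l transfer_transfer) (simp add: algebra_simps)
  qed
qed

lemma kern_Nil_mult: "kern u [] (a * b) = kern u [] a * b"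
  by (induction u arbitrary: a) (auto simp: transfer_mult_right mult.assoc[symmetric])

text \<open>The word w is prolonged by \<omega> anyway, and b can be moved to the right end because
  \<omega> is central.\<close>

lemma kern_pad:
  assumes "valid u" "valid w" "r \<ge> 0"
  shows "kern u (w @ [(b, False, r)]) a = kern u w a * b"
  using assms
proof (induction u w arbitrary: a r rule: kern.induct)
  case (2 d e s u)
  consider "s = r" | "s < r" | "s > r" by linarith
  then show ?case
  proof cases
    case 1
    then show ?thesis by (simp add: mult.assoc[symmetric] transfer_mult_right kern_Nil_mult)
  next
    case 2
    then show ?thesis
      using "2.IH"[of "r - s" "transfer e False s (star d * a)"] "2.prems"
      by (simp add: mult.assoc[symmetric] transfer_mult_right)
         (metis append_Nil kern_coeff_right)
  next
    case 3
    then show ?thesis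
      using "2.prems"
      by (simp add: mult.assoc[symmetric] transfer_mult_right kern_Nil_mult transfer_transfer)
  qed
next
  case (4 b e s u b' e' s' w)
  then show ?case by (cases s s' rule: linorder_cases) auto
qed (simp_all add: mult.assoc)

section \<open>Positivity of the kernel\<close>

definition head_coeff :: "('b \<times> bool \<times> real) list \<Rightarrow> 'b" where
  "head_coeff w = (case w of [] \<Rightarrow> 1 | (b, e, t) # w' \<Rightarrow> b)"

definition head_colour :: "('b \<times> bool \<times> real) list \<Rightarrow> bool" where
  "head_colour w = (case w of [] \<Rightarrow> False | (b, e, t) # w' \<Rightarrow> e)"

definition cut :: "real \<Rightarrow> ('b \<times> bool \<times> real) list \<Rightarrow> ('b \<times> bool \<times> real) list" where
  "cut s w = (case w of [] \<Rightarrow> [] | (b, e, t) # w' \<Rightarrow> if t = s then w' else (1, e, t - s) # w')"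

lemma kern_cut:
  assumes "s \<ge> 0" "u \<noteq> [] \<Longrightarrow> s \<le> snd (snd (hd u))" "w \<noteq> [] \<Longrightarrow> s \<le> snd (snd (hd w))"
  shows "kern u w a = kern (cut s u) (cut s w)
    (transfer (head_colour u) (head_colour w) s (star (head_coeff u) * a * head_coeff w))"
  using assms
  by (cases u; cases w)
     (auto simp: cut_def head_colour_def head_coeff_def transfer_transfer split: if_splits)

text \<open>Induction on the total number of letters: strip the shortest leading duration \<open>s\<close> off all words
  at once. Empty words count as words starting with \<open>\<omega>\<^sub>s\<close>.\<close>

lemma mat_psd_kern:
  assumes "\<And>i. i < n \<Longrightarrow> valid (w i)" "mat_psd n A"
  shows "mat_psd n (\<lambda>i j. kern (w i) (w j) (A i j))"
  using assms
proof (induction "\<Sum>i<n. length (w i)" arbitrary: w A rule: less_induct)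
  case less
  define I where "I = {i. i < n \<and> w i \<noteq> []}"
  show ?case
  proof (cases "I = {}")
    case True
    then have "w i = []" if "i < n" for i using that by (auto simp: I_def)
    then show ?thesis by (intro mat_psd_cong[OF less.prems(2)]) simp
  next
    case False
    define s where "s = Min ((\<lambda>i. snd (snd (hd (w i)))) ` I)"
    have fin: "finite I" by (simp add: I_def)
    have s_le: "s \<le> snd (snd (hd (w i)))" if "i \<in> I" for i
      unfolding s_def using fin that by (intro Min_le) auto
    have "s \<in> (\<lambda>i. snd (snd (hd (w i)))) ` I" unfolding s_def using fin False by (intro Min_in) auto
    then obtain i0 where i0: "i0 \<in> I" "s = snd (snd (hd (w i0)))" by blast
    have hd: "snd (snd (hd (w i))) \<ge> 0" if "i \<in> I" for i
    proof -
      have "hd (w i) \<in> set (w i)" "valid (w i)" using that less.prems(1) by (auto simp: I_def)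
      then show ?thesis by (auto simp: valid_def)
    qed
    have s: "s \<ge> 0" using hd[OF i0(1)] i0 by simp
    let ?A = "\<lambda>i j. transfer (head_colour (w i)) (head_colour (w j)) s (star (head_coeff (w i)) * A i j * head_coeff (w j))"
    have "mat_psd n (\<lambda>i j. kern (cut s (w i)) (cut s (w j)) (?A i j))"
    proof (rule less.hyps)
      have le: "length (cut s (w i)) \<le> length (w i)" for i
        by (auto simp: cut_def split: list.splits)
      \<comment> \<open>The word that attains the minimal leading duration loses a letter and no
        word grows, so the total length decreases.\<close>
      have "length (cut s (w i0)) < length (w i0)"
        using i0 by (auto simp: cut_def I_def split: list.splits)
      then show "(\<Sum>i<n. length (cut s (w i))) < (\<Sum>i<n. length (w i))"
        using le i0(1) by (intro sum_strict_mono_ex1) (auto simp: I_def)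
      show "valid (cut s (w i))" if "i < n" for i
        using less.prems(1)[OF that] s_le[of i] that by (auto simp: cut_def I_def split: list.splits)
      show "mat_psd n ?A" by (intro mat_psd_transfer mat_psd_conj less.prems s)
    qed
    then show ?thesis
    proof (rule mat_psd_cong)
      fix i j assume "i < n" "j < n"
      then show "kern (w i) (w j) (A i j) = kern (cut s (w i)) (cut s (w j)) (?A i j)"
        using s s_le by (intro kern_cut) (auto simp: I_def)
    qed
  qed
qed

end

section \<open>The completion of a semi-inner product space\<close>

context semi_module
begin

lemma emb_eqI:
  assumes "x \<in> S" "y \<in> S" "\<And>z. z \<in> S \<Longrightarrow> Q z x = Q z y"
  shows "emb x = emb y"
  by (rule bcontfun_eqI) (simp add: apply_emb assms)

lemma closure_emb_add:
  assumes R: "R \<subseteq> S" "\<And>x y. \<lbrakk>x \<in> R; y \<in> R\<rbrakk> \<Longrightarrow> add x y \<in> R"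
    and "x \<in> closure (emb ` R)" "y \<in> closure (emb ` R)"
  shows "x + y \<in> closure (emb ` R)"
proof -
  obtain U where U: "\<And>n. U n \<in> R" "(\<lambda>n. emb (U n)) \<longlonglongrightarrow> x" using completion_seq[OF assms(3)] by blast
  obtain V where V: "\<And>n. V n \<in> R" "(\<lambda>n. emb (V n)) \<longlonglongrightarrow> y" using completion_seq[OF assms(4)] by blast
  show ?thesis
  proof (rule completion_limI)
    show "add (U n) (V n) \<in> R" for n by (intro R U V)
    have "emb (add (U n) (V n)) = emb (U n) + emb (V n)" for n
      using U(1) V(1) R(1) by (intro emb_add) auto
    then show "(\<lambda>n. emb (add (U n) (V n))) \<longlonglongrightarrow> x + y" by (simp add: tendsto_add U V)
  qed
qed

lemma closure_emb_bract:
  assumes R: "R \<subseteq> S" "\<And>x. x \<in> R \<Longrightarrow> rm x b \<in> R" and "x \<in> closure (emb ` R)"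
  shows "bract x b \<in> closure (emb ` R)"
proof -
  obtain U where U: "\<And>n. U n \<in> R" "(\<lambda>n. emb (U n)) \<longlonglongrightarrow> x" using completion_seq[OF assms(3)] by blast
  show ?thesis
  proof (rule completion_limI)
    show "rm (U n) b \<in> R" for n by (intro R U)
    have "emb (rm (U n) b) = bract (emb (U n)) b" for n using U(1) R(1) by (intro emb_rm) auto
    then show "(\<lambda>n. emb (rm (U n) b)) \<longlonglongrightarrow> bract x b"
      by (simp add: bract.tendsto U)
  qed
qed

lemma completion_add: "\<lbrakk>x \<in> completion; y \<in> completion\<rbrakk> \<Longrightarrow> x + y \<in> completion"
  unfolding completion_def by (rule closure_emb_add) (auto intro: add_in)

lemma completion_bract: "x \<in> completion \<Longrightarrow> bract x b \<in> completion"
  unfolding completion_def by (rule closure_emb_bract) (auto intro: rm_in)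

lemma completion_diff: "\<lbrakk>x \<in> completion; y \<in> completion\<rbrakk> \<Longrightarrow> x - y \<in> completion"
  using completion_add[OF _ completion_bract[of y "-1"], of x] by (simp add: bract.minus_right)

lemma completion_obtain:
  assumes "x \<in> completion"
  obtains U where "\<And>n. U n \<in> S" "(\<lambda>n. emb (U n)) \<longlonglongrightarrow> x"
  using completion_seq[of x S] assms unfolding completion_def by blast

lemma ip_add:
  assumes "x \<in> completion" "y \<in> completion" "z \<in> completion"
  shows "ip x (y + z) = ip x y + ip x z"
proof -
  obtain U where U: "\<And>n. U n \<in> S" "(\<lambda>n. emb (U n)) \<longlonglongrightarrow> x" using completion_obtain[OF assms(1)] by blast
  obtain V where V: "\<And>n. V n \<in> S" "(\<lambda>n. emb (V n)) \<longlonglongrightarrow> y" using completion_obtain[OF assms(2)] by blast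
  obtain W where W: "\<And>n. W n \<in> S" "(\<lambda>n. emb (W n)) \<longlonglongrightarrow> z" using completion_obtain[OF assms(3)] by blast
  have "(\<lambda>n. Q (U n) (add (V n) (W n))) \<longlonglongrightarrow> ip x (y + z)"
    by (rule ip_tendsto) (simp_all add: U V W add_in emb_add tendsto_add)
  moreover have "(\<lambda>n. Q (U n) (V n) + Q (U n) (W n)) \<longlonglongrightarrow> ip x y + ip x z"
    by (intro tendsto_add ip_tendsto U V W)
  ultimately show ?thesis using U V W by (simp add: Q_add LIMSEQ_unique)
qed

lemma ip_bract:
  assumes "x \<in> completion" "y \<in> completion"
  shows "ip x (bract y b) = ip x y * b"
proof -
  obtain U where U: "\<And>n. U n \<in> S" "(\<lambda>n. emb (U n)) \<longlonglongrightarrow> x" using completion_obtain[OF assms(1)] by blast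
  obtain V where V: "\<And>n. V n \<in> S" "(\<lambda>n. emb (V n)) \<longlonglongrightarrow> y" using completion_obtain[OF assms(2)] by blast
  have "(\<lambda>n. Q (U n) (rm (V n) b)) \<longlonglongrightarrow> ip x (bract y b)"
    by (rule ip_tendsto) (simp_all add: U V rm_in emb_rm bract.tendsto)
  moreover have "(\<lambda>n. Q (U n) (V n) * b) \<longlonglongrightarrow> ip x y * b"
    by (intro tendsto_mult tendsto_const ip_tendsto U V)
  ultimately show ?thesis using U V by (simp add: Q_rm LIMSEQ_unique)
qed

lemma ip_star:
  assumes "x \<in> completion" "y \<in> completion"
  shows "star (ip x y) = ip y x"
proof -
  obtain U where U: "\<And>n. U n \<in> S" "(\<lambda>n. emb (U n)) \<longlonglongrightarrow> x" using completion_obtain[OF assms(1)] by blast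
  obtain V where V: "\<And>n. V n \<in> S" "(\<lambda>n. emb (V n)) \<longlonglongrightarrow> y" using completion_obtain[OF assms(2)] by blast
  have "(\<lambda>n. star (Q (U n) (V n))) \<longlonglongrightarrow> star (ip x y)"
    by (intro bounded_linear.tendsto[OF bounded_linear_star] ip_tendsto U V)
  moreover have "(\<lambda>n. Q (V n) (U n)) \<longlonglongrightarrow> ip y x" by (intro ip_tendsto U V)
  ultimately show ?thesis using U V by (simp add: Q_star LIMSEQ_unique)
qed

lemma ip_positive:
  assumes "x \<in> completion" shows "positive (ip x x)"
proof -
  obtain U where U: "\<And>n. U n \<in> S" "(\<lambda>n. emb (U n)) \<longlonglongrightarrow> x" using completion_obtain[OF assms(1)] by blast
  show ?thesis by (rule positive_limit[of "\<lambda>n. Q (U n) (U n)"]) (intro Q_pos ip_tendsto U)+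
qed

lemma norm_completion:
  assumes "x \<in> completion" shows "norm x = sqrt (norm (ip x x))"
proof -
  obtain U where U: "\<And>n. U n \<in> S" "(\<lambda>n. emb (U n)) \<longlonglongrightarrow> x" using completion_obtain[OF assms(1)] by blast
  have "(\<lambda>n. norm (emb (U n))) \<longlonglongrightarrow> norm x" by (intro tendsto_norm U)
  moreover have "(\<lambda>n. sqrt (norm (Q (U n) (U n)))) \<longlonglongrightarrow> sqrt (norm (ip x x))"
    by (intro tendsto_real_sqrt tendsto_norm ip_tendsto U)
  ultimately show ?thesis using U by (simp add: norm_emb LIMSEQ_unique)
qed

lemma norm_ip_le:
  assumes "x \<in> completion" "y \<in> completion"
  shows "norm (ip x y) \<le> norm x * norm y"
proof -
  obtain U where U: "\<And>n. U n \<in> S" "(\<lambda>n. emb (U n)) \<longlonglongrightarrow> x" using completion_obtain[OF assms(1)] by blast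
  obtain V where V: "\<And>n. V n \<in> S" "(\<lambda>n. emb (V n)) \<longlonglongrightarrow> y" using completion_obtain[OF assms(2)] by blast
  show ?thesis
  proof (rule LIMSEQ_le)
    show "(\<lambda>n. norm (Q (U n) (V n))) \<longlonglongrightarrow> norm (ip x y)" by (intro tendsto_norm ip_tendsto U V)
    show "(\<lambda>n. norm (emb (U n)) * norm (emb (V n))) \<longlonglongrightarrow> norm x * norm y"
      by (intro tendsto_mult tendsto_norm U V)
    show "\<exists>N. \<forall>n\<ge>N. norm (Q (U n) (V n)) \<le> norm (emb (U n)) * norm (emb (V n))"
      using U V norm_Q_le by blast
  qed
qed

lemma ip_diff:
  assumes "x \<in> completion" "y \<in> completion" "z \<in> completion"
  shows "ip x (y - z) = ip x y - ip x z"
  using ip_add[OF assms(1) completion_diff[OF assms(2,3)] assms(3)] by simp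

lemma ip_diff_left:
  assumes "x \<in> completion" "y \<in> completion" "z \<in> completion"
  shows "ip (y - z) x = ip y x - ip z x"
proof -
  have "star (ip x (y - z)) = star (ip x y - ip x z)" using assms by (simp add: ip_diff)
  then show ?thesis using assms by (simp add: ip_star star_diff completion_diff)
qed

lemma tendsto_ip:
  assumes f: "(f \<longlongrightarrow> x) F" and g: "(g \<longlongrightarrow> y) F" and x: "x \<in> completion" and y: "y \<in> completion"
    and ev: "\<forall>\<^sub>F t in F. f t \<in> completion \<and> g t \<in> completion"
  shows "((\<lambda>t. ip (f t) (g t)) \<longlongrightarrow> ip x y) F"
proof -
  have "((\<lambda>t. norm (f t - x) * norm (g t) + norm x * norm (g t - y)) \<longlongrightarrow>
      norm (x - x) * norm y + norm x * norm (y - y)) F"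
    by (intro tendsto_add tendsto_mult tendsto_norm tendsto_diff tendsto_const f g)
  then have lim: "((\<lambda>t. norm (f t - x) * norm (g t) + norm x * norm (g t - y)) \<longlongrightarrow> 0) F"
    by simp
  have "\<forall>\<^sub>F t in F. norm (ip (f t) (g t) - ip x y) \<le> norm (f t - x) * norm (g t) + norm x * norm (g t - y)"
    using ev
  proof eventually_elim
    case (elim t)
    then have m: "f t \<in> completion" "g t \<in> completion" by auto
    have eq: "ip (f t) (g t) - ip x y = ip (f t - x) (g t) + ip x (g t - y)"
      by (simp add: ip_diff ip_diff_left m x y)
    show ?case
      unfolding eq using norm_triangle_ineq[of "ip (f t - x) (g t)" "ip x (g t - y)"]
        norm_ip_le[OF completion_diff[OF m(1) x] m(2)] norm_ip_le[OF x completion_diff[OF m(2) y]]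
      by linarith
  qed
  then have "((\<lambda>t. ip (f t) (g t) - ip x y) \<longlongrightarrow> 0) F"
    by (rule Lim_null_comparison) (rule lim)
  then show ?thesis by (simp add: LIM_zero_iff)
qed

lemma ip_continuous:
  assumes f: "continuous_on A f" "\<And>t. t \<in> A \<Longrightarrow> f t \<in> completion"
    and g: "continuous_on A g" "\<And>t. t \<in> A \<Longrightarrow> g t \<in> completion"
  shows "continuous_on A (\<lambda>t. ip (f t) (g t))"
  unfolding continuous_on_def
proof
  fix p assume "p \<in> A"
  then show "((\<lambda>t. ip (f t) (g t)) \<longlongrightarrow> ip (f p) (g p)) (at p within A)"
    using f g by (intro tendsto_ip) (auto simp: continuous_on_def eventually_at_filter)
qed

lemma norm_emb_diff_sq:
  assumes "x \<in> S" "y \<in> S"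
  shows "(norm (emb x - emb y))\<^sup>2 = norm (Q x x - Q x y - (Q y x - Q y y))"
  using assms norm_emb_sq[of "add x (rm y (-1))"]
  by (simp add: emb_diff add_in rm_in Q_add Q_add_left Q_rm Q_rm_left star_minus algebra_simps)

end

section \<open>The module generated by the words\<close>

context spatial_cp
begin

text \<open>A list \<open>[(w\<^sub>1, d\<^sub>1), \<dots>, (w\<^sub>n, d\<^sub>n)]\<close> stands for the sum of the vectors \<open>w\<^sub>i d\<^sub>i\<close>.\<close>

definition combs :: "(('b \<times> bool \<times> real) list \<times> 'b) list set" where
  "combs = {U. \<forall>(u, b)\<in>set U. valid u}"

definition combs_at :: "real \<Rightarrow> (('b \<times> bool \<times> real) list \<times> 'b) list set" where
  "combs_at t = {U. \<forall>(u, b)\<in>set U. valid u \<and> duration u = t}"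

text \<open>The inner product of U with a V. Carrying the coefficient a along allows the inner
  product of the first factors to be inserted when products are compared, as in
  \<open>comb_inner_mult\<close>.\<close>

definition comb_inner :: "'b \<Rightarrow> (('b \<times> bool \<times> real) list \<times> 'b) list \<Rightarrow> (('b \<times> bool \<times> real) list \<times> 'b) list \<Rightarrow> 'b" where
  "comb_inner a U V = (\<Sum>(u, b)\<leftarrow>U. \<Sum>(w, d)\<leftarrow>V. star b * kern u w a * d)"

definition comb_ract :: "(('b \<times> bool \<times> real) list \<times> 'b) list \<Rightarrow> 'b \<Rightarrow> (('b \<times> bool \<times> real) list \<times> 'b) list" where
  "comb_ract U b = map (\<lambda>(w, d). (w, d * b)) U"

definition prefix :: "('b \<times> bool \<times> real) list \<Rightarrow> 'b \<Rightarrow> (('b \<times> bool \<times> real) list \<times> 'b) list \<Rightarrow> (('b \<times> bool \<times> real) list \<times> 'b) list" where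
  "prefix u b V = map (\<lambda>(w, d). (u @ (b, False, 0) # w, d)) V"

text \<open>The letter \<open>(b, False, 0)\<close> is \<open>b \<omega>\<^sub>0 = b\<close>.\<close>

definition comb_mult :: "(('b \<times> bool \<times> real) list \<times> 'b) list \<Rightarrow> (('b \<times> bool \<times> real) list \<times> 'b) list \<Rightarrow> (('b \<times> bool \<times> real) list \<times> 'b) list" where
  "comb_mult U V = concat (map (\<lambda>(u, b). prefix u b V) U)"

lemma combs_simps [simp]: "[] \<in> combs" "(u, b) # U \<in> combs \<longleftrightarrow> valid u \<and> U \<in> combs"
  "U @ V \<in> combs \<longleftrightarrow> U \<in> combs \<and> V \<in> combs"
  by (auto simp: combs_def)

lemma combs_at_simps [simp]: "[] \<in> combs_at t" "(u, b) # U \<in> combs_at t \<longleftrightarrow> valid u \<and> duration u = t \<and> U \<in> combs_at t"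
  "U @ V \<in> combs_at t \<longleftrightarrow> U \<in> combs_at t \<and> V \<in> combs_at t"
  by (auto simp: combs_at_def)

lemma combs_at_subset: "combs_at t \<subseteq> combs"
  by (auto simp: combs_at_def combs_def)

lemma comb_ract_simps [simp]: "comb_ract [] b = []" "comb_ract ((w, d) # U) b = (w, d * b) # comb_ract U b"
  by (auto simp: comb_ract_def)

lemma comb_ract_in: "U \<in> combs \<Longrightarrow> comb_ract U b \<in> combs" "U \<in> combs_at t \<Longrightarrow> comb_ract U b \<in> combs_at t"
  by (induction U) auto

lemma prefix_simps [simp]: "prefix u b [] = []" "prefix u b ((w, d) # V) = (u @ (b, False, 0) # w, d) # prefix u b V"
  by (auto simp: prefix_def)

lemma prefix_in: "valid u \<Longrightarrow> V \<in> combs \<Longrightarrow> prefix u b V \<in> combs"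
  "valid u \<Longrightarrow> duration u = s \<Longrightarrow> V \<in> combs_at t \<Longrightarrow> prefix u b V \<in> combs_at (s + t)"
  by (induction V) auto

lemma comb_mult_simps [simp]: "comb_mult [] V = []" "comb_mult ((u, b) # U) V = prefix u b V @ comb_mult U V"
  "comb_mult (U @ U') V = comb_mult U V @ comb_mult U' V"
  by (auto simp: comb_mult_def)

lemma comb_mult_in: "U \<in> combs \<Longrightarrow> V \<in> combs \<Longrightarrow> comb_mult U V \<in> combs"
  "U \<in> combs_at s \<Longrightarrow> V \<in> combs_at t \<Longrightarrow> comb_mult U V \<in> combs_at (s + t)"
  by (induction U) (auto intro: prefix_in)

lemma comb_inner_append_left: "comb_inner a (U @ U') V = comb_inner a U V + comb_inner a U' V"
  by (simp add: comb_inner_def)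

lemma comb_inner_Nil [simp]: "comb_inner a [] V = 0" "comb_inner a U [] = 0"
proof -
  show "comb_inner a [] V = 0" by (simp add: comb_inner_def)
  show "comb_inner a U [] = 0" by (induction U) (auto simp: comb_inner_def)
qed

lemma comb_inner_append_right: "comb_inner a U (V @ V') = comb_inner a U V + comb_inner a U V'"
  by (induction U) (auto simp: comb_inner_def algebra_simps)

lemma comb_inner_ract: "comb_inner a U (comb_ract V b) = comb_inner a U V * b"
proof -
  have 1: "(\<Sum>(w, d)\<leftarrow>comb_ract V b. star x * kern u w a * d) = (\<Sum>(w, d)\<leftarrow>V. star x * kern u w a * d) * b" for u x
    by (induction V) (auto simp: algebra_simps)
  show ?thesis by (induction U) (auto simp: comb_inner_def 1 distrib_right)
qed

lemma comb_inner_Cons: "comb_inner a [(u, b)] ((w, d) # V) = star b * kern u w a * d + comb_inner a [(u, b)] V"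
  by (simp add: comb_inner_def)

lemma comb_inner_add:
  "U \<in> combs \<Longrightarrow> V \<in> combs \<Longrightarrow> comb_inner (a + a') U V = comb_inner a U V + comb_inner a' U V"
proof (induction U)
  case (Cons l U)
  obtain u b where l: "l = (u, b)" by (cases l)
  have u: "valid u" using Cons.prems l by simp
  have "comb_inner (a + a') [(u, b)] V = comb_inner a [(u, b)] V + comb_inner a' [(u, b)] V"
    using Cons.prems(2)
  proof (induction V)
    case (Cons m V)
    then show ?case using u by (cases m) (simp add: comb_inner_Cons kern_add algebra_simps)
  qed simp
  then show ?case
    using Cons comb_inner_append_left[of _ "[(u, b)]" U V] l by (simp add: algebra_simps)
qed simp

lemma comb_inner_scaleC:
  "U \<in> combs \<Longrightarrow> V \<in> combs \<Longrightarrow> comb_inner (z *\<^sub>C a) U V = z *\<^sub>C comb_inner a U V"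
proof (induction U)
  case (Cons l U)
  obtain u b where l: "l = (u, b)" by (cases l)
  have u: "valid u" using Cons.prems l by simp
  have "comb_inner (z *\<^sub>C a) [(u, b)] V = z *\<^sub>C comb_inner a [(u, b)] V"
    using Cons.prems(2)
  proof (induction V)
    case (Cons m V)
    then show ?case using u
      by (cases m) (simp add: comb_inner_Cons kern_scaleC mult_scaleC_left mult_scaleC_right scaleC_add_right)
  qed simp
  then show ?case
    using Cons comb_inner_append_left[of _ "[(u, b)]" U V] l by (simp add: scaleC_add_right)
qed simp

lemma comb_inner_star:
  assumes U: "U \<in> combs" and V: "V \<in> combs"
  shows "star (comb_inner a U V) = comb_inner (star a) V U"
  using U
proof (induction U)
  case (Cons l U)
  obtain u b where l: "l = (u, b)" by (cases l)
  have u: "valid u" using Cons.prems l by simp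
  have "star (comb_inner a [(u, b)] V) = comb_inner (star a) V [(u, b)]"
    using V
  proof (induction V)
    case (Cons m V)
    then show ?case using u comb_inner_append_left[of "star a" "[m]" V "[(u, b)]"]
      by (cases m) (simp add: comb_inner_Cons star_add star_mult star_star kern_star mult.assoc)
  qed simp
  then show ?case
    using Cons comb_inner_append_left[of a "[(u, b)]" U V] comb_inner_append_right[of "star a" V "[(u, b)]" U] l
    by (simp add: star_add)
qed simp

text \<open>The constant matrix with entries a is positive, and by \<open>mat_psd_kern\<close> so is
  the matrix of the kernels; the claim is its value at the column of right coefficients.\<close>

lemma comb_inner_positive:
  assumes U: "U \<in> combs" and a: "positive a"
  shows "positive (comb_inner a U U)"
proof -
  obtain x where x: "a = star x * x" using a by (auto simp: positive_def)
  have v: "valid (fst (U ! i))" if "i < length U" for i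
    using U nth_mem[OF that] by (auto simp: combs_def)
  have "mat_psd (length U) (\<lambda>i j. a)"
    unfolding mat_psd_def by (intro exI[of _ 1] exI[of _ "\<lambda>_ _. x"]) (simp add: x)
  then have "mat_psd (length U) (\<lambda>i j. kern (fst (U ! i)) (fst (U ! j)) a)"
    by (intro mat_psd_kern v)
  from mat_psd_positive[OF this, of "\<lambda>i. snd (U ! i)"] show ?thesis
    unfolding comb_inner_def sum_list_sum_nth
    by (simp add: case_prod_beta atLeast0LessThan sum_list_sum_nth)
qed

lemma comb_inner_prefix:
  assumes "valid u" "valid u'" "duration u = duration u'" "V \<in> combs" "V' \<in> combs"
  shows "comb_inner a (prefix u b V) (prefix u' b' V') = comb_inner (star b * kern u u' a * b') V V'"
  using assms(4)
proof (induction V)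
  case (Cons l V)
  obtain w d where l: "l = (w, d)" by (cases l)
  have w: "valid w" using Cons.prems l by simp
  have "comb_inner a [(u @ (b, False, 0) # w, d)] (prefix u' b' V')
      = comb_inner (star b * kern u u' a * b') [(w, d)] V'"
    using assms(5)
  proof (induction V')
    case (Cons m V')
    then show ?case using w assms by (cases m) (simp add: comb_inner_Cons kern_append)
  qed simp
  then show ?case
    using Cons l comb_inner_append_left[of _ "[(w, d)]" V V']
      comb_inner_append_left[of a "[(u @ (b, False, 0) # w, d)]" "prefix u b V" "prefix u' b' V'"]
    by simp
qed simp

text \<open>Extends \<open>kern_append\<close> to sums. Only the left factors need a common
  duration, as the right ones are prolonged by \<omega>.\<close>

lemma comb_inner_mult:
  assumes "U \<in> combs_at s" "U' \<in> combs_at s" "V \<in> combs" "V' \<in> combs"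
  shows "comb_inner a (comb_mult U V) (comb_mult U' V') = comb_inner (comb_inner a U U') V V'"
  using assms(1)
proof (induction U)
  case Nil
  have "comb_inner 0 V V' = 0" using comb_inner_add[OF assms(3,4), of 0 0] by simp
  then show ?case by simp
next
  case (Cons l U)
  obtain u b where l: "l = (u, b)" by (cases l)
  have u: "valid u" "duration u = s" using Cons.prems l by simp_all
  have "comb_inner a (prefix u b V) (comb_mult U' V') = comb_inner (comb_inner a [(u, b)] U') V V'"
    using assms(2)
  proof (induction U')
    case Nil
    have "comb_inner 0 V V' = 0" using comb_inner_add[OF assms(3,4), of 0 0] by simp
    then show ?case by simp
  next
    case (Cons m U')
    then show ?case using u assms
      by (cases m) (simp add: comb_inner_append_right comb_inner_prefix comb_inner_Cons comb_inner_add)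
  qed
  then show ?case
    using Cons l comb_inner_append_left[of a "[(u, b)]" U U'] assms(3,4)
    by (simp add: comb_inner_append_left comb_inner_add)
qed

sublocale semi_module combs "comb_inner 1" "(@)" comb_ract
proof
  show "combs \<noteq> {}" using combs_simps(1) by blast
qed (auto simp: comb_ract_in comb_inner_append_right comb_inner_ract comb_inner_star intro!: comb_inner_positive,
     use positive_star_mult[of "1::'b"] in simp)

lemma comb_inner_act:
  assumes "U \<in> combs" "V \<in> combs"
  shows "comb_inner 1 U (prefix [] a V) = comb_inner a U V"
    and "comb_inner 1 (prefix [] a U) V = comb_inner (star a) U V"
proof -
  have 1: "comb_inner 1 U (prefix [] a V) = comb_inner a U V" if "U \<in> combs" "V \<in> combs" for U V a
    using that(1)
  proof (induction U)
    case (Cons l U)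
    obtain u b where l: "l = (u, b)" by (cases l)
    have u: "valid u" using Cons.prems l by simp
    have "comb_inner 1 [(u, b)] (prefix [] a V) = comb_inner a [(u, b)] V"
      using that(2)
    proof (induction V)
      case (Cons m V)
      then show ?case using u by (cases m) (simp add: comb_inner_Cons kern_zero)
    qed simp
    then show ?case
      using Cons l comb_inner_append_left[of _ "[(u, b)]" U] by simp
  qed simp
  show "comb_inner 1 U (prefix [] a V) = comb_inner a U V" by (rule 1[OF assms])
  have "star (comb_inner 1 V (prefix [] a U)) = star (comb_inner a V U)" using assms by (simp add: 1)
  then show "comb_inner 1 (prefix [] a U) V = comb_inner (star a) U V"
    using assms by (simp add: comb_inner_star prefix_in)
qed

end

context spatial_cp
begin

section \<open>Cutting words at a given time\<close>

lemma kern_mid_one: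
  assumes "valid u" "valid x" "valid w"
  shows "kern u (x @ (1, e, 0) # w) a = kern u (x @ w) a"
  using assms
proof (induction u x arbitrary: a rule: kern.induct)
  case (2 b e' s u)
  then show ?case using kern_zero(2)[of "(b, e', s) # u" w 1 e a] by (simp del: kern.simps)
next
  case (4 b e' s u b' e'' s' w')
  then show ?case by (cases s s' rule: linorder_cases) auto
qed (simp_all add: kern_zero)

lemma kern_split_right:
  assumes "s \<ge> 0" "t \<ge> 0" "valid w" "valid u"
  shows "kern w ((b, e, s) # (1, e, t) # u) a = kern w ((b, e, s + t) # u) a"
proof -
  have "star (kern ((b, e, s) # (1, e, t) # u) w (star a)) = star (kern ((b, e, s + t) # u) w (star a))"
    using assms by (simp only: kern_split)
  then show ?thesis using assms by (simp add: kern_star star_star)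
qed

lemma kern_Cons_cong:
  assumes "\<And>v a. valid v \<Longrightarrow> kern v x a = kern v y a" "valid v" "r \<ge> 0"
  shows "kern v ((b, e, r) # x) a = kern v ((b, e, r) # y) a"
  using assms(2,3)
proof (induction v arbitrary: r b a)
  case Nil
  then show ?case using assms(1)[of "[]"] by simp
next
  case (Cons l v)
  obtain d f q where l: "l = (d, f, q)" by (cases l)
  have "valid ((1, f, q - r) # v)" if "r < q" using Cons.prems l that by simp
  then show ?case using Cons assms(1) l by (cases q r rule: linorder_cases) auto
qed

text \<open>The letter that straddles the time s is cut in two by \<open>kern_split_right\<close>.
  This is the source of surjectivity of the product maps.\<close>

lemma word_split:
  assumes "valid w" "duration w = s + t" "s \<ge> 0" "t \<ge> 0"
  shows "\<exists>u w'. valid u \<and> valid w' \<and> duration u = s \<and> duration w' = t \<and>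
    (\<forall>v a. valid v \<longrightarrow> kern v w a = kern v (u @ w') a)"
  using assms(1-3)
proof (induction w arbitrary: s)
  case Nil
  then show ?case using assms(4) by (intro exI[of _ "[]"]) auto
next
  case (Cons l w)
  obtain b e r where l: "l = (b, e, r)" by (cases l)
  have r: "r \<ge> 0" "valid w" "duration w = s + t - r" using Cons.prems l by auto
  show ?case
  proof (cases "r \<le> s")
    case True
    then obtain u w' where uw: "valid u" "valid w'" "duration u = s - r" "duration w' = t"
      "\<And>v a. valid v \<Longrightarrow> kern v w a = kern v (u @ w') a"
      using Cons.IH[of "s - r"] r by auto
    have "kern v (l # w) a = kern v (((b, e, r) # u) @ w') a" if "valid v" for v a
      unfolding l append_Cons using uw(5) that r by (intro kern_Cons_cong)
    then show ?thesis using uw r by (intro exI[of _ "(b, e, r) # u"] exI[of _ w']) auto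
  next
    case False
    then show ?thesis
      using r Cons.prems(3) kern_split_right[of s "r - s" _ w b e]
      by (intro exI[of _ "[(b, e, s)]"] exI[of _ "(1, e, r - s) # w"]) (auto simp: l)
  qed
qed

lemma comb_inner_ract_left: "comb_inner a (comb_ract U b) V = star b * comb_inner a U V"
proof -
  have 1: "(\<Sum>(w, d)\<leftarrow>V. star (x * b) * kern u w a * d) = star b * (\<Sum>(w, d)\<leftarrow>V. star x * kern u w a * d)" for u x
    by (induction V) (auto simp: star_mult mult.assoc distrib_left)
  show ?thesis by (induction U) (auto simp: comb_inner_def 1 distrib_left)
qed

lemma comb_inner_diff:
  assumes "U \<in> combs" "V \<in> combs"
  shows "comb_inner (a - a') U V = comb_inner a U V - comb_inner a' U V"
  using comb_inner_add[OF assms, of "a - a'" a'] by simp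

text \<open>\<open>comb_inner\<close> is positive in its coefficient, and q <= norm q.\<close>

lemma comb_inner_norm_le:
  assumes "positive q" "V \<in> combs"
  shows "norm (comb_inner q V V) \<le> norm q * norm (comb_inner 1 V V)"
proof -
  have "positive (comb_inner (norm q *\<^sub>R 1 - q) V V)"
    by (intro comb_inner_positive assms positive_norm_minus positive_selfadjoint) simp
  moreover have "comb_inner (norm q *\<^sub>R 1 - q) V V = norm q *\<^sub>R comb_inner 1 V V - comb_inner q V V"
    using assms(2) comb_inner_scaleC[of V V "complex_of_real (norm q)" 1]
    by (simp add: comb_inner_diff scaleC_of_real)
  ultimately have "norm (comb_inner q V V) \<le> norm (norm q *\<^sub>R comb_inner 1 V V)"
    using comb_inner_positive assms by (intro positive_norm_mono) auto
  then show ?thesis by simp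
qed

section \<open>The product on the completion\<close>

text \<open>For D = U - U' the square of the norm of D V is the norm of <V, <D, D> V>, to which
  \<open>comb_inner_norm_le\<close> applies. The estimate is stated for differences because
  \<open>bilinear_extension\<close> consumes it in this form.\<close>

lemma norm_mult_diff_left:
  assumes U: "U \<in> combs_at s" "U' \<in> combs_at s" and V: "V \<in> combs"
  shows "norm (emb (comb_mult U V) - emb (comb_mult U' V)) \<le> norm (emb U - emb U') * norm (emb V)"
proof -
  define D where "D = U @ comb_ract U' (- 1)"
  have UC: "U \<in> combs" "U' \<in> combs" using U combs_at_subset by auto
  have D: "D \<in> combs_at s" "D \<in> combs" using U UC by (simp_all add: D_def comb_ract_in)
  let ?X = "comb_mult U V" and ?Y = "comb_mult U' V"
  have XY: "?X \<in> combs" "?Y \<in> combs" using UC V by (simp_all add: comb_mult_in)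
  have "comb_inner 1 (?X @ comb_ract ?Y (- 1)) (?X @ comb_ract ?Y (- 1)) = comb_inner (comb_inner 1 D D) V V"
    using U V unfolding D_def
    by (simp add: comb_inner_append_left comb_inner_append_right comb_inner_ract comb_inner_ract_left
        star_minus comb_inner_mult comb_inner_add comb_inner_diff)
  then have "(norm (emb ?X - emb ?Y))\<^sup>2 = norm (comb_inner (comb_inner 1 D D) V V)"
    using XY norm_emb_sq[of "?X @ comb_ract ?Y (- 1)"] emb_diff[of ?X ?Y] by (simp add: comb_ract_in)
  also have "\<dots> \<le> norm (comb_inner 1 D D) * norm (comb_inner 1 V V)"
    using D V by (intro comb_inner_norm_le Q_pos)
  also have "\<dots> = (norm (emb U - emb U') * norm (emb V))\<^sup>2"
    using D V UC emb_diff[of U U'] by (simp add: norm_emb_sq[symmetric] power_mult_distrib D_def)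
  finally show ?thesis by (rule power2_le_imp_le) simp
qed

lemma norm_mult_diff_right:
  assumes U: "U \<in> combs_at s" and V: "V \<in> combs" "V' \<in> combs"
  shows "norm (emb (comb_mult U V) - emb (comb_mult U V')) \<le> norm (emb U) * norm (emb V - emb V')"
proof -
  define D where "D = V @ comb_ract V' (- 1)"
  have UC: "U \<in> combs" using U combs_at_subset by auto
  have D: "D \<in> combs" using V by (simp add: D_def comb_ract_in)
  let ?X = "comb_mult U V" and ?Y = "comb_mult U V'"
  have XY: "?X \<in> combs" "?Y \<in> combs" using UC V by (simp_all add: comb_mult_in)
  have "comb_inner 1 (?X @ comb_ract ?Y (- 1)) (?X @ comb_ract ?Y (- 1)) = comb_inner (comb_inner 1 U U) D D"
    using U V unfolding D_def
    by (simp add: comb_inner_append_left comb_inner_append_right comb_inner_ract comb_inner_ract_left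
        star_minus comb_inner_mult)
  then have "(norm (emb ?X - emb ?Y))\<^sup>2 = norm (comb_inner (comb_inner 1 U U) D D)"
    using XY norm_emb_sq[of "?X @ comb_ract ?Y (- 1)"] emb_diff[of ?X ?Y] by (simp add: comb_ract_in)
  also have "\<dots> \<le> norm (comb_inner 1 U U) * norm (comb_inner 1 D D)"
    using D UC by (intro comb_inner_norm_le Q_pos)
  also have "\<dots> = (norm (emb U) * norm (emb V - emb V'))\<^sup>2"
    using D V UC emb_diff[of V V'] by (simp add: norm_emb_sq[symmetric] power_mult_distrib D_def)
  finally show ?thesis by (rule power2_le_imp_le) simp
qed

text \<open>The time s of the left factor is part of the data. By padding, a vector x of level s
  also lies in each later level t, where it stands for x \<omega>_(t - s), and its products with y
  change accordingly.\<close>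

definition mul where
  "mul s = (SOME B. \<forall>U V x y. (\<forall>n. U n \<in> combs_at s) \<longrightarrow> (\<forall>n. V n \<in> combs) \<longrightarrow> (\<lambda>n. emb (U n)) \<longlonglongrightarrow> x \<longrightarrow>
     (\<lambda>n. emb (V n)) \<longlonglongrightarrow> y \<longrightarrow> (\<lambda>n. emb (comb_mult (U n) (V n))) \<longlonglongrightarrow> B x y)"

lemma mul_tendsto:
  assumes "\<And>n. U n \<in> combs_at s" "\<And>n. V n \<in> combs" "(\<lambda>n. emb (U n)) \<longlonglongrightarrow> x" "(\<lambda>n. emb (V n)) \<longlonglongrightarrow> y"
  shows "(\<lambda>n. emb (comb_mult (U n) (V n))) \<longlonglongrightarrow> mul s x y"
proof -
  have "\<exists>B. \<forall>U V x y. (\<forall>n. U n \<in> combs_at s) \<longrightarrow> (\<forall>n. V n \<in> combs) \<longrightarrow> (\<lambda>n. emb (U n)) \<longlonglongrightarrow> x \<longrightarrow>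
     (\<lambda>n. emb (V n)) \<longlonglongrightarrow> y \<longrightarrow> (\<lambda>n. emb (comb_mult (U n) (V n))) \<longlonglongrightarrow> B x y"
    by (rule bilinear_extension) (fact norm_mult_diff_left norm_mult_diff_right)+
  from someI_ex[OF this, folded mul_def, THEN spec[of _ U], THEN spec[of _ V], THEN spec[of _ x], THEN spec[of _ y]]
  show ?thesis using assms by simp
qed

lemma mul_emb:
  assumes "U \<in> combs_at s" "V \<in> combs" shows "mul s (emb U) (emb V) = emb (comb_mult U V)"
proof -
  have "(\<lambda>n::nat. emb (comb_mult U V)) \<longlonglongrightarrow> mul s (emb U) (emb V)"
    by (rule mul_tendsto[where U = "\<lambda>_. U" and V = "\<lambda>_. V"]) (simp_all add: assms)
  then show ?thesis by (rule LIMSEQ_unique) simp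
qed

text \<open>The fibre at time t, realised as a closed subspace of one completion common to all
  times.\<close>

definition level where "level t = closure (emb ` combs_at t)"

lemma level_obtain:
  assumes "x \<in> level t"
  obtains U where "\<And>n. U n \<in> combs_at t" "(\<lambda>n. emb (U n)) \<longlonglongrightarrow> x"
  using completion_seq[of x "combs_at t"] assms unfolding level_def by blast

lemma level_limI: "\<lbrakk>\<And>n. U n \<in> combs_at t; (\<lambda>n. emb (U n)) \<longlonglongrightarrow> x\<rbrakk> \<Longrightarrow> x \<in> level t"
  unfolding level_def by (rule completion_limI)

lemma emb_level: "U \<in> combs_at t \<Longrightarrow> emb U \<in> level t"
  by (rule level_limI[of "\<lambda>_. U"]) auto

lemma closed_level: "closed (level t)" by (simp add: level_def)

lemma closed_completion: "closed completion" by (simp add: completion_def)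

lemma level_completion: "x \<in> level t \<Longrightarrow> x \<in> completion"
  unfolding level_def completion_def by (rule subsetD[OF closure_mono[OF image_mono[OF combs_at_subset]]])

lemma level_add: "\<lbrakk>x \<in> level t; y \<in> level t\<rbrakk> \<Longrightarrow> x + y \<in> level t"
  unfolding level_def by (rule closure_emb_add) (auto simp: combs_at_subset)

lemma level_bract: "x \<in> level t \<Longrightarrow> bract x b \<in> level t"
  unfolding level_def by (rule closure_emb_bract) (auto simp: combs_at_subset comb_ract_in)

lemma bract_scaleR_one: "bract x (r *\<^sub>R 1) = r *\<^sub>R (x :: 'c::topological_space \<Rightarrow>\<^sub>C 'b)"
  by (simp add: bract.scaleR_right)

lemma level_scaleR: "x \<in> level t \<Longrightarrow> r *\<^sub>R x \<in> level t"
  using level_bract[of x t "r *\<^sub>R 1"] by (simp add: bract_scaleR_one)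

lemma level_diff: "\<lbrakk>x \<in> level t; y \<in> level t\<rbrakk> \<Longrightarrow> x - y \<in> level t"
  using level_add[OF _ level_scaleR[of y t "-1"]] by simp

lemma level_zero: "0 \<in> level t"
proof -
  have "emb [] + emb [] = emb ([] @ [])" by (intro emb_add[symmetric]) simp_all
  then have "emb [] = 0" by simp
  then show ?thesis using emb_level[of "[]" t] by simp
qed

lemma mul_in_level:
  assumes "x \<in> level s" "y \<in> level t" shows "mul s x y \<in> level (s + t)"
proof -
  obtain U where U: "\<And>n. U n \<in> combs_at s" "(\<lambda>n. emb (U n)) \<longlonglongrightarrow> x" using level_obtain[OF assms(1)] by blast
  obtain V where V: "\<And>n. V n \<in> combs_at t" "(\<lambda>n. emb (V n)) \<longlonglongrightarrow> y" using level_obtain[OF assms(2)] by blast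
  have "V n \<in> combs" for n using V(1) combs_at_subset by blast
  then have "(\<lambda>n. emb (comb_mult (U n) (V n))) \<longlonglongrightarrow> mul s x y" by (intro mul_tendsto U V)
  then show ?thesis by (rule level_limI[rotated]) (intro comb_mult_in U V)
qed

lemma mul_in:
  assumes "x \<in> level s" "y \<in> completion" shows "mul s x y \<in> completion"
proof -
  obtain U where U: "\<And>n. U n \<in> combs_at s" "(\<lambda>n. emb (U n)) \<longlonglongrightarrow> x" using level_obtain[OF assms(1)] by blast
  obtain V where V: "\<And>n. V n \<in> combs" "(\<lambda>n. emb (V n)) \<longlonglongrightarrow> y" using completion_obtain[OF assms(2)] by blast
  have "(\<lambda>n. emb (comb_mult (U n) (V n))) \<longlonglongrightarrow> mul s x y" by (intro mul_tendsto U V)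
  moreover have "comb_mult (U n) (V n) \<in> combs" for n
    using U(1) V(1) combs_at_subset by (intro comb_mult_in) auto
  ultimately show ?thesis unfolding completion_def by (rule completion_limI[rotated])
qed

lemma mul_add_left:
  assumes "x \<in> level s" "x' \<in> level s" "y \<in> completion"
  shows "mul s (x + x') y = mul s x y + mul s x' y"
proof -
  obtain U where U: "\<And>n. U n \<in> combs_at s" "(\<lambda>n. emb (U n)) \<longlonglongrightarrow> x" using level_obtain[OF assms(1)] by blast
  obtain W where W: "\<And>n. W n \<in> combs_at s" "(\<lambda>n. emb (W n)) \<longlonglongrightarrow> x'" using level_obtain[OF assms(2)] by blast
  obtain V where V: "\<And>n. V n \<in> combs" "(\<lambda>n. emb (V n)) \<longlonglongrightarrow> y" using completion_obtain[OF assms(3)] by blast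
  have UW: "U n \<in> combs" "W n \<in> combs" for n using U(1) W(1) combs_at_subset by auto
  have "(\<lambda>n. emb (comb_mult (U n @ W n) (V n))) \<longlonglongrightarrow> mul s (x + x') y"
    by (intro mul_tendsto) (simp_all add: U W V UW emb_add tendsto_add)
  moreover have "(\<lambda>n. emb (comb_mult (U n) (V n)) + emb (comb_mult (W n) (V n))) \<longlonglongrightarrow> mul s x y + mul s x' y"
    by (intro tendsto_add mul_tendsto U V W)
  ultimately show ?thesis using UW V by (simp add: emb_add comb_mult_in LIMSEQ_unique)
qed

lemma emb_prefix_append:
  "valid u \<Longrightarrow> V \<in> combs \<Longrightarrow> V' \<in> combs \<Longrightarrow> emb (prefix u b (V @ V')) = emb (prefix u b V) + emb (prefix u b V')"
proof -
  assume "valid u" "V \<in> combs" "V' \<in> combs"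
  moreover have "prefix u b (V @ V') = prefix u b V @ prefix u b V'" by (simp add: prefix_def)
  ultimately show ?thesis by (simp add: emb_add prefix_in)
qed

lemma emb_mult_append:
  "U \<in> combs \<Longrightarrow> V \<in> combs \<Longrightarrow> V' \<in> combs \<Longrightarrow> emb (comb_mult U (V @ V')) = emb (comb_mult U V) + emb (comb_mult U V')"
proof (induction U)
  case Nil
  have "emb [] + emb [] = emb ([] @ [])" by (intro emb_add[symmetric]) simp_all
  then show ?case by simp
next
  case (Cons l U)
  then show ?case by (cases l) (simp add: emb_add comb_mult_in prefix_in emb_prefix_append)
qed

lemma mul_add_right:
  assumes "x \<in> level s" "y \<in> completion" "y' \<in> completion"
  shows "mul s x (y + y') = mul s x y + mul s x y'"
proof -
  obtain U where U: "\<And>n. U n \<in> combs_at s" "(\<lambda>n. emb (U n)) \<longlonglongrightarrow> x" using level_obtain[OF assms(1)] by blast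
  obtain V where V: "\<And>n. V n \<in> combs" "(\<lambda>n. emb (V n)) \<longlonglongrightarrow> y" using completion_obtain[OF assms(2)] by blast
  obtain W where W: "\<And>n. W n \<in> combs" "(\<lambda>n. emb (W n)) \<longlonglongrightarrow> y'" using completion_obtain[OF assms(3)] by blast
  have UC: "U n \<in> combs" for n using U(1) combs_at_subset by auto
  have "(\<lambda>n. emb (comb_mult (U n) (V n @ W n))) \<longlonglongrightarrow> mul s x (y + y')"
    by (intro mul_tendsto) (simp_all add: U W V emb_add tendsto_add)
  moreover have "(\<lambda>n. emb (comb_mult (U n) (V n)) + emb (comb_mult (U n) (W n))) \<longlonglongrightarrow> mul s x y + mul s x y'"
    by (intro tendsto_add mul_tendsto U V W)
  ultimately show ?thesis using UC V W by (simp add: emb_mult_append LIMSEQ_unique)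
qed

lemma comb_mult_ract: "comb_mult U (comb_ract V b) = comb_ract (comb_mult U V) b"
proof -
  have "prefix u d (comb_ract V b) = comb_ract (prefix u d V) b" for u d
    by (induction V) auto
  then show ?thesis by (induction U) (auto simp: comb_ract_def)
qed

lemma mul_bract:
  assumes "x \<in> level s" "y \<in> completion"
  shows "mul s x (bract y b) = bract (mul s x y) b"
proof -
  obtain U where U: "\<And>n. U n \<in> combs_at s" "(\<lambda>n. emb (U n)) \<longlonglongrightarrow> x" using level_obtain[OF assms(1)] by blast
  obtain V where V: "\<And>n. V n \<in> combs" "(\<lambda>n. emb (V n)) \<longlonglongrightarrow> y" using completion_obtain[OF assms(2)] by blast
  have UC: "U n \<in> combs" for n using U(1) combs_at_subset by auto
  have "(\<lambda>n. emb (comb_mult (U n) (comb_ract (V n) b))) \<longlonglongrightarrow> mul s x (bract y b)"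
    by (intro mul_tendsto) (simp_all add: U V comb_ract_in emb_rm bract.tendsto)
  moreover have "(\<lambda>n. bract (emb (comb_mult (U n) (V n))) b) \<longlonglongrightarrow> bract (mul s x y) b"
    by (intro bract.tendsto tendsto_const mul_tendsto U V)
  ultimately show ?thesis using UC V by (simp add: comb_mult_ract emb_rm comb_mult_in LIMSEQ_unique)
qed

lemma comb_mult_assoc: "comb_mult (comb_mult U V) W = comb_mult U (comb_mult V W)"
proof -
  have 1: "prefix u b (prefix w d W) = prefix (u @ (b, False, 0) # w) d W" for u b w d
    by (simp add: prefix_def case_prod_beta)
  have app: "prefix u b (X @ Y) = prefix u b X @ prefix u b Y" for u b X Y by (simp add: prefix_def)
  have "comb_mult (prefix u b V) W = prefix u b (comb_mult V W)" for u b
    by (induction V) (auto simp: 1 app)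
  then show ?thesis by (induction U) auto
qed

lemma mul_assoc:
  assumes "x \<in> level r" "y \<in> level s" "z \<in> completion"
  shows "mul (r + s) (mul r x y) z = mul r x (mul s y z)"
proof -
  obtain U where U: "\<And>n. U n \<in> combs_at r" "(\<lambda>n. emb (U n)) \<longlonglongrightarrow> x" using level_obtain[OF assms(1)] by blast
  obtain V where V: "\<And>n. V n \<in> combs_at s" "(\<lambda>n. emb (V n)) \<longlonglongrightarrow> y" using level_obtain[OF assms(2)] by blast
  obtain W where W: "\<And>n. W n \<in> combs" "(\<lambda>n. emb (W n)) \<longlonglongrightarrow> z" using completion_obtain[OF assms(3)] by blast
  have VC: "V n \<in> combs" for n using V(1) combs_at_subset by auto
  have "(\<lambda>n. emb (comb_mult (comb_mult (U n) (V n)) (W n))) \<longlonglongrightarrow> mul (r + s) (mul r x y) z"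
    by (intro mul_tendsto comb_mult_in U V W VC)
  moreover have "(\<lambda>n. emb (comb_mult (U n) (comb_mult (V n) (W n)))) \<longlonglongrightarrow> mul r x (mul s y z)"
    by (intro mul_tendsto comb_mult_in U V W VC)
  ultimately show ?thesis by (simp add: comb_mult_assoc LIMSEQ_unique)
qed

lemma mul_diff_left:
  assumes "x \<in> level s" "x' \<in> level s" "y \<in> completion"
  shows "mul s (x - x') y = mul s x y - mul s x' y"
  using mul_add_left[OF level_diff[OF assms(1,2)] assms(2,3)] by simp

lemma mul_diff_right:
  assumes "x \<in> level s" "y \<in> completion" "y' \<in> completion"
  shows "mul s x (y - y') = mul s x y - mul s x y'"
  using mul_add_right[OF assms(1) completion_diff[OF assms(2,3)] assms(3)] by simp

text \<open>The limit of the estimate for differences with U' empty.\<close>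

lemma norm_mul_le:
  assumes "x \<in> level s" "y \<in> completion"
  shows "norm (mul s x y) \<le> norm x * norm y"
proof -
  obtain U where U: "\<And>n. U n \<in> combs_at s" "(\<lambda>n. emb (U n)) \<longlonglongrightarrow> x" using level_obtain[OF assms(1)] by blast
  obtain V where V: "\<And>n. V n \<in> combs" "(\<lambda>n. emb (V n)) \<longlonglongrightarrow> y" using completion_obtain[OF assms(2)] by blast
  have e0: "emb [] = 0"
  proof -
    have "emb [] + emb [] = emb ([] @ [])" by (intro emb_add[symmetric]) simp_all
    then show ?thesis by simp
  qed
  show ?thesis
  proof (rule LIMSEQ_le)
    show "(\<lambda>n. norm (emb (comb_mult (U n) (V n)))) \<longlonglongrightarrow> norm (mul s x y)" by (intro tendsto_norm mul_tendsto U V)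
    show "(\<lambda>n. norm (emb (U n)) * norm (emb (V n))) \<longlonglongrightarrow> norm x * norm y"
      by (intro tendsto_mult tendsto_norm U V)
    show "\<exists>N. \<forall>n\<ge>N. norm (emb (comb_mult (U n) (V n))) \<le> norm (emb (U n)) * norm (emb (V n))"
      using norm_mult_diff_left[OF U(1) combs_at_simps(1) V(1)] by (simp add: e0)
  qed
qed

section \<open>The algebra as level 0\<close>

definition base where "base b = emb [([], b)]"

lemma base_level: "base b \<in> level 0" unfolding base_def by (rule emb_level) simp

lemma base_in: "base b \<in> completion" by (rule level_completion[OF base_level])

lemma bract_base: "bract (base a) b = base (a * b)"
  unfolding base_def by (subst emb_rm[symmetric]) simp_all

lemma base_eq: "base b = bract (base 1) b" by (simp add: bract_base)

lemma base_add: "base (a + b) = base a + base b"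
  by (metis base_eq bract.add_right)

lemma ip_base: "ip (base a) (base b) = star a * b"
  unfolding base_def by (subst ip_emb) (simp_all add: comb_inner_def)

lemma norm_base: "norm (base b) = norm b"
  by (simp add: norm_completion[OF base_in] ip_base norm_star_mult)

lemma base_tendsto: "X \<longlonglongrightarrow> b \<Longrightarrow> (\<lambda>n. base (X n)) \<longlonglongrightarrow> base b"
  by (subst (1 2) base_eq) (intro bract.tendsto tendsto_const)

text \<open>Multiplying (u, d) by 1 turns the right coefficient d into a final letter of duration 0,
  which \<open>kern_pad\<close> turns back into a coefficient.\<close>

lemma mul_base_right:
  assumes "x \<in> level s" shows "mul s x (base b) = bract x b"
proof -
  have 1: "emb (comb_mult U [([], 1)]) = emb U" if "U \<in> combs" for U
    using that
  proof (induction U)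
    case (Cons l U)
    obtain u d where l: "l = (u, d)" by (cases l)
    have u: "valid u" using Cons.prems l by simp
    have "comb_inner 1 z [(u @ [(d, False, 0)], 1)] = comb_inner 1 z [(u, d)]" if "z \<in> combs" for z
      using that
    proof (induction z)
      case (Cons m z)
      then show ?case using u comb_inner_append_left[of 1 "[m]" z]
        by (cases m) (simp add: comb_inner_Cons kern_pad mult.assoc)
    qed simp
    then have "emb [(u @ [(d, False, 0)], 1)] = emb [(u, d)]" using u by (intro emb_eqI) simp_all
    then show ?case using Cons l u emb_add[of "[(u, d)]" U] emb_add[of "[(u @ [(d, False, 0)], 1)]" "comb_mult U [([], 1)]"]
      by (simp add: comb_mult_in)
  qed simp
  obtain U where U: "\<And>n. U n \<in> combs_at s" "(\<lambda>n. emb (U n)) \<longlonglongrightarrow> x" using level_obtain[OF assms] by blast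
  have UC: "U n \<in> combs" for n using U(1) combs_at_subset by auto
  have "(\<lambda>n. emb (comb_mult (U n) [([], 1)])) \<longlonglongrightarrow> mul s x (base 1)"
    unfolding base_def by (intro mul_tendsto U) simp_all
  then have "mul s x (base 1) = x" using U(2) UC by (simp add: 1 LIMSEQ_unique)
  then show ?thesis using mul_bract[OF assms base_in, of 1 b] by (simp add: bract_base)
qed

lemma comb_mult_base: "comb_mult [([], a)] V = prefix [] a V" by simp

lemma mul_inner:
  assumes "x \<in> level s" "x' \<in> level s" "y \<in> completion" "y' \<in> completion"
  shows "ip (mul s x y) (mul s x' y') = ip y (mul 0 (base (ip x x')) y')"
proof -
  obtain U where U: "\<And>n. U n \<in> combs_at s" "(\<lambda>n. emb (U n)) \<longlonglongrightarrow> x" using level_obtain[OF assms(1)] by blast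
  obtain W where W: "\<And>n. W n \<in> combs_at s" "(\<lambda>n. emb (W n)) \<longlonglongrightarrow> x'" using level_obtain[OF assms(2)] by blast
  obtain V where V: "\<And>n. V n \<in> combs" "(\<lambda>n. emb (V n)) \<longlonglongrightarrow> y" using completion_obtain[OF assms(3)] by blast
  obtain Z where Z: "\<And>n. Z n \<in> combs" "(\<lambda>n. emb (Z n)) \<longlonglongrightarrow> y'" using completion_obtain[OF assms(4)] by blast
  have UW: "U n \<in> combs" "W n \<in> combs" for n using U(1) W(1) combs_at_subset by auto
  have "(\<lambda>n. comb_inner 1 (comb_mult (U n) (V n)) (comb_mult (W n) (Z n))) \<longlonglongrightarrow> ip (mul s x y) (mul s x' y')"
    by (intro ip_tendsto mul_tendsto comb_mult_in U V W Z UW)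
  moreover have "(\<lambda>n. comb_inner 1 (V n) (comb_mult [([], comb_inner 1 (U n) (W n))] (Z n))) \<longlonglongrightarrow> ip y (mul 0 (base (ip x x')) y')"
  proof (intro ip_tendsto mul_tendsto comb_mult_in V Z)
    have "(\<lambda>n. base (comb_inner 1 (U n) (W n))) \<longlonglongrightarrow> base (ip x x')"
      by (intro base_tendsto ip_tendsto UW U W)
    then show "(\<lambda>n. emb [([], comb_inner 1 (U n) (W n))]) \<longlonglongrightarrow> base (ip x x')" by (simp add: base_def)
  qed simp_all
  moreover have "comb_inner 1 (comb_mult (U n) (V n)) (comb_mult (W n) (Z n))
      = comb_inner 1 (V n) (comb_mult [([], comb_inner 1 (U n) (W n))] (Z n))" for n
    unfolding comb_mult_base comb_inner_mult[OF U(1) W(1) V(1) Z(1)]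
    using V(1) Z(1) by (simp add: comb_inner_act)
  ultimately show ?thesis by (simp only: LIMSEQ_unique)
qed

lemma mul_base_adjoint:
  assumes "x \<in> completion" "y \<in> completion"
  shows "ip (mul 0 (base b) x) y = ip x (mul 0 (base (star b)) y)"
proof -
  obtain U where U: "\<And>n. U n \<in> combs" "(\<lambda>n. emb (U n)) \<longlonglongrightarrow> x" using completion_obtain[OF assms(1)] by blast
  obtain V where V: "\<And>n. V n \<in> combs" "(\<lambda>n. emb (V n)) \<longlonglongrightarrow> y" using completion_obtain[OF assms(2)] by blast
  have m: "(\<lambda>n. emb (prefix [] a (W n))) \<longlonglongrightarrow> mul 0 (base a) w"
    if "\<And>n. W n \<in> combs" "(\<lambda>n. emb (W n)) \<longlonglongrightarrow> w" for a W w
    unfolding comb_mult_base[symmetric] base_def by (intro mul_tendsto that) simp_all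
  have "(\<lambda>n. comb_inner 1 (prefix [] b (U n)) (V n)) \<longlonglongrightarrow> ip (mul 0 (base b) x) y"
    by (intro ip_tendsto m U V prefix_in) simp_all
  moreover have "(\<lambda>n. comb_inner 1 (U n) (prefix [] (star b) (V n))) \<longlonglongrightarrow> ip x (mul 0 (base (star b)) y)"
    by (intro ip_tendsto m U V prefix_in) simp_all
  ultimately show ?thesis using U V by (simp add: comb_inner_act LIMSEQ_unique)
qed

lemma mul_base_scaleC:
  assumes "y \<in> completion"
  shows "mul 0 (base (z *\<^sub>C b)) y = bract (mul 0 (base b) y) (z *\<^sub>C 1)"
proof -
  obtain V where V: "\<And>n. V n \<in> combs" "(\<lambda>n. emb (V n)) \<longlonglongrightarrow> y" using completion_obtain[OF assms(1)] by blast
  have m: "(\<lambda>n. emb (prefix [] a (V n))) \<longlonglongrightarrow> mul 0 (base a) y" for a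
    unfolding comb_mult_base[symmetric] base_def by (intro mul_tendsto V) simp_all
  have "emb (prefix [] (z *\<^sub>C b) (V n)) = bract (emb (prefix [] b (V n))) (z *\<^sub>C 1)" for n
  proof -
    have P: "prefix [] a (V n) \<in> combs" for a using V by (simp add: prefix_in)
    have "emb (prefix [] (z *\<^sub>C b) (V n)) = emb (comb_ract (prefix [] b (V n)) (z *\<^sub>C 1))"
      using V by (intro emb_eqI P comb_ract_in)
        (simp add: comb_inner_act comb_inner_ract comb_inner_scaleC mult_scaleC_right)
    then show ?thesis by (simp add: emb_rm P)
  qed
  then have "(\<lambda>n. bract (emb (prefix [] b (V n))) (z *\<^sub>C 1)) \<longlonglongrightarrow> mul 0 (base (z *\<^sub>C b)) y"
    using m[of "z *\<^sub>C b"] by simp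
  moreover have "(\<lambda>n. bract (emb (prefix [] b (V n))) (z *\<^sub>C 1)) \<longlonglongrightarrow> bract (mul 0 (base b) y) (z *\<^sub>C 1)"
    by (intro bract.tendsto tendsto_const m)
  ultimately show ?thesis by (rule LIMSEQ_unique)
qed

lemma mul_base_one: "y \<in> completion \<Longrightarrow> mul 0 (base 1) y = y"
proof -
  assume y: "y \<in> completion"
  obtain V where V: "\<And>n. V n \<in> combs" "(\<lambda>n. emb (V n)) \<longlonglongrightarrow> y" using completion_obtain[OF y] by blast
  have "(\<lambda>n. emb (prefix [] 1 (V n))) \<longlonglongrightarrow> mul 0 (base 1) y"
    unfolding comb_mult_base[symmetric] base_def by (intro mul_tendsto V) simp_all
  moreover have "emb (prefix [] 1 (V n)) = emb (V n)" for n
    using V by (intro emb_eqI) (simp_all add: prefix_in comb_inner_act)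
  ultimately show "mul 0 (base 1) y = y" using V(2) by (simp add: LIMSEQ_unique)
qed

lemma mul_base_base: "mul 0 (base a) (base b) = base (a * b)"
  by (simp add: mul_base_right base_level bract_base)

text \<open>\<open>emb\<close> records nothing but inner products with other sums, and these reduce
  to kernels against single words.\<close>

lemma emb_word_eqI:
  assumes "valid u" "valid w" "\<And>v. valid v \<Longrightarrow> kern v u 1 * b = kern v w 1 * d"
  shows "emb [(u, b)] = emb [(w, d)]"
proof (rule emb_eqI)
  fix z assume "z \<in> combs"
  then show "comb_inner 1 z [(u, b)] = comb_inner 1 z [(w, d)]"
  proof (induction z)
    case (Cons m z)
    then show ?case using comb_inner_append_left[of 1 "[m]" z] assms(3)
      by (cases m) (simp add: comb_inner_Cons mult.assoc)
  qed simp
qed (simp_all add: assms)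

text \<open>Padding by \<open>\<omega>\<close> on the right does not change a vector.\<close>

lemma level_mono:
  assumes "x \<in> level s" "s \<le> t" shows "x \<in> level t"
proof -
  obtain U where U: "\<And>n. U n \<in> combs_at s" "(\<lambda>n. emb (U n)) \<longlonglongrightarrow> x" using level_obtain[OF assms(1)] by blast
  have "\<exists>W\<in>combs_at t. emb W = emb V" if "V \<in> combs_at s" for V
    using that
  proof (induction V)
    case (Cons l V)
    obtain u b where l: "l = (u, b)" by (cases l)
    have u: "valid u" "duration u = s" using Cons.prems l by auto
    obtain W where W: "W \<in> combs_at t" "emb W = emb V" using Cons l by auto
    define u' where "u' = u @ [(1, False, t - s)]"
    have u': "valid u'" "duration u' = t" using u assms(2) by (simp_all add: u'_def)
    have "emb [(u', b)] = emb [(u, b)]"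
      using u u' assms(2) by (intro emb_word_eqI) (simp_all add: u'_def kern_pad)
    moreover have "W \<in> combs" "V \<in> combs" using W Cons.prems l combs_at_subset by auto
    ultimately have "emb ((u', b) # W) = emb (l # V)"
      using u u' W(2) emb_add[of "[(u', b)]" W] emb_add[of "[(u, b)]" V] by (simp add: l)
    then show ?case using W u' by (intro bexI[of _ "(u', b) # W"]) auto
  qed (auto intro: bexI[of _ "[]"])
  then have "\<forall>n. \<exists>W. W \<in> combs_at t \<and> emb W = emb (U n)" using U(1) by blast
  then obtain W where "\<And>n. W n \<in> combs_at t" "\<And>n. emb (W n) = emb (U n)" by metis
  then show ?thesis using U(2) by (intro level_limI[of W]) simp_all
qed

section \<open>The two units in the completion\<close>

definition unit where "unit e t = emb [([(1, e, t)], 1)]"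

lemma unit_level: "t \<ge> 0 \<Longrightarrow> unit e t \<in> level t"
  unfolding unit_def by (rule emb_level) simp

lemma unit_in: "t \<ge> 0 \<Longrightarrow> unit e t \<in> completion"
  by (rule level_completion[OF unit_level])

text \<open>By padding, all \<omega>_t are one and the same vector of the completion, the image of
  1.\<close>

lemma unit_False: "t \<ge> 0 \<Longrightarrow> unit False t = base 1"
  unfolding unit_def base_def using kern_pad[of _ "[]" t 1] by (intro emb_word_eqI) simp_all

lemma unit_0: "unit e 0 = base 1"
  unfolding unit_def base_def by (intro emb_word_eqI) (simp_all add: kern_zero)

lemma mul_word: "valid u \<Longrightarrow> valid w \<Longrightarrow> mul (duration u) (emb [(u, 1)]) (emb [(w, d)]) = emb [(u @ w, d)]"
  by (subst mul_emb) (auto intro!: emb_word_eqI simp: kern_mid_one)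

lemma mul_unit: "s \<ge> 0 \<Longrightarrow> t \<ge> 0 \<Longrightarrow> mul s (unit e s) (unit e t) = unit e (s + t)"
  using mul_word[of "[(1, e, s)]" "[(1, e, t)]" 1] unfolding unit_def
  by (auto intro!: emb_word_eqI simp: kern_split_right)

lemma lact_word: "valid w \<Longrightarrow> mul 0 (base b) (emb [(w, d)]) = emb [((b, False, 0) # w, d)]"
  unfolding base_def by (subst mul_emb) simp_all

lemma lact_unit: "t \<ge> 0 \<Longrightarrow> mul 0 (base b) (unit e t) = emb [([(b, e, t)], 1)]"
  unfolding unit_def by (subst lact_word) (auto intro!: emb_word_eqI simp: kern_zero, subst kern_coeff_right, simp)

lemma ip_unit: "t \<ge> 0 \<Longrightarrow> ip (unit e t) (mul 0 (base b) (unit e' t)) = transfer e e' t b"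
  unfolding lact_unit unfolding unit_def by (subst ip_emb) (simp_all add: comb_inner_def)

text \<open>Words of duration 0 collapse to coefficients. Since \<open>base\<close> is isometric and
  the algebra complete, limits of such vectors come from the algebra as well.\<close>

lemma level_0: 
  assumes "x \<in> level 0" shows "\<exists>b. x = base b"
proof -
  have word: "\<exists>b. emb [(w, d)] = base b" if "valid w" "duration w = 0" for w d
    using that
  proof (induction w arbitrary: d)
    case (Cons l w)
    obtain b e t where l: "l = (b, e, t)" by (cases l)
    have t: "t = 0" "valid w" "duration w = 0" using Cons.prems duration_nonneg[of w] l by auto
    then obtain a where "emb [(w, d)] = base a" using Cons.IH by blast
    moreover have "emb [(l # w, d)] = mul 0 (base b) (emb [(w, d)])"
      unfolding lact_word[OF t(2)] l t(1) using t by (intro emb_word_eqI) (simp_all add: kern_zero)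
    ultimately show ?case by (auto simp: mul_base_base)
  qed (auto simp: base_def)
  have comb: "\<exists>b. emb U = base b" if "U \<in> combs_at 0" for U
    using that
  proof (induction U)
    case Nil
    have "emb [] + emb [] = emb ([] @ [])" by (intro emb_add[symmetric]) simp_all
    moreover have "base 0 = 0" using norm_base[of 0] by simp
    ultimately show ?case by (intro exI[of _ 0]) simp
  next
    case (Cons l U)
    obtain w d where l: "l = (w, d)" by (cases l)
    have UC: "U \<in> combs" using Cons.prems l combs_at_subset by auto
    obtain a b where "emb [(w, d)] = base a" "emb U = base b" using word[of w d] Cons l by auto
    then show ?case using emb_add[of "[(w, d)]" U] Cons.prems l UC by (auto simp: base_add[symmetric])
  qed
  obtain U where U: "\<And>n. U n \<in> combs_at 0" "(\<lambda>n. emb (U n)) \<longlonglongrightarrow> x" using level_obtain[OF assms(1)] by blast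
  then have "\<exists>b. \<forall>n. emb (U n) = base (b n)" using comb by (intro choice) blast
  then obtain b where b: "\<And>n. emb (U n) = base (b n)" by blast
  have "base (a - a') = base a - base a'" for a a' using base_add[of "a - a'" a'] by simp
  then have "Cauchy b"
    using LIMSEQ_imp_Cauchy[OF U(2)] unfolding Cauchy_iff b by (metis norm_base)
  then obtain l where "b \<longlonglongrightarrow> l" by (auto simp: Cauchy_convergent_iff convergent_def)
  then have "(\<lambda>n. emb (U n)) \<longlonglongrightarrow> base l" unfolding b by (rule base_tendsto)
  then show ?thesis using U(2) LIMSEQ_unique by blast
qed

text \<open>Each word is cut at time s, so the sums of products are dense in level s + t.\<close>

lemma level_product_dense:
  assumes "Z \<in> combs_at (s + t)" "s \<ge> 0" "t \<ge> 0"
  shows "\<exists>X. set X \<subseteq> level s \<times> level t \<and> emb Z = (\<Sum>(x, y)\<leftarrow>X. mul s x y)"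
  using assms(1)
proof (induction Z)
  case Nil
  have "emb [] + emb [] = emb ([] @ [])" by (intro emb_add[symmetric]) simp_all
  then show ?case by (intro exI[of _ "[]"]) simp
next
  case (Cons l Z)
  obtain w d where l: "l = (w, d)" by (cases l)
  have w: "valid w" "duration w = s + t" using Cons.prems l by auto
  have ZC: "Z \<in> combs" using Cons.prems l combs_at_subset by auto
  obtain X where X: "set X \<subseteq> level s \<times> level t" "emb Z = (\<Sum>(x, y)\<leftarrow>X. mul s x y)" using Cons l by auto
  obtain u w' where uw: "valid u" "valid w'" "duration u = s" "duration w' = t"
    "\<And>v a. valid v \<Longrightarrow> kern v w a = kern v (u @ w') a"
    using word_split[OF w assms(2,3)] by blast
  have "emb [(w, d)] = emb [(u @ w', d)]" using uw w by (intro emb_word_eqI) simp_all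
  also have "\<dots> = mul s (emb [(u, 1)]) (emb [(w', d)])" using mul_word[of u w' d] uw by simp
  finally have "emb (l # Z) = mul s (emb [(u, 1)]) (emb [(w', d)]) + emb Z"
    using emb_add[of "[(w, d)]" Z] w ZC by (simp add: l)
  moreover have "emb [(u, 1)] \<in> level s" "emb [(w', d)] \<in> level t" using uw by (auto intro: emb_level)
  ultimately show ?case using X by (intro exI[of _ "(emb [(u, 1)], emb [(w', d)]) # X"]) simp
qed

end

context spatial_cp
begin

section \<open>Continuity\<close>

lemma transfer_continuous: "continuous_on {0..} (\<lambda>t. transfer e e' t a)"
proof -
  have "continuous_on {0..} (\<lambda>t. T t a)" using strong by (simp add: strongly_continuous_def)
  moreover have "continuous_on {0..} (\<lambda>t. star (c t))"
    by (rule bounded_linear.continuous_on[OF bounded_linear_star c_cont])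
  ultimately show ?thesis
    by (cases e; cases e') (auto simp: transfer_def intro!: continuous_intros c_cont)
qed

lemma ip_unit_unit: "t \<ge> 0 \<Longrightarrow> ip (unit e t) (unit e' t) = transfer e e' t 1"
  using ip_unit[of t e 1 e'] by (simp add: mul_base_one unit_in)

lemma norm_unit: "t \<ge> 0 \<Longrightarrow> norm (unit e t) = sqrt (norm (transfer e e t 1))"
  by (simp add: norm_completion unit_in ip_unit_unit)

lemma norm_unit_continuous: "continuous_on {0..} (\<lambda>t. norm (unit e t))"
proof (rule continuous_on_eq)
  show "continuous_on {0..} (\<lambda>t. sqrt (norm (transfer e e t 1)))"
    by (intro continuous_intros transfer_continuous)
qed (simp add: norm_unit)

text \<open>Reading \<open>base 1\<close> as \<omega>_t, all four inner products are taken at the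
  same time t. Norm continuity of c enters here, through \<open>transfer_continuous\<close>. The gap
  vanishes at 0, and continuity of the units is derived from that.\<close>

lemma unit_gap_continuous: "continuous_on {0..} (\<lambda>t. norm (unit e t - base 1))"
proof (rule continuous_on_eq)
  show "continuous_on {0..} (\<lambda>t. sqrt (norm (transfer e e t 1 - transfer e False t 1 - (transfer False e t 1 - 1))))"
    by (intro continuous_intros transfer_continuous)
next
  fix t :: real assume "t \<in> {0..}"
  then have t: "t \<ge> 0" by simp
  have "ip (unit e t - unit False t) (unit e t - unit False t)
      = transfer e e t 1 - transfer e False t 1 - (transfer False e t 1 - transfer False False t 1)"
    using t by (simp add: ip_diff ip_diff_left unit_in completion_diff ip_unit_unit)
  then show "sqrt (norm (transfer e e t 1 - transfer e False t 1 - (transfer False e t 1 - 1))) = norm (unit e t - base 1)"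
    using t norm_completion[OF completion_diff[OF unit_in[OF t, of e] unit_in[OF t, of False]]]
    by (simp add: unit_False)
qed

lemma base_level': "t \<ge> 0 \<Longrightarrow> base b \<in> level t"
  by (rule level_mono[OF base_level])

lemma bract_one_level: "x \<in> level s \<Longrightarrow> mul s x (base 1) = x"
  by (simp add: mul_base_right)

text \<open>As \<zeta>_s is also \<zeta>_s \<omega>_(t - s), for s <= t the difference is \<zeta>_s
  (\<zeta>_(t - s) - \<omega>_(t - s)).\<close>

lemma norm_unit_diff_le:
  assumes "0 \<le> s" "0 \<le> t"
  shows "norm (unit e t - unit e s) \<le> norm (unit e (min s t)) * norm (unit e \<bar>t - s\<bar> - base 1)"
proof -
  have le: "norm (unit e t - unit e s) \<le> norm (unit e s) * norm (unit e (t - s) - base 1)"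
    if st: "0 \<le> s" "s \<le> t" for s t
  proof -
    have "unit e t - unit e s = mul s (unit e s) (unit e (t - s) - base 1)"
      using st mul_unit[of s "t - s" e]
      by (simp add: mul_diff_right unit_level unit_in base_in bract_one_level)
    then show ?thesis using st by (simp add: norm_mul_le unit_level unit_in base_in completion_diff)
  qed
  show ?thesis
  proof (cases "s \<le> t")
    case True
    then show ?thesis using le[OF assms(1) True] by simp
  next
    case False
    then show ?thesis using le[of t s] assms by (simp add: norm_minus_commute)
  qed
qed

lemma unit_continuous: "continuous_on {0..} (unit e)"
  unfolding continuous_on_def
proof
  fix p :: real assume "p \<in> {0..}"
  then have p: "p \<ge> 0" by simp
  have "continuous_on {0..} (\<lambda>t. norm (unit e (min p t)) * norm (unit e \<bar>t - p\<bar> - base 1))"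
    using p by (intro continuous_on_mult continuous_on_compose2[OF norm_unit_continuous]
        continuous_on_compose2[OF unit_gap_continuous]) (auto intro!: continuous_intros)
  then have "((\<lambda>t. norm (unit e (min p t)) * norm (unit e \<bar>t - p\<bar> - base 1)) \<longlongrightarrow> 0) (at p within {0..})"
    using p unfolding continuous_on_def by (force simp: unit_0)
  moreover have "\<forall>\<^sub>F t in at p within {0..}. norm (unit e t - unit e p) \<le> norm (unit e (min p t)) * norm (unit e \<bar>t - p\<bar> - base 1)"
    using p norm_unit_diff_le[of p] by (simp add: eventually_at_filter)
  ultimately have "((\<lambda>t. unit e t - unit e p) \<longlongrightarrow> 0) (at p within {0..})"
    by (rule Lim_null_comparison[rotated])
  then show "(unit e \<longlongrightarrow> unit e p) (at p within {0..})" by (simp add: LIM_zero_iff)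
qed

section \<open>Strong continuity of left multiplication by \<omega>\<close>

text \<open>The vector \<omega>_r y - y. Left multiplication by \<omega>_r, unlike right
  multiplication, moves vectors of the completion; the aim is that it tends strongly to the identity
  as r tends to 0.\<close>

definition shift_gap where "shift_gap y r = mul r (base 1) y - y"

lemma norm_shift_le: "r \<ge> 0 \<Longrightarrow> y \<in> completion \<Longrightarrow> norm (mul r (base 1) y) \<le> norm y"
  using norm_mul_le[of "base 1" r y] by (simp add: base_level' norm_base)

lemma shift_gap_comb:
  assumes "y \<in> completion" "y' \<in> completion" "(shift_gap y \<longlongrightarrow> 0) (at 0 within {0..})"
    "(shift_gap y' \<longlongrightarrow> 0) (at 0 within {0..})"
  shows "(shift_gap (y + bract y' b) \<longlongrightarrow> 0) (at 0 within {0..})"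
proof -
  have "((\<lambda>r. shift_gap y r + bract (shift_gap y' r) b) \<longlongrightarrow> 0 + bract 0 b) (at 0 within {0..})"
    by (intro tendsto_add bract.tendsto tendsto_const assms)
  then have "((\<lambda>r. shift_gap y r + bract (shift_gap y' r) b) \<longlongrightarrow> 0) (at 0 within {0..})"
    by (simp add: bract.zero_left)
  moreover have "shift_gap (y + bract y' b) r = shift_gap y r + bract (shift_gap y' r) b" if "r \<ge> 0" for r
    using assms(1,2) that
    by (simp add: shift_gap_def mul_add_right mul_bract base_level' completion_bract bract.diff_left)
  ultimately show ?thesis
    by (subst tendsto_cong) (auto simp: eventually_at_filter)
qed

text \<open>\<omega>_r \<zeta>_t - \<zeta>_t = (\<zeta>_(r + t) - \<zeta>_t) - (\<zeta>_r -
  \<omega>_r) \<zeta>_t, and both terms tend to 0 by continuity of the unit.\<close>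

lemma shift_gap_unit:
  assumes "t \<ge> 0" shows "(shift_gap (unit e t) \<longlongrightarrow> 0) (at 0 within {0..})"
proof -
  have "continuous_on {0..} (\<lambda>r. norm (unit e r - base 1) * norm (unit e t) + norm (unit e (r + t) - unit e t))"
    using assms by (intro continuous_intros unit_gap_continuous continuous_on_compose2[OF unit_continuous]) auto
  then have lim: "((\<lambda>r. norm (unit e r - base 1) * norm (unit e t) + norm (unit e (r + t) - unit e t)) \<longlongrightarrow> 0) (at 0 within {0..})"
    unfolding continuous_on_def by (force simp: unit_0)
  have bound: "norm (shift_gap (unit e t) r) \<le> norm (unit e r - base 1) * norm (unit e t) + norm (unit e (r + t) - unit e t)"
    if r: "r \<ge> 0" for r
  proof -
    have "shift_gap (unit e t) r = (unit e (r + t) - unit e t) - mul r (unit e r - base 1) (unit e t)"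
      using r assms by (simp add: shift_gap_def mul_diff_left mul_unit unit_level unit_in base_level')
    moreover have "norm (mul r (unit e r - base 1) (unit e t)) \<le> norm (unit e r - base 1) * norm (unit e t)"
      using r assms by (intro norm_mul_le level_diff unit_level unit_in base_level')
    ultimately show ?thesis
      using norm_triangle_ineq4[of "unit e (r + t) - unit e t" "mul r (unit e r - base 1) (unit e t)"] by simp
  qed
  show ?thesis
    by (rule Lim_null_comparison[OF _ lim]) (use bound in \<open>auto simp: eventually_at_filter\<close>)
qed

text \<open>By centrality \<omega>_r and b commute, so the gap of b y is b times the gap of
  y.\<close>

lemma shift_gap_lact:
  assumes "y \<in> completion" "(shift_gap y \<longlongrightarrow> 0) (at 0 within {0..})"
  shows "(shift_gap (mul 0 (base b) y) \<longlongrightarrow> 0) (at 0 within {0..})"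
proof -
  have "((\<lambda>r. norm b * norm (shift_gap y r)) \<longlongrightarrow> norm b * 0) (at 0 within {0..})"
    by (intro tendsto_mult tendsto_const tendsto_norm_zero assms)
  then have lim: "((\<lambda>r. norm b * norm (shift_gap y r)) \<longlongrightarrow> 0) (at 0 within {0..})" by simp
  have bound: "norm (shift_gap (mul 0 (base b) y) r) \<le> norm b * norm (shift_gap y r)" if r: "r \<ge> 0" for r
  proof -
    have "mul r (base 1) (mul 0 (base b) y) = mul r (base b) y"
      using mul_assoc[of "base 1" r "base b" 0 y] r assms(1)
      by (simp add: base_level' base_level mul_base_right bract_base)
    moreover have "mul 0 (base b) (mul r (base 1) y) = mul r (base b) y"
      using mul_assoc[of "base b" 0 "base 1" r y] r assms(1)
      by (simp add: base_level' base_level mul_base_right bract_base)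
    ultimately have "shift_gap (mul 0 (base b) y) r = mul 0 (base b) (shift_gap y r)"
      using r assms(1) by (simp add: shift_gap_def mul_diff_right base_level mul_in[OF base_level'])
    then show ?thesis
      using norm_mul_le[OF base_level, of "shift_gap y r" b] r assms(1)
      by (simp add: norm_base shift_gap_def completion_diff mul_in[OF base_level'])
  qed
  show ?thesis
    by (rule Lim_null_comparison[OF _ lim]) (use bound in \<open>auto simp: eventually_at_filter\<close>)
qed

text \<open>Insert x \<omega>_r y: the gap of x y is (\<omega>_r x - x \<omega>_r) y + x (\<omega>_r
  y - y). In level r + t the vector x stands for x \<omega>_r, so both brackets are gaps.\<close>

lemma shift_gap_mul:
  assumes t: "t \<ge> 0" and x: "x \<in> level t" "(shift_gap x \<longlongrightarrow> 0) (at 0 within {0..})"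
    and y: "y \<in> completion" "(shift_gap y \<longlongrightarrow> 0) (at 0 within {0..})"
  shows "(shift_gap (mul t x y) \<longlongrightarrow> 0) (at 0 within {0..})"
proof -
  have "((\<lambda>r. norm (shift_gap x r) * norm y + norm x * norm (shift_gap y r)) \<longlongrightarrow> 0 * norm y + norm x * 0) (at 0 within {0..})"
    by (intro tendsto_add tendsto_mult tendsto_norm_zero tendsto_const x y)
  then have lim: "((\<lambda>r. norm (shift_gap x r) * norm y + norm x * norm (shift_gap y r)) \<longlongrightarrow> 0) (at 0 within {0..})" by simp
  have bound: "norm (shift_gap (mul t x y) r) \<le> norm (shift_gap x r) * norm y + norm x * norm (shift_gap y r)"
    if r: "r \<ge> 0" for r
  proof -
    have sx: "mul r (base 1) x \<in> level (r + t)" using r x(1) by (intro mul_in_level base_level')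
    have xl: "x \<in> level (r + t)" using r by (intro level_mono[OF x(1)]) simp
    have sy: "mul r (base 1) y \<in> completion" using r y(1) by (intro mul_in[OF base_level'])
    have "mul r (base 1) (mul t x y) = mul (r + t) (mul r (base 1) x) y"
      using r x(1) y(1) by (simp add: mul_assoc base_level')
    moreover have "mul t x (mul r (base 1) y) = mul (r + t) x y"
      using mul_assoc[OF x(1) base_level'[OF r] y(1), of 1] x(1) by (simp add: bract_one_level add.commute)
    ultimately have "shift_gap (mul t x y) r = mul (r + t) (shift_gap x r) y + mul t x (shift_gap y r)"
      using r x(1) y(1) sx xl sy by (simp add: shift_gap_def mul_diff_left mul_diff_right)
    moreover have "norm (mul (r + t) (shift_gap x r) y) \<le> norm (shift_gap x r) * norm y"
      unfolding shift_gap_def by (intro norm_mul_le level_diff sx xl y)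
    moreover have "norm (mul t x (shift_gap y r)) \<le> norm x * norm (shift_gap y r)"
      unfolding shift_gap_def by (intro norm_mul_le completion_diff sy x y)
    ultimately show ?thesis
      using norm_triangle_ineq[of "mul (r + t) (shift_gap x r) y" "mul t x (shift_gap y r)"] by simp
  qed
  show ?thesis
    by (rule Lim_null_comparison[OF _ lim]) (use bound in \<open>auto simp: eventually_at_filter\<close>)
qed

lemma emb_word_Cons:
  assumes "t \<ge> 0" "valid w"
  shows "emb [((b, e, t) # w, d)] = mul t (mul 0 (base b) (unit e t)) (emb [(w, d)])"
  using mul_word[of "[(b, e, t)]" w d] assms by (simp add: lact_unit)

lemma shift_gap_word:
  "valid w \<Longrightarrow> (shift_gap (emb [(w, 1)]) \<longlongrightarrow> 0) (at 0 within {0..})"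
proof (induction w)
  case Nil
  have "shift_gap (base 1) r = 0" if "r \<ge> 0" for r
    using that by (simp add: shift_gap_def base_level' mul_base_right)
  then show ?case unfolding base_def[symmetric] by (intro tendsto_eventually) (auto simp: eventually_at_filter)
next
  case (Cons l w)
  obtain b e t where l: "l = (b, e, t)" by (cases l)
  have t: "t \<ge> 0" "valid w" using Cons.prems l by auto
  have "mul 0 (base b) (unit e t) \<in> level t" using mul_in_level[OF base_level unit_level[OF t(1)]] by simp
  then show ?case
    unfolding l emb_word_Cons[OF t] using t Cons.IH
    by (intro shift_gap_mul shift_gap_lact shift_gap_unit unit_in) (auto intro: emb_in)
qed

lemma shift_gap_emb: "U \<in> combs \<Longrightarrow> (shift_gap (emb U) \<longlongrightarrow> 0) (at 0 within {0..})"
proof (induction U)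
  case Nil
  have "emb [] + emb [] = emb ([] @ [])" by (intro emb_add[symmetric]) simp_all
  moreover have "shift_gap 0 r = 0" if "r \<ge> 0" for r
    using norm_shift_le[OF that, of 0] level_completion[OF level_zero] by (simp add: shift_gap_def)
  ultimately show ?case by (intro tendsto_eventually) (auto simp: eventually_at_filter)
next
  case (Cons l U)
  obtain w d where l: "l = (w, d)" by (cases l)
  have w: "valid w" "U \<in> combs" using Cons.prems l by auto
  have "emb (l # U) = emb U + bract (emb [(w, 1)]) d"
    using w emb_add[of "[(w, d)]" U] emb_rm[of "[(w, 1)]" d] by (simp add: l add.commute)
  then show ?case using w Cons.IH by (simp only:) (intro shift_gap_comb shift_gap_word, auto intro: emb_in)
qed

text \<open>The shifts are contractions, so convergence on the dense set of formal sums
  suffices.\<close>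

lemma shift_gap_tendsto:
  assumes y: "y \<in> completion" shows "(shift_gap y \<longlongrightarrow> 0) (at 0 within {0..})"
proof (rule tendstoI)
  fix \<epsilon> :: real assume \<epsilon>: "\<epsilon> > 0"
  obtain U where U: "\<And>n. U n \<in> combs" "(\<lambda>n. emb (U n)) \<longlonglongrightarrow> y" using completion_obtain[OF y] by blast
  obtain n where n: "norm (emb (U n) - y) < \<epsilon> / 3"
    using LIMSEQ_D[OF U(2), of "\<epsilon> / 3"] \<epsilon> by auto
  let ?z = "emb (U n)"
  have z: "?z \<in> completion" using U by (simp add: emb_in)
  have "\<forall>\<^sub>F r in at 0 within {0..}. dist (shift_gap ?z r) 0 < \<epsilon> / 3"
    using shift_gap_emb[OF U(1)[of n]] \<epsilon> by (intro tendstoD) auto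
  then show "\<forall>\<^sub>F r in at 0 within {0..}. dist (shift_gap y r) 0 < \<epsilon>"
    unfolding eventually_at_filter
  proof eventually_elim
    case (elim r)
    show ?case
    proof (intro impI)
      assume "r \<noteq> 0" "r \<in> {0..}"
      then have r: "r \<ge> 0" and "norm (shift_gap ?z r) < \<epsilon> / 3" using elim by auto
      moreover have "shift_gap y r = shift_gap ?z r + (?z - y) - mul r (base 1) (?z - y)"
        using r y z by (simp add: shift_gap_def mul_diff_right base_level')
      moreover have "norm (mul r (base 1) (?z - y)) \<le> norm (?z - y)"
        using r y z by (intro norm_shift_le completion_diff)
      ultimately show "dist (shift_gap y r) 0 < \<epsilon>"
        using n norm_triangle_ineq4[of "shift_gap ?z r + (?z - y)" "mul r (base 1) (?z - y)"]
          norm_triangle_ineq[of "shift_gap ?z r" "?z - y"] by simp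
    qed
  qed
qed

text \<open>This rests on \<open>x \<omega>\<^sub>r y - x y \<rightarrow> 0\<close> for \<open>r \<rightarrow> 0\<close>.\<close>

lemma mul_tendsto_filter:
  assumes \<sigma>: "(\<sigma> \<longlongrightarrow> s) F" and s: "s \<ge> 0" and f: "(f \<longlongrightarrow> x) F" and x: "x \<in> level s"
    and g: "(g \<longlongrightarrow> y) F" and y: "y \<in> completion"
    and ev: "\<forall>\<^sub>F i in F. \<sigma> i \<ge> 0 \<and> f i \<in> level (\<sigma> i) \<and> g i \<in> completion"
  shows "((\<lambda>i. mul (\<sigma> i) (f i) (g i)) \<longlongrightarrow> mul s x y) F"
proof -
  let ?h = "\<lambda>r. norm (shift_gap y r)"
  have h0: "shift_gap y 0 = 0" using y by (simp add: shift_gap_def mul_base_one)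
  have hc: "continuous (at 0 within {0..}) ?h"
    unfolding continuous_within h0 using shift_gap_tendsto[OF y] by (simp add: tendsto_norm_zero)
  have \<sigma>0: "((\<lambda>i. \<bar>\<sigma> i - s\<bar>) \<longlongrightarrow> 0) F"
    using \<sigma> by (simp add: tendsto_rabs_zero_iff LIM_zero_iff)
  have "((\<lambda>i. ?h \<bar>\<sigma> i - s\<bar>) \<longlongrightarrow> ?h 0) F"
    by (rule continuous_within_tendsto_compose'[OF hc _ \<sigma>0]) simp
  then have h: "((\<lambda>i. ?h \<bar>\<sigma> i - s\<bar>) \<longlongrightarrow> 0) F" by (simp add: h0)
  have "((\<lambda>i. norm (f i) * norm (g i - y) + (norm (f i - x) * norm y + (norm (f i) + norm x) * ?h \<bar>\<sigma> i - s\<bar>))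
      \<longlongrightarrow> norm x * norm (y - y) + (norm (x - x) * norm y + (norm x + norm x) * 0)) F"
    by (intro tendsto_add tendsto_mult tendsto_norm tendsto_diff tendsto_const f g h)
  then have lim: "((\<lambda>i. norm (f i) * norm (g i - y) + (norm (f i - x) * norm y + (norm (f i) + norm x) * ?h \<bar>\<sigma> i - s\<bar>)) \<longlongrightarrow> 0) F"
    by simp
  have "\<forall>\<^sub>F i in F. norm (mul (\<sigma> i) (f i) (g i) - mul s x y)
      \<le> norm (f i) * norm (g i - y) + (norm (f i - x) * norm y + (norm (f i) + norm x) * ?h \<bar>\<sigma> i - s\<bar>)"
    using ev
  proof eventually_elim
    case (elim i)
    have "norm (mul (\<sigma> i) (f i) y - mul s x y) \<le> norm (f i - x) * norm y + (norm (f i) + norm x) * ?h \<bar>\<sigma> i - s\<bar>"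
    proof (cases "s \<le> \<sigma> i")
      case True
      have xl: "x \<in> level (\<sigma> i)" using x True by (rule level_mono)
      \<comment> \<open>At level \<open>\<sigma> i\<close> the vector x stands for x \<omega>_r with
        r = \<open>\<sigma> i - s\<close>; hence the gap of y appears behind x.\<close>
      have "mul s x (mul (\<sigma> i - s) (base 1) y) = mul (\<sigma> i) x y"
        using mul_assoc[OF x base_level' y, of "\<sigma> i - s" 1] True x by (simp add: bract_one_level)
      then have "mul (\<sigma> i) (f i) y - mul s x y = mul (\<sigma> i) (f i - x) y + mul s x (shift_gap y (\<sigma> i - s))"
        using elim x xl y True
        by (simp add: shift_gap_def mul_diff_left mul_diff_right mul_in[OF base_level'])
      moreover have "norm (mul (\<sigma> i) (f i - x) y) \<le> norm (f i - x) * norm y"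
        using elim xl y by (intro norm_mul_le level_diff) auto
      moreover have "norm (mul s x (shift_gap y (\<sigma> i - s))) \<le> norm x * ?h (\<sigma> i - s)"
        using x y True unfolding shift_gap_def
        by (intro norm_mul_le completion_diff mul_in[OF base_level']) auto
      ultimately have "norm (mul (\<sigma> i) (f i) y - mul s x y) \<le> norm (f i - x) * norm y + norm x * ?h (\<sigma> i - s)"
        using norm_triangle_ineq[of "mul (\<sigma> i) (f i - x) y" "mul s x (shift_gap y (\<sigma> i - s))"]
        by simp
      moreover have "norm x * ?h (\<sigma> i - s) \<le> (norm (f i) + norm x) * ?h (\<sigma> i - s)"
        by (intro mult_right_mono) auto
      ultimately show ?thesis using True by simp
    next
      case False
      then have le: "\<sigma> i \<le> s" by simp
      have fl: "f i \<in> level s" using elim le level_mono by blast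
      have fi: "f i \<in> level (\<sigma> i)" using elim by simp
      \<comment> \<open>Here f i is the vector to be prolonged, to level s, and the gap of y appears
        behind f i. This explains the two norms in the common bound.\<close>
      have "mul (\<sigma> i) (f i) (mul (s - \<sigma> i) (base 1) y) = mul s (f i) y"
        using mul_assoc[OF fi base_level' y, of "s - \<sigma> i" 1] le fi by (simp add: bract_one_level)
      then have "mul (\<sigma> i) (f i) y - mul s x y = mul s (f i - x) y - mul (\<sigma> i) (f i) (shift_gap y (s - \<sigma> i))"
        using fi fl x y le
        by (simp add: shift_gap_def mul_diff_left mul_diff_right mul_in[OF base_level'])
      moreover have "norm (mul s (f i - x) y) \<le> norm (f i - x) * norm y"
        using fl x y by (intro norm_mul_le level_diff) auto
      moreover have "norm (mul (\<sigma> i) (f i) (shift_gap y (s - \<sigma> i))) \<le> norm (f i) * ?h (s - \<sigma> i)"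
        using fi y le unfolding shift_gap_def
        by (intro norm_mul_le completion_diff mul_in[OF base_level']) auto
      ultimately have "norm (mul (\<sigma> i) (f i) y - mul s x y) \<le> norm (f i - x) * norm y + norm (f i) * ?h (s - \<sigma> i)"
        using norm_triangle_ineq4[of "mul s (f i - x) y" "mul (\<sigma> i) (f i) (shift_gap y (s - \<sigma> i))"]
        by simp
      moreover have "norm (f i) * ?h (s - \<sigma> i) \<le> (norm (f i) + norm x) * ?h (s - \<sigma> i)"
        by (intro mult_right_mono) auto
      moreover have "\<bar>\<sigma> i - s\<bar> = s - \<sigma> i" using le by simp
      ultimately show ?thesis by simp
    qed
    moreover have "norm (mul (\<sigma> i) (f i) (g i - y)) \<le> norm (f i) * norm (g i - y)"
      using elim y by (intro norm_mul_le completion_diff) auto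
    moreover have eq: "mul (\<sigma> i) (f i) (g i) - mul s x y = mul (\<sigma> i) (f i) (g i - y) + (mul (\<sigma> i) (f i) y - mul s x y)"
      using elim y by (simp add: mul_diff_right)
    ultimately show ?case
      unfolding eq using norm_triangle_ineq[of "mul (\<sigma> i) (f i) (g i - y)" "mul (\<sigma> i) (f i) y - mul s x y"]
      by linarith
  qed
  then have "((\<lambda>i. mul (\<sigma> i) (f i) (g i) - mul s x y) \<longlongrightarrow> 0) F"
    by (rule Lim_null_comparison) (rule lim)
  then show ?thesis by (simp add: LIM_zero_iff)
qed

lemma mul_continuous:
  fixes \<sigma> :: "'p::topological_space \<Rightarrow> real"
  assumes "continuous_on A \<sigma>" "continuous_on A f" "continuous_on A g"
    and "\<And>p. p \<in> A \<Longrightarrow> \<sigma> p \<ge> 0" "\<And>p. p \<in> A \<Longrightarrow> f p \<in> level (\<sigma> p)" "\<And>p. p \<in> A \<Longrightarrow> g p \<in> completion"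
  shows "continuous_on A (\<lambda>p. mul (\<sigma> p) (f p) (g p))"
  unfolding continuous_on_def
proof
  fix p assume p: "p \<in> A"
  show "((\<lambda>p. mul (\<sigma> p) (f p) (g p)) \<longlongrightarrow> mul (\<sigma> p) (f p) (g p)) (at p within A)"
    using assms p by (intro mul_tendsto_filter) (auto simp: continuous_on_def eventually_at_filter)
qed

lemma lact_continuous:
  fixes g :: "'p::topological_space \<Rightarrow> _"
  assumes "continuous_on A g" "\<And>p. p \<in> A \<Longrightarrow> g p \<in> completion"
  shows "continuous_on A (\<lambda>p. mul 0 (base b) (g p))"
  using assms by (intro mul_continuous) (auto intro!: continuous_intros base_level)

section \<open>Continuous sections through given vectors\<close>

text \<open>Rescaling all durations gives a continuous path of vectors that reaches the given word
  at r = 1 and passes through earlier levels before.\<close>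

definition scale :: "real \<Rightarrow> ('b \<times> bool \<times> real) list \<Rightarrow> ('b \<times> bool \<times> real) list" where
  "scale r w = map (\<lambda>(b, e, t). (b, e, r * t)) w"

lemma scale_simps [simp]: "scale r [] = []" "scale r ((b, e, t) # w) = (b, e, r * t) # scale r w"
  by (auto simp: scale_def)

lemma scale_valid: "valid w \<Longrightarrow> r \<ge> 0 \<Longrightarrow> valid (scale r w)"
  by (induction w) auto

lemma scale_duration: "duration (scale r w) = r * duration w"
  by (induction w) (auto simp: algebra_simps)

lemma scale_one: "scale 1 w = w"
  by (induction w) auto

lemma scale_continuous: "valid w \<Longrightarrow> continuous_on {0..} (\<lambda>r. emb [(scale r w, d)])"
proof (induction w)
  case (Cons l w)
  obtain b e t where l: "l = (b, e, t)" by (cases l)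
  have t: "t \<ge> 0" "valid w" using Cons.prems l by auto
  have u: "continuous_on {0..} (\<lambda>r. mul 0 (base b) (unit e (r * t)))"
    using t by (intro lact_continuous continuous_on_compose2[OF unit_continuous] unit_in)
      (auto intro!: continuous_intros)
  have lv: "mul 0 (base b) (unit e (r * t)) \<in> level (r * t)" if "r \<ge> 0" for r
    using mul_in_level[OF base_level unit_level[of "r * t" e]] t that by simp
  have "continuous_on {0..} (\<lambda>r. mul (r * t) (mul 0 (base b) (unit e (r * t))) (emb [(scale r w, d)]))"
    using t lv by (intro mul_continuous u Cons.IH) (auto intro!: continuous_intros emb_in simp: scale_valid)
  then show ?case
    by (rule continuous_on_eq) (use t in \<open>simp add: l emb_word_Cons scale_valid\<close>)
qed simp

definition path where "path U r = map (\<lambda>(w, d). (scale r w, d)) U"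

lemma path_continuous:
  "U \<in> combs \<Longrightarrow> continuous_on {0..} (\<lambda>r. emb (path U r))"
  and path_level: "U \<in> combs_at s \<Longrightarrow> r \<ge> 0 \<Longrightarrow> path U r \<in> combs_at (r * s)"
  and path_one: "path U 1 = U"
proof -
  show "U \<in> combs_at s \<Longrightarrow> r \<ge> 0 \<Longrightarrow> path U r \<in> combs_at (r * s)"
    by (induction U) (auto simp: path_def scale_valid scale_duration)
  show "path U 1 = U" by (simp add: path_def scale_one)
  have pc: "path V r \<in> combs" if "V \<in> combs" "r \<ge> 0" for V r
    using that by (induction V) (auto simp: path_def scale_valid)
  show "U \<in> combs \<Longrightarrow> continuous_on {0..} (\<lambda>r. emb (path U r))"
  proof (induction U)
    case (Cons l U)
    obtain w d where l: "l = (w, d)" by (cases l)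
    have w: "valid w" "U \<in> combs" using Cons.prems l by auto
    have "continuous_on {0..} (\<lambda>r. emb [(scale r w, d)] + emb (path U r))"
      using w Cons.IH by (intro continuous_intros scale_continuous)
    then show ?case
    proof (rule continuous_on_eq)
      fix r :: real assume "r \<in> {0..}"
      then show "emb [(scale r w, d)] + emb (path U r) = emb (path (l # U) r)"
        using w pc[of U r] emb_add[of "[(scale r w, d)]" "path U r"] by (simp add: l path_def scale_valid)
    qed
  qed (simp add: path_def)
qed

text \<open>A formal sum near y, rescaled by a factor just below 1, lies in an earlier level and is
  still near y.\<close>

lemma level_approx:
  assumes y: "y \<in> level s" and s: "s > 0" and \<epsilon>: "\<epsilon> > 0"
  shows "\<exists>r z. 0 \<le> r \<and> r < s \<and> z \<in> level r \<and> norm (y - z) < \<epsilon>"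
proof -
  obtain U where U: "\<And>n. U n \<in> combs_at s" "(\<lambda>n. emb (U n)) \<longlonglongrightarrow> y" using level_obtain[OF y] by blast
  obtain n where n: "norm (emb (U n) - y) < \<epsilon> / 2"
    using LIMSEQ_D[OF U(2), of "\<epsilon> / 2"] \<epsilon> by auto
  have "U n \<in> combs" using U(1) combs_at_subset by blast
  then have cont: "continuous_on {0..} (\<lambda>r. emb (path (U n) r))" by (rule path_continuous)
  define r where "r k = 1 - inverse (real (Suc k))" for k
  have r: "0 \<le> r k" "r k < 1" for k by (auto simp: r_def inverse_eq_divide field_simps)
  have "r \<longlonglongrightarrow> 1" unfolding r_def using tendsto_diff[OF tendsto_const LIMSEQ_inverse_real_of_nat, of 1] by simp
  then have "(\<lambda>k. emb (path (U n) (r k))) \<longlonglongrightarrow> emb (path (U n) 1)"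
    by (rule continuous_on_tendsto_compose[OF cont]) (auto simp: r)
  then obtain k where k: "norm (emb (path (U n) (r k)) - emb (U n)) < \<epsilon> / 2"
    using LIMSEQ_D[of "\<lambda>k. emb (path (U n) (r k))" "emb (U n)" "\<epsilon> / 2"] \<epsilon> by (auto simp: path_one)
  have "norm (y - emb (path (U n) (r k))) < \<epsilon>"
    using n k norm_triangle_ineq[of "y - emb (U n)" "emb (U n) - emb (path (U n) (r k))"]
    by (simp add: norm_minus_commute)
  moreover have "emb (path (U n) (r k)) \<in> level (r k * s)"
    by (intro emb_level path_level U r)
  ultimately show ?thesis using r[of k] s
    by (intro exI[of _ "r k * s"] exI[of _ "emb (path (U n) (r k))"]) auto
qed

text \<open>Approximate \<open>y\<close> by \<open>z\<^sub>n\<close> of levels \<open>q\<^sub>n < s\<close>. The section is the series of the differences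
  \<open>z\<^bsub>n\<^esub> - z\<^bsub>n-1\<^esub>\<close>, each faded in between the times \<open>q\<^sub>n\<close> and \<open>s\<close>.\<close>

lemma section_exists:
  assumes s: "s \<ge> 0" and y: "y \<in> level s"
  shows "\<exists>x. continuous_on {0..} x \<and> (\<forall>t\<ge>0. x t \<in> level t) \<and> x s = y"
proof (cases "s = 0")
  case True
  then obtain b where "y = base b" using level_0 y by blast
  then show ?thesis by (intro exI[of _ "\<lambda>_. y"]) (auto simp: base_level')
next
  case False
  then have s: "s > 0" using s by simp
  have "\<forall>n::nat. \<exists>p. 0 \<le> fst p \<and> fst p < s \<and> snd p \<in> level (fst p) \<and> norm (y - snd p) < (1/2) ^ n"
    using level_approx[OF y s] by (metis fst_conv snd_conv half_gt_zero_iff zero_less_one zero_less_power)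
  then obtain p where p: "\<And>n::nat. 0 \<le> fst (p n)" "\<And>n. fst (p n) < s" "\<And>n. snd (p n) \<in> level (fst (p n))"
    "\<And>n. norm (y - snd (p n)) < (1/2) ^ n" by metis
  define z where "z n = snd (p n)" for n
  \<comment> \<open>Both z n and z (n - 1) must lie in level q n. For n = 0 subtraction of natural
    numbers yields the same term twice.\<close>
  define q where "q n = max (fst (p n)) (fst (p (n - 1)))" for n
  define u where "u n = (if n = 0 then z 0 else z n - z (n - 1))" for n
  have q: "0 \<le> q n" "q n < s" for n using p(1,2) by (auto simp: q_def le_max_iff_disj)
  have zl: "z n \<in> level (q n)" "z (n - 1) \<in> level (q n)" for n
    unfolding z_def q_def by (rule level_mono[OF p(3)], simp)+
  have ul: "u n \<in> level (q n)" for n using zl by (auto simp: u_def intro: level_diff)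
  have usum: "(\<Sum>k<Suc n. u k) = z n" for n by (induction n) (auto simp: u_def)
  \<comment> \<open>For n > 0 successive approximations differ by at most 2^(1 - n) + 2^(-n) = 3 /
    2^n; the summand norm (z 0) covers n = 0.\<close>
  define M where "M n = (norm (z 0) + 3) * (1/2) ^ n" for n :: nat
  have uM: "norm (u n) \<le> M n" for n
  proof (cases n)
    case (Suc k)
    have "norm (u n) \<le> norm (y - z k) + norm (y - z (Suc k))"
      using norm_triangle_ineq4[of "y - z k" "y - z (Suc k)"] by (simp add: u_def Suc)
    also have "\<dots> \<le> (1/2) ^ k + (1/2) ^ Suc k"
      using p(4)[of k] p(4)[of "Suc k"] unfolding z_def by linarith
    also have "\<dots> = 3 * (1/2) ^ n" by (simp add: Suc)
    also have "\<dots> \<le> M n" unfolding M_def by (intro mult_right_mono) auto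
    finally show ?thesis .
  qed (simp add: u_def M_def)
  have M: "summable M" unfolding M_def by (intro summable_mult summable_geometric) simp
  \<comment> \<open>A ramp that is 0 up to time q n and 1 from time s on: u n contributes at time t
    only if q n < t, and then it belongs to level t.\<close>
  define f where "f n t = max 0 (min 1 ((t - q n) / (s - q n)))" for n t
  have f: "0 \<le> f n t" "f n t \<le> 1" for n t by (auto simp: f_def)
  have f0: "f n t = 0" if "t \<le> q n" for n t
    using that q(2)[of n] by (simp add: f_def divide_nonpos_pos)
  have fs: "f n s = 1" for n using q(2)[of n] by (simp add: f_def)
  define x where "x t = (\<Sum>n. f n t *\<^sub>R u n)" for t
  have bound: "norm (f n t *\<^sub>R u n) \<le> M n" for n t
    using f[of n t] uM[of n] mult_left_le_one_le[of "norm (u n)" "f n t"] by simp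
  have ul: "uniform_limit {0..} (\<lambda>n t. \<Sum>i<n. f i t *\<^sub>R u i) x sequentially"
    unfolding x_def[abs_def] by (rule Weierstrass_m_test[OF bound M])
  have "continuous_on {0..} x"
  proof (rule uniform_limit_theorem[OF _ ul])
    have "continuous_on {0..} (f n)" for n
      unfolding f_def[abs_def] using q(2)[of n] by (intro continuous_intros) auto
    then show "\<forall>\<^sub>F n in sequentially. continuous_on {0..} (\<lambda>t. \<Sum>i<n. f i t *\<^sub>R u i)"
      by (intro always_eventually allI continuous_intros)
  qed simp
  moreover have "x t \<in> level t" if t: "t \<ge> 0" for t
  proof (rule closed_sequentially[OF closed_level])
    have "f i t *\<^sub>R u i \<in> level t" for i
    proof (cases "t \<le> q i")
      case True
      then show ?thesis by (simp add: f0 level_zero)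
    next
      case False
      then show ?thesis using \<open>\<And>n. u n \<in> level (q n)\<close> level_mono[of "u i" "q i" t] by (intro level_scaleR) auto
    qed
    then show "(\<Sum>i<n. f i t *\<^sub>R u i) \<in> level t" for n
      by (induction n) (auto simp: level_zero level_add)
    show "(\<lambda>n. \<Sum>i<n. f i t *\<^sub>R u i) \<longlonglongrightarrow> x t"
      by (rule tendsto_uniform_limitI[OF ul]) (use t in simp)
  qed
  moreover have "x s = y"
  proof -
    have "(\<lambda>n. \<Sum>i<n. f i s *\<^sub>R u i) \<longlonglongrightarrow> x s"
      by (rule tendsto_uniform_limitI[OF ul]) (use s in simp)
    then have "z \<longlonglongrightarrow> x s" using LIMSEQ_Suc[of "\<lambda>n. \<Sum>i<n. u i"] by (simp add: fs usum del: sum.lessThan_Suc)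
    moreover have "z \<longlonglongrightarrow> y"
    proof -
      have "(\<lambda>n. norm (y - z n)) \<longlonglongrightarrow> 0"
      proof (rule tendsto_sandwich[OF _ _ tendsto_const])
        show "(\<lambda>n. (1/2) ^ n :: real) \<longlonglongrightarrow> 0" by (rule LIMSEQ_realpow_zero) auto
      qed (use p(4) in \<open>auto simp: z_def intro!: always_eventually less_imp_le\<close>)
      then have "(\<lambda>n. y - z n) \<longlonglongrightarrow> 0" by (simp add: tendsto_norm_zero_iff)
      from tendsto_diff[OF tendsto_const this, of y] show ?thesis by simp
    qed
    ultimately show ?thesis by (rule LIMSEQ_unique)
  qed
  ultimately show ?thesis by blast
qed

end

section \<open>Coding functions on lists of words\<close>

text \<open>Elements of the completion are functions on lists of words. Coding these lists by elements of
  \<open>'b list\<close>, one obtains modules with elements of type \<open>'b list \<Rightarrow> 'b\<close>.\<close>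

primrec code_word :: "('b::real_normed_algebra_1 \<times> bool \<times> real) list \<Rightarrow> 'b list" where
  "code_word [] = []"
| "code_word (l # w) = fst l # of_bool (fst (snd l)) # of_real (snd (snd l)) # code_word w"

text \<open>The length of each word precedes its code, so that the list can be cut at the right
  places.\<close>

primrec code_comb :: "(('b::real_normed_algebra_1 \<times> bool \<times> real) list \<times> 'b) list \<Rightarrow> 'b list" where
  "code_comb [] = []"
| "code_comb (p # U) = of_nat (length (fst p)) # code_word (fst p) @ snd p # code_comb U"

lemma code_word_append:
  "length w = length w' \<Longrightarrow> code_word w @ x = code_word w' @ y \<Longrightarrow> w = w' \<and> x = y"
  by (induction w w' rule: list_induct2) (auto simp: prod_eq_iff of_bool_eq_iff)

lemma inj_code_comb:
  "inj (code_comb :: (('b::real_normed_algebra_1 \<times> bool \<times> real) list \<times> 'b) list \<Rightarrow> 'b list)"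
proof (rule injI)
  fix U U' :: "(('b \<times> bool \<times> real) list \<times> 'b) list" assume "code_comb U = code_comb U'"
  then show "U = U'"
  proof (induction U arbitrary: U')
    case Nil
    then show ?case by (cases U') auto
  next
    case (Cons p U)
    then obtain p' V where U': "U' = p' # V" by (cases U') auto
    have len: "length (fst p) = length (fst p')" using Cons.prems by (simp add: U')
    have "code_word (fst p) @ snd p # code_comb U = code_word (fst p') @ snd p' # code_comb V"
      using Cons.prems by (simp add: U')
    then have "fst p = fst p' \<and> snd p # code_comb U = snd p' # code_comb V"
      by (rule code_word_append[OF len])
    then show ?case using Cons.IH by (simp add: U' prod_eq_iff)
  qed
qed

definition code ::
  "((('b::{real_normed_algebra_1} \<times> bool \<times> real) list \<times> 'b) list discrete \<Rightarrow>\<^sub>C 'b) \<Rightarrow> 'b list \<Rightarrow> 'b" where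
  "code f l = apply_bcontfun f (discrete (inv code_comb l))"

definition decode where "decode = inv code"

lemma decode_code [simp]:
  fixes f :: "(('b::real_normed_algebra_1 \<times> bool \<times> real) list \<times> 'b) list discrete \<Rightarrow>\<^sub>C 'b"
  shows "decode (code f) = f"
proof -
  have "inj (code :: ((('b \<times> bool \<times> real) list \<times> 'b) list discrete \<Rightarrow>\<^sub>C 'b) \<Rightarrow> 'b list \<Rightarrow> 'b)"
  proof (rule injI)
    fix f g :: "(('b \<times> bool \<times> real) list \<times> 'b) list discrete \<Rightarrow>\<^sub>C 'b" assume eq: "code f = code g"
    show "f = g"
    proof (rule bcontfun_eqI)
      fix z
      have "code f (code_comb (of_discrete z)) = code g (code_comb (of_discrete z))" by (simp add: eq)
      then show "apply_bcontfun f z = apply_bcontfun g z"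
        by (simp add: code_def inj_code_comb of_discrete_inverse)
    qed
  qed
  then show ?thesis by (simp add: decode_def inv_f_f)
qed

context correspondence
begin

section \<open>Boundedness of the left action of a correspondence\<close>

text \<open>Boundedness follows from adjointability: norm a ^ 2 - \<open>star a * a\<close> is of
  the form \<open>star d * d\<close>, so <a x, a x> + <d x, d x> = norm a ^ 2 <x, x>.\<close>

lemma norm_lact_le: "x \<in> hcarrier E \<Longrightarrow> norm (emb (lact E a x)) \<le> norm a * norm (emb x)"
proof -
  assume x: "x \<in> hcarrier E"
  have "positive ((norm a)\<^sup>2 *\<^sub>R 1 - star a * a)"
    by (intro positive_norm_minus positive_selfadjoint) (simp_all add: norm_star_mult)
  then obtain d where d: "(norm a)\<^sup>2 *\<^sub>R 1 - star a * a = star d * d" by (auto simp: positive_def)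
  have add: "hinner E x (lact E (a + b) x) = hinner E x (lact E a x) + hinner E x (lact E b x)" for a b
    using x by (simp add: lact_add_left inner_add lact_closed)
  have eq: "hinner E (lact E a x) (lact E a x) + hinner E (lact E d x) (lact E d x) = hinner E x (lact E ((norm a)\<^sup>2 *\<^sub>R 1) x)"
    using d x by (simp add: lact_star_mult_inner[symmetric] add[symmetric] algebra_simps)
  have "hinner E x (lact E ((norm a)\<^sup>2 *\<^sub>R 1) x) = (norm a)\<^sup>2 *\<^sub>R hinner E x x"
    using x lact_scaleC[of x "complex_of_real ((norm a)\<^sup>2)" 1]
    by (simp add: scaleC_of_real lact_one inner_ract del: of_real_power)
  then have eq': "(norm a)\<^sup>2 *\<^sub>R hinner E x x = hinner E (lact E a x) (lact E a x) + hinner E (lact E d x) (lact E d x)"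
    using eq by simp
  have "positive ((norm a)\<^sup>2 *\<^sub>R hinner E x x - hinner E (lact E a x) (lact E a x))"
    unfolding eq' using inner_positive[OF lact_closed[OF x, of d]] by simp
  then have "norm (hinner E (lact E a x) (lact E a x)) \<le> norm ((norm a)\<^sup>2 *\<^sub>R hinner E x x)"
    by (intro positive_norm_mono inner_positive lact_closed x)
  then have "(norm (emb (lact E a x)))\<^sup>2 \<le> (norm a * norm (emb x))\<^sup>2"
    using x by (simp add: norm_emb_sq lact_closed power_mult_distrib)
  then show ?thesis by (rule power2_le_imp_le) simp
qed

lemma lact_tendsto:
  assumes a: "a \<longlonglongrightarrow> b" and X: "\<And>n. X n \<in> hcarrier E" "(\<lambda>n. emb (X n)) \<longlonglongrightarrow> emb x" and x: "x \<in> hcarrier E"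
  shows "(\<lambda>n. emb (lact E (a n) (X n))) \<longlonglongrightarrow> emb (lact E b x)"
proof -
  have "(\<lambda>n. norm (a n) * norm (emb (X n) - emb x) + norm (a n - b) * norm (emb x)) \<longlonglongrightarrow>
      norm b * norm (emb x - emb x) + norm (b - b) * norm (emb x)"
    by (intro tendsto_add tendsto_mult tendsto_norm tendsto_diff tendsto_const a X)
  then have lim: "(\<lambda>n. norm (a n) * norm (emb (X n) - emb x) + norm (a n - b) * norm (emb x)) \<longlonglongrightarrow> 0"
    by simp
  have "norm (emb (lact E (a n) (X n)) - emb (lact E b x)) \<le> norm (a n) * norm (emb (X n) - emb x) + norm (a n - b) * norm (emb x)" for n
  proof -
    have "hadd E (lact E (a n) (hdiff E (X n) x)) (lact E (a n) x) = lact E (a n) (hadd E (hdiff E (X n) x) x)"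
      using X x by (simp add: lact_add_right hdiff_closed)
    moreover have "hadd E (hdiff E (X n) x) x = X n"
      using X x by (intro emb_inject) (simp_all add: emb_hadd hdiff_closed emb_hdiff add_closed)
    ultimately have 1: "emb (lact E (a n) (X n)) = emb (lact E (a n) (hdiff E (X n) x)) + emb (lact E (a n) x)"
      using X x by (metis emb_hadd lact_closed hdiff_closed)
    have "lact E (a n) x = hadd E (lact E (a n - b) x) (lact E b x)"
      using x lact_add_left[of x "a n - b" b] by simp
    then have 2: "emb (lact E (a n) x) = emb (lact E (a n - b) x) + emb (lact E b x)"
      using x by (simp add: emb_hadd lact_closed)
    have 3: "emb (lact E (a n) (X n)) - emb (lact E b x) = emb (lact E (a n) (hdiff E (X n) x)) + emb (lact E (a n - b) x)"
      unfolding 1 2 by simp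
    show ?thesis
      unfolding 3 using norm_triangle_ineq[of "emb (lact E (a n) (hdiff E (X n) x))" "emb (lact E (a n - b) x)"]
        norm_lact_le[OF hdiff_closed[OF X(1)[of n] x], of "a n"] norm_lact_le[OF x, of "a n - b"] X(1)[of n] x
      by (simp add: emb_hdiff)
  qed
  then have "(\<lambda>n. emb (lact E (a n) (X n)) - emb (lact E b x)) \<longlonglongrightarrow> 0"
    by (intro Lim_null_comparison[OF always_eventually lim]) simp
  then show ?thesis by (simp add: LIM_zero_iff)
qed

end

section \<open>The product system generated by the words\<close>

context spatial_cp
begin

text \<open>It shares its operations with the fibres, so that the embeddings of the fibres will be
  identities.\<close>

definition ambient :: "('b list \<Rightarrow> 'b, 'b) hmod" where
  "ambient = \<lparr>hcarrier = code ` completion, hzero = code 0, hadd = (\<lambda>x y. code (decode x + decode y)),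
     ract = (\<lambda>x b. code (bract (decode x) b)), hinner = (\<lambda>x y. ip (decode x) (decode y))\<rparr>"

definition level_corr :: "real \<Rightarrow> ('b list \<Rightarrow> 'b, 'b) corr" where
  "level_corr t = \<lparr>hcarrier = code ` level t, hzero = code 0, hadd = (\<lambda>x y. code (decode x + decode y)),
     ract = (\<lambda>x b. code (bract (decode x) b)), hinner = (\<lambda>x y. ip (decode x) (decode y)),
     lact = (\<lambda>b x. code (mul 0 (base b) (decode x)))\<rparr>"

lemma level_corr_simps [simp]:
  "hcarrier (level_corr t) = code ` level t" "hzero (level_corr t) = code 0"
  "hadd (level_corr t) = (\<lambda>x y. code (decode x + decode y))"
  "ract (level_corr t) = (\<lambda>x b. code (bract (decode x) b))"
  "hinner (level_corr t) = (\<lambda>x y. ip (decode x) (decode y))"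
  "lact (level_corr t) = (\<lambda>b x. code (mul 0 (base b) (decode x)))"
  by (simp_all add: level_corr_def)

lemma ambient_simps [simp]:
  "hcarrier ambient = code ` completion" "hzero ambient = code 0"
  "hadd ambient = (\<lambda>x y. code (decode x + decode y))"
  "ract ambient = (\<lambda>x b. code (bract (decode x) b))"
  "hinner ambient = (\<lambda>x y. ip (decode x) (decode y))"
  by (simp_all add: ambient_def)

lemma hilbert_module_code:
  fixes E :: "('b list \<Rightarrow> 'b, 'b, 'm) hmod_scheme"
  assumes E: "hcarrier E = code ` L" "hzero E = code 0" "hadd E = (\<lambda>x y. code (decode x + decode y))"
    "ract E = (\<lambda>x b. code (bract (decode x) b))" "hinner E = (\<lambda>x y. ip (decode x) (decode y))"
  and L: "L \<subseteq> completion" "closed L" "0 \<in> L" "\<And>x y. \<lbrakk>x \<in> L; y \<in> L\<rbrakk> \<Longrightarrow> x + y \<in> L" "\<And>x b. x \<in> L \<Longrightarrow> bract x b \<in> L"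
  shows "hilbert_module E"
proof
  have LC: "x \<in> completion" if "x \<in> L" for x using that L(1) by blast
  note [simp] = E
  show "hzero E \<in> hcarrier E" using L(3) by simp
  fix x y z a b assume x: "x \<in> hcarrier E"
  then obtain x' where x': "x = code x'" "x' \<in> L" by auto
  show "hadd E x (hzero E) = x" by (simp add: x')
  show "\<exists>y\<in>hcarrier E. hadd E x y = hzero E"
    using L(5)[OF x'(2), of "-1"] by (intro bexI[of _ "ract E x (-1)"]) (auto simp: x' bract.minus_right)
  show "ract E x b \<in> hcarrier E" using L(5)[OF x'(2), of b] by (simp add: x')
  show "ract E x 1 = x" by (simp add: x')
  show "ract E (ract E x a) b = ract E x (a * b)" by (simp add: x' bract_bract)
  show "ract E x (a + b) = hadd E (ract E x a) (ract E x b)" by (simp add: x' bract.add_right)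
  show "positive (hinner E x x)" using x' by (simp add: ip_positive LC)
  show "x = hzero E" if "hinner E x x = 0"
    using that norm_completion[OF LC[OF x'(2)]] by (simp add: x')
  assume y: "y \<in> hcarrier E"
  then obtain y' where y': "y = code y'" "y' \<in> L" by auto
  show "hadd E x y \<in> hcarrier E" using x' y' L(4) by simp
  show "hadd E x y = hadd E y x" by (simp add: add.commute)
  show "ract E (hadd E x y) b = hadd E (ract E x b) (ract E y b)" by (simp add: bract.add_left)
  show "hinner E x (ract E y b) = hinner E x y * b" using x' y' by (simp add: ip_bract LC)
  show "star (hinner E x y) = hinner E y x" using x' y' by (simp add: ip_star LC)
  assume z: "z \<in> hcarrier E"
  then obtain z' where z': "z = code z'" "z' \<in> L" by auto
  show "hadd E (hadd E x y) z = hadd E x (hadd E y z)" by (simp add: add.assoc)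
  show "hinner E x (hadd E y z) = hinner E x y + hinner E x z" using x' y' z' by (simp add: ip_add LC)
next
  note [simp] = E
  fix X :: "nat \<Rightarrow> 'b list \<Rightarrow> 'b"
  assume X: "\<forall>n. X n \<in> hcarrier E"
    and cauchy: "\<forall>\<epsilon>>0. \<exists>N. \<forall>m\<ge>N. \<forall>n\<ge>N. hnorm E (hdiff E (X m) (X n)) < \<epsilon>"
  have XL: "decode (X n) \<in> L" "code (decode (X n)) = X n" for n
    using X[rule_format, of n] by auto
  have norm: "hnorm E (hdiff E x y) = norm (decode x - decode y)" if "decode x \<in> L" "decode y \<in> L" for x y
  proof -
    have "decode x - decode y \<in> completion" using that L(1) by (intro completion_diff) auto
    then show ?thesis by (simp add: hnorm_def hdiff_def bract.minus_right norm_completion)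
  qed
  have "Cauchy (\<lambda>n. decode (X n))" using cauchy XL by (simp add: norm Cauchy_iff)
  then obtain l where l: "(\<lambda>n. decode (X n)) \<longlonglongrightarrow> l" by (auto simp: Cauchy_convergent_iff convergent_def)
  have lL: "l \<in> L" using closed_sequentially[OF L(2) _ l] XL by blast
  have "(\<lambda>n. norm (decode (X n) - l)) \<longlonglongrightarrow> 0" using l by (simp add: tendsto_norm_zero_iff LIM_zero_iff)
  then show "\<exists>x\<in>hcarrier E. (\<lambda>n. hnorm E (hdiff E (X n) x)) \<longlonglongrightarrow> 0"
    using lL XL by (intro bexI[of _ "code l"]) (simp_all add: norm)
qed

lemma ambient_hilbert: "hilbert_module ambient"
  by (rule hilbert_module_code[where L = completion])
    (auto simp: closed_completion completion_add completion_bract level_completion[OF level_zero])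

lemma level_corr_correspondence: "correspondence (level_corr t)"
proof -
  have h: "hilbert_module (level_corr t)"
    by (rule hilbert_module_code[where L = "level t"])
      (auto simp: closed_level level_add level_bract level_zero level_completion)
  have m: "mul 0 (base b) x \<in> level t" if "x \<in> level t" for b x
    using mul_in_level[OF base_level that] by simp
  note C = level_completion
  show ?thesis
  proof (rule correspondence.intro[OF h], unfold_locales)
    fix x y :: "'b list \<Rightarrow> 'b" and a b :: 'b and z
    assume "x \<in> hcarrier (level_corr t)"
    then obtain x' where x': "x = code x'" "x' \<in> level t" by auto
    show "lact (level_corr t) b x \<in> hcarrier (level_corr t)" using x' m by simp
    show "lact (level_corr t) 1 x = x" using x' by (simp add: mul_base_one C)
    show "lact (level_corr t) a (lact (level_corr t) b x) = lact (level_corr t) (a * b) x"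
      using x' mul_assoc[OF base_level base_level C, of x' t a b] by (simp add: mul_base_base)
    show "lact (level_corr t) (a + b) x = hadd (level_corr t) (lact (level_corr t) a x) (lact (level_corr t) b x)"
      using x' by (simp add: base_add mul_add_left base_level C)
    show "lact (level_corr t) (z *\<^sub>C b) x = ract (level_corr t) (lact (level_corr t) b x) (z *\<^sub>C 1)"
      using x' by (simp add: mul_base_scaleC C)
    show "lact (level_corr t) a (ract (level_corr t) x b) = ract (level_corr t) (lact (level_corr t) a x) b"
      using x' by (simp add: mul_bract base_level C)
    assume "y \<in> hcarrier (level_corr t)"
    then obtain y' where y': "y = code y'" "y' \<in> level t" by auto
    show "lact (level_corr t) b (hadd (level_corr t) x y) = hadd (level_corr t) (lact (level_corr t) b x) (lact (level_corr t) b y)"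
      using x' y' by (simp add: mul_add_right base_level C)
    show "hinner (level_corr t) (lact (level_corr t) b x) y = hinner (level_corr t) x (lact (level_corr t) (star b) y)"
      using x' y' by (simp add: mul_base_adjoint C)
  qed
qed

section \<open>The product as a unitary on the internal tensor product\<close>

definition pair_sum where
  "pair_sum s X = (\<Sum>(x, y)\<leftarrow>X. mul s (decode x) (decode y))"

definition word_system :: "('b list \<Rightarrow> 'b, 'b) prodsys" where
  "word_system = \<lparr>fibre = level_corr, base = (\<lambda>b. code (base b)),
     psu = (\<lambda>s t A. code (lim (\<lambda>n. pair_sum s (tensor_rep A n))))\<rparr>"

lemma word_system_simps [simp]:
  "fibre word_system = level_corr" "prodsys.base word_system = (\<lambda>b. code (base b))"
  "psu word_system s t A = code (lim (\<lambda>n. pair_sum s (tensor_rep A n)))"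
  by (simp_all add: word_system_def)

lemma pair_sum_simps [simp]: "pair_sum s [] = 0"
  "pair_sum s ((x, y) # X) = mul s (decode x) (decode y) + pair_sum s X"
  "pair_sum s (X @ Y) = pair_sum s X + pair_sum s Y"
  by (simp_all add: pair_sum_def)

context
  fixes s t :: real
begin

interpretation P: correspondence_tensor "level_corr s" "level_corr t"
  by (simp add: correspondence_tensor_def level_corr_correspondence)

abbreviation (input) "tensor_carrier \<equiv> code ` level s \<times> code ` level t"

lemma pair_sum_level: "set X \<subseteq> tensor_carrier \<Longrightarrow> pair_sum s X \<in> level (s + t)"
  by (induction X) (auto simp: level_zero intro!: level_add mul_in_level)

lemma pair_sum_in: "set X \<subseteq> tensor_carrier \<Longrightarrow> pair_sum s X \<in> completion"
  using pair_sum_level level_completion by blast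

lemma pair_sum_ract:
  "set X \<subseteq> tensor_carrier \<Longrightarrow> pair_sum s (map (\<lambda>(x, y). (x, ract (level_corr t) y b)) X) = bract (pair_sum s X) b"
  by (induction X) (auto simp: bract.add_left bract.zero_left mul_bract level_completion)

lemma pair_sum_lact:
  "set X \<subseteq> tensor_carrier \<Longrightarrow> pair_sum s (map (\<lambda>(x, y). (lact (level_corr s) b x, y)) X) = mul 0 (base b) (pair_sum s X)"
proof (induction X)
  case Nil
  have "mul 0 (base b) 0 = 0"
    using norm_mul_le[OF base_level level_completion[OF level_zero], of b] by simp
  then show ?case by simp
next
  case (Cons p X)
  then obtain x y where p: "p = (code x, code y)" "x \<in> level s" "y \<in> level t" by auto
  have "mul s (mul 0 (base b) x) y = mul 0 (base b) (mul s x y)"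
    using mul_assoc[OF base_level p(2) level_completion[OF p(3)], of b] by simp
  moreover have "mul s x y \<in> completion" using p level_completion mul_in by blast
  ultimately show ?case using Cons p by (simp add: mul_add_right base_level pair_sum_in)
qed

text \<open>By \<open>mul_inner\<close> the semi-inner product of formal tensors is the inner
  product of their values. Evaluation is therefore isometric, and limits of formal tensors can be
  followed on the values.\<close>

lemma pair_sum_inner:
  assumes "set X \<subseteq> tensor_carrier" "set Y \<subseteq> tensor_carrier"
  shows "ip (pair_sum s X) (pair_sum s Y) = fsum_inner (level_corr s) (level_corr t) X Y"
  using assms(1)
proof (induction X)
  case Nil
  have "ip (0 - 0) (pair_sum s Y) = 0"
    using pair_sum_in[OF assms(2)] level_completion[OF level_zero] by (subst ip_diff_left) auto
  then show ?case by (simp add: fsum_inner_def)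
next
  case (Cons p X)
  then obtain x y where p: "p = (code x, code y)" "x \<in> level s" "y \<in> level t" by auto
  have xy: "mul s x y \<in> completion" using p level_completion mul_in by blast
  have 1: "ip (mul s x y) (pair_sum s Y) = (\<Sum>(x', y')\<leftarrow>Y. ip y (mul 0 (base (ip x (decode x'))) (decode y')))"
    using assms(2)
  proof (induction Y)
    case Nil
    have "ip (mul s x y) (0 - 0) = 0" using xy level_completion[OF level_zero] by (subst ip_diff) auto
    then show ?case by simp
  next
    case (Cons q Y)
    then obtain x' y' where q: "q = (code x', code y')" "x' \<in> level s" "y' \<in> level t" by auto
    have "mul s x' y' \<in> completion" using q level_completion mul_in by blast
    then show ?case using Cons p q xy
      by (simp add: ip_add pair_sum_in mul_inner level_completion)
  qed
  have "star (ip (pair_sum s Y) (mul s x y + pair_sum s X)) = star (ip (pair_sum s Y) (mul s x y) + ip (pair_sum s Y) (pair_sum s X))"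
    using Cons xy assms(2) by (simp add: ip_add pair_sum_in)
  then have "ip (mul s x y + pair_sum s X) (pair_sum s Y) = ip (mul s x y) (pair_sum s Y) + ip (pair_sum s X) (pair_sum s Y)"
    using Cons xy assms(2) by (simp add: ip_star pair_sum_in star_add completion_add)
  then show ?case using Cons p by (simp add: 1) (simp add: fsum_inner_def)
qed

lemma norm_pair_sum_diff:
  assumes "set X \<subseteq> tensor_carrier" "set Y \<subseteq> tensor_carrier"
  shows "norm (P.T.emb X - P.T.emb Y) = norm (pair_sum s X - pair_sum s Y)"
proof -
  have assms': "X \<in> {X. set X \<subseteq> hcarrier (level_corr s) \<times> hcarrier (level_corr t)}"
    "Y \<in> {X. set X \<subseteq> hcarrier (level_corr s) \<times> hcarrier (level_corr t)}" using assms by simp_all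
  let ?Z = "X @ map (\<lambda>(x, y). (x, ract (level_corr t) y (- 1))) Y"
  have Z: "set ?Z \<subseteq> tensor_carrier"
    using assms P.T.add_in[of X "map (\<lambda>(x, y). (x, ract (level_corr t) y (- 1))) Y"] P.T.rm_in[of Y "- 1"] by simp
  have "norm (P.T.emb X - P.T.emb Y) = sqrt (norm (ip (pair_sum s ?Z) (pair_sum s ?Z)))"
    unfolding P.T.emb_diff[OF assms', symmetric] P.T.norm_emb[OF P.T.add_in[OF assms'(1) P.T.rm_in[OF assms'(2)]]]
      pair_sum_inner[OF Z Z] ..
  also have "\<dots> = norm (pair_sum s ?Z)" using pair_sum_in[OF Z] by (rule norm_completion[symmetric])
  also have "pair_sum s ?Z = pair_sum s X - pair_sum s Y"
    using pair_sum_ract[OF assms(2), of "-1"] by (simp add: bract.minus_right)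
  finally show ?thesis .
qed

text \<open>By isometry, a sequence whose values converge is Cauchy as a sequence of formal tensors,
  and the arbitrary representative behind \<open>psu\<close> yields the same limit.\<close>

lemma psu_class:
  assumes X: "\<And>n. set (X n) \<subseteq> tensor_carrier" "(\<lambda>n. pair_sum s (X n)) \<longlonglongrightarrow> z"
  shows "X \<in> tensor_cauchy (level_corr s) (level_corr t)"
    "psu word_system s t (tensor_class (level_corr s) (level_corr t) X) = code z"
    "\<And>n. set (tensor_rep (tensor_class (level_corr s) (level_corr t) X) n) \<subseteq> tensor_carrier"
    "(\<lambda>n. pair_sum s (tensor_rep (tensor_class (level_corr s) (level_corr t) X) n)) \<longlonglongrightarrow> z"
proof -
  have X': "\<And>n. set (X n) \<subseteq> hcarrier (level_corr s) \<times> hcarrier (level_corr t)" using X by simp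
  have "Cauchy (\<lambda>n. P.T.emb (X n))"
    using LIMSEQ_imp_Cauchy[OF X(2)] unfolding Cauchy_iff norm_pair_sum_diff[OF X(1) X(1)] .
  then obtain l where l: "(\<lambda>n. P.T.emb (X n)) \<longlonglongrightarrow> l" by (auto simp: Cauchy_convergent_iff convergent_def)
  show "X \<in> tensor_cauchy (level_corr s) (level_corr t)" by (rule P.tensor_cauchyI[OF X' l])
  let ?R = "tensor_rep (tensor_class (level_corr s) (level_corr t) X)"
  have R: "\<And>n. set (?R n) \<subseteq> tensor_carrier" "(\<lambda>n. P.T.emb (?R n)) \<longlonglongrightarrow> l"
    using P.tensor_rep_class[OF X' l] unfolding level_corr_simps(1) .
  show "set (?R n) \<subseteq> tensor_carrier" for n by (rule R)
  have "(\<lambda>n. P.T.emb (?R n) - P.T.emb (X n)) \<longlonglongrightarrow> 0" using tendsto_diff[OF R(2) l] by simp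
  then have "(\<lambda>n. norm (pair_sum s (?R n) - pair_sum s (X n))) \<longlonglongrightarrow> 0"
    unfolding norm_pair_sum_diff[OF R(1) X(1), symmetric] by (rule tendsto_norm_zero)
  then have "(\<lambda>n. pair_sum s (?R n) - pair_sum s (X n)) \<longlonglongrightarrow> 0" by (simp add: tendsto_norm_zero_iff)
  from tendsto_add[OF this X(2)] show lim: "(\<lambda>n. pair_sum s (?R n)) \<longlonglongrightarrow> z" by simp
  show "psu word_system s t (tensor_class (level_corr s) (level_corr t) X) = code z"
    by (simp add: limI[OF lim])
qed

lemma psu_rep:
  assumes "A \<in> hcarrier (internal_tensor (level_corr s) (level_corr t))"
  obtains z where "z \<in> level (s + t)" "psu word_system s t A = code z"
    "\<And>n. set (tensor_rep A n) \<subseteq> tensor_carrier" "(\<lambda>n. pair_sum s (tensor_rep A n)) \<longlonglongrightarrow> z"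
proof -
  obtain X where X: "X \<in> tensor_cauchy (level_corr s) (level_corr t)" "A = tensor_class (level_corr s) (level_corr t) X"
    using assms by (auto simp: internal_tensor_def)
  have cauchy: "Cauchy (\<lambda>n. P.T.emb (X n))" and "\<And>n. set (X n) \<subseteq> hcarrier (level_corr s) \<times> hcarrier (level_corr t)"
    using X(1) unfolding P.tensor_cauchy_iff by blast+
  then have XS: "\<And>n. set (X n) \<subseteq> tensor_carrier" by simp
  have "Cauchy (\<lambda>n. pair_sum s (X n))"
    using cauchy unfolding Cauchy_iff norm_pair_sum_diff[OF XS XS] .
  then obtain z where z: "(\<lambda>n. pair_sum s (X n)) \<longlonglongrightarrow> z" by (auto simp: Cauchy_convergent_iff convergent_def)
  have "z \<in> level (s + t)" by (rule closed_sequentially[OF closed_level pair_sum_level[OF XS] z])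
  then show ?thesis using that psu_class[OF XS z] X(2) by blast
qed

lemma psu_unitary:
  assumes "s \<ge> 0" "t \<ge> 0"
  shows "bilinear_unitary (internal_tensor (level_corr s) (level_corr t)) (level_corr (s + t)) (psu word_system s t)"
  unfolding bilinear_unitary_def bilinear_isometry_def right_isometry_def
proof (intro conjI ballI allI)
  let ?E = "internal_tensor (level_corr s) (level_corr t)"
  let ?u = "psu word_system s t"
  fix A assume A: "A \<in> hcarrier ?E"
  obtain x where x: "x \<in> level (s + t)" "?u A = code x" "\<And>n. set (tensor_rep A n) \<subseteq> tensor_carrier"
    "(\<lambda>n. pair_sum s (tensor_rep A n)) \<longlonglongrightarrow> x" using psu_rep[OF A] by blast
  show "?u A \<in> hcarrier (level_corr (s + t))" using x by simp
  fix b
  have "ract ?E A b = tensor_class (level_corr s) (level_corr t) (\<lambda>n. map (\<lambda>(x, y). (x, ract (level_corr t) y b)) (tensor_rep A n))"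
    by (simp add: internal_tensor_def)
  also have "?u \<dots> = code (bract x b)"
  proof (rule psu_class(2))
    show "set (map (\<lambda>(x, y). (x, ract (level_corr t) y b)) (tensor_rep A n)) \<subseteq> tensor_carrier" for n
      using P.T.rm_in[of "tensor_rep A n" b] x(3)[of n] by simp
    show "(\<lambda>n. pair_sum s (map (\<lambda>(x, y). (x, ract (level_corr t) y b)) (tensor_rep A n))) \<longlonglongrightarrow> bract x b"
      unfolding pair_sum_ract[OF x(3)] by (intro bract.tendsto x(4) tendsto_const)
  qed
  finally show "?u (ract ?E A b) = ract (level_corr (s + t)) (?u A) b" unfolding x(2) by simp
  have "lact ?E b A = tensor_class (level_corr s) (level_corr t) (\<lambda>n. map (\<lambda>(x, y). (lact (level_corr s) b x, y)) (tensor_rep A n))"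
    by (simp add: internal_tensor_def)
  also have "?u \<dots> = code (mul 0 (base b) x)"
  proof (rule psu_class(2))
    have "lact (level_corr s) b y \<in> code ` level s" if "y \<in> code ` level s" for y
      using mul_in_level[OF base_level, of _ s b] that by auto
    then show "set (map (\<lambda>(x, y). (lact (level_corr s) b x, y)) (tensor_rep A n)) \<subseteq> tensor_carrier" for n
      using x(3)[of n] unfolding subset_iff by fastforce
    show "(\<lambda>n. pair_sum s (map (\<lambda>(x, y). (lact (level_corr s) b x, y)) (tensor_rep A n))) \<longlonglongrightarrow> mul 0 (base b) x"
      unfolding pair_sum_lact[OF x(3)]
      by (rule mul_tendsto_filter[where \<sigma> = "\<lambda>_. 0"])
        (intro tendsto_const order_refl x(4) base_level level_completion[OF x(1)] always_eventually allI conjI pair_sum_in x(3))+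
  qed
  finally show "?u (lact ?E b A) = lact (level_corr (s + t)) b (?u A)" unfolding x(2) by simp
  fix B assume B: "B \<in> hcarrier ?E"
  obtain y where y: "y \<in> level (s + t)" "?u B = code y" "\<And>n. set (tensor_rep B n) \<subseteq> tensor_carrier"
    "(\<lambda>n. pair_sum s (tensor_rep B n)) \<longlonglongrightarrow> y" using psu_rep[OF B] by blast
  have "hadd ?E A B = tensor_class (level_corr s) (level_corr t) (\<lambda>n. tensor_rep A n @ tensor_rep B n)"
    by (simp add: internal_tensor_def)
  also have "?u \<dots> = code (x + y)"
    by (rule psu_class(2)) (use x y in \<open>auto intro: tendsto_add\<close>)
  finally show "?u (hadd ?E A B) = hadd (level_corr (s + t)) (?u A) (?u B)" unfolding x(2) y(2) by simp
  have "(\<lambda>n. ip (pair_sum s (tensor_rep A n)) (pair_sum s (tensor_rep B n))) \<longlonglongrightarrow> ip x y"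
    by (intro tendsto_ip x y level_completion[OF x(1)] level_completion[OF y(1)] always_eventually allI conjI pair_sum_in)
  then have "(\<lambda>n. fsum_inner (level_corr s) (level_corr t) (tensor_rep A n) (tensor_rep B n)) \<longlonglongrightarrow> ip x y"
    by (simp only: pair_sum_inner[OF x(3) y(3)])
  then have "hinner ?E A B = ip x y" by (simp add: internal_tensor_def limI)
  then show "hinner (level_corr (s + t)) (?u A) (?u B) = hinner ?E A B" unfolding x(2) y(2) by simp
next
  let ?E = "internal_tensor (level_corr s) (level_corr t)"
  let ?u = "psu word_system s t"
  show "?u ` hcarrier ?E = hcarrier (level_corr (s + t))"
  proof
    show "?u ` hcarrier ?E \<subseteq> hcarrier (level_corr (s + t))"
    proof
      fix w assume "w \<in> ?u ` hcarrier ?E"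
      then obtain A where A: "A \<in> hcarrier ?E" "w = ?u A" by blast
      obtain z where "z \<in> level (s + t)" "?u A = code z" by (rule psu_rep[OF A(1)]) (rule that)
      then show "w \<in> hcarrier (level_corr (s + t))" unfolding A(2) by simp
    qed
    \<comment> \<open>Surjectivity: approximating sums are cut at time s into sums of products, and
      these form a Cauchy sequence of formal tensors.\<close>
    show "hcarrier (level_corr (s + t)) \<subseteq> ?u ` hcarrier ?E"
    proof
      fix w assume "w \<in> hcarrier (level_corr (s + t))"
      then obtain z where z: "w = code z" "z \<in> level (s + t)" by auto
      obtain Z where Z: "\<And>n. Z n \<in> combs_at (s + t)" "(\<lambda>n. emb (Z n)) \<longlonglongrightarrow> z" using level_obtain[OF z(2)] by blast
      have "\<exists>X. set X \<subseteq> tensor_carrier \<and> pair_sum s X = emb (Z n)" for n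
      proof -
        obtain X where X: "set X \<subseteq> level s \<times> level t" "emb (Z n) = (\<Sum>(x, y)\<leftarrow>X. mul s x y)"
          using level_product_dense[OF Z(1) assms] by blast
        have "pair_sum s (map (\<lambda>(x, y). (code x, code y)) X) = (\<Sum>(x, y)\<leftarrow>X. mul s x y)"
          by (induction X) auto
        then show ?thesis using X by (intro exI[of _ "map (\<lambda>(x, y). (code x, code y)) X"]) auto
      qed
      then have "\<exists>X. \<forall>n. set (X n) \<subseteq> tensor_carrier \<and> pair_sum s (X n) = emb (Z n)" by (intro choice) blast
      then obtain X where X: "\<And>n. set (X n) \<subseteq> tensor_carrier" "\<And>n. pair_sum s (X n) = emb (Z n)" by blast
      have lim: "(\<lambda>n. pair_sum s (X n)) \<longlonglongrightarrow> z" unfolding X(2) by (rule Z(2))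
      have "tensor_class (level_corr s) (level_corr t) X \<in> hcarrier ?E"
        using psu_class(1)[OF X(1) lim] by (simp add: internal_tensor_def)
      moreover have "w = ?u (tensor_class (level_corr s) (level_corr t) X)"
        unfolding z(1) by (rule psu_class(2)[OF X(1) lim, symmetric])
      ultimately show "w \<in> ?u ` hcarrier ?E" by blast
    qed
  qed
qed

lemma psmult_word_system:
  assumes "x \<in> level s" "y \<in> level t"
  shows "psmult word_system s t (code x) (code y) = code (mul s x y)"
  unfolding psmult_def elem_tensor_def word_system_simps(1)
  by (rule psu_class(2)) (use assms in auto)

end

lemma product_system_word_system: "product_system word_system"
  unfolding product_system_def
proof (intro conjI allI impI ballI)
  fix t :: real
  show "correspondence (fibre word_system t)" by (simp add: level_corr_correspondence)
next
  fix s t :: real assume "s \<ge> 0" "t \<ge> 0"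
  then show "bilinear_unitary (internal_tensor (fibre word_system s) (fibre word_system t)) (fibre word_system (s + t)) (psu word_system s t)"
    using psu_unitary by simp
next
  fix r s t :: real and x y z
  assume "x \<in> hcarrier (fibre word_system r)" "y \<in> hcarrier (fibre word_system s)" "z \<in> hcarrier (fibre word_system t)"
  then obtain x' y' z' where xyz: "x = code x'" "y = code y'" "z = code z'" "x' \<in> level r" "y' \<in> level s" "z' \<in> level t"
    by auto
  show "psmult word_system (r + s) t (psmult word_system r s x y) z = psmult word_system r (s + t) x (psmult word_system s t y z)"
    using xyz by (simp add: psmult_word_system mul_in_level mul_assoc level_completion)
next
  have "code ` base ` UNIV = code ` level 0" using base_level level_0 by blast
  then show "bilinear_unitary self_corr (fibre word_system 0) (prodsys.base word_system)"
    unfolding bilinear_unitary_def bilinear_isometry_def right_isometry_def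
    by (auto simp: self_corr_def base_level base_add bract_base ip_base mul_base_base image_image)
next
  fix t :: real and x b assume "x \<in> hcarrier (fibre word_system t)"
  then obtain x' where x: "x = code x'" "x' \<in> level t" by auto
  show "psmult word_system 0 t (prodsys.base word_system b) x = lact (fibre word_system t) b x"
    using x by (simp add: psmult_word_system base_level)
  show "psmult word_system t 0 x (prodsys.base word_system b) = ract (fibre word_system t) x b"
    using x by (simp add: psmult_word_system base_level mul_base_right)
qed

section \<open>The continuous structure of the word system\<close>

lemma norm_continuous_ambient:
  assumes "\<And>p. p \<in> A \<Longrightarrow> f p \<in> code ` completion"
  shows "norm_continuous_on ambient A f \<longleftrightarrow> continuous_on A (\<lambda>p. decode (f p))"
  unfolding norm_continuous_on_def continuous_on_def
proof (rule ball_cong[OF refl])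
  fix p assume p: "p \<in> A"
  have norm: "hnorm ambient (hdiff ambient (f q) (f p)) = norm (decode (f q) - decode (f p))" if "q \<in> A" for q
  proof -
    have "decode (f q) - decode (f p) \<in> completion" using assms[OF p] assms[OF that] by (auto intro: completion_diff)
    then show ?thesis by (simp add: hnorm_def hdiff_def bract.minus_right norm_completion)
  qed
  have "((\<lambda>q. hnorm ambient (hdiff ambient (f q) (f p))) \<longlongrightarrow> 0) (at p within A)
      \<longleftrightarrow> ((\<lambda>q. norm (decode (f q) - decode (f p))) \<longlongrightarrow> 0) (at p within A)"
    using norm by (intro tendsto_cong) (auto simp: eventually_at_filter)
  also have "\<dots> \<longleftrightarrow> ((\<lambda>q. decode (f q)) \<longlongrightarrow> decode (f p)) (at p within A)"
    by (simp add: tendsto_norm_zero_iff LIM_zero_iff)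
  finally show "((\<lambda>q. hnorm ambient (hdiff ambient (f q) (f p))) \<longlongrightarrow> 0) (at p within A)
      \<longleftrightarrow> ((\<lambda>q. decode (f q)) \<longlongrightarrow> decode (f p)) (at p within A)" .
qed

lemma cont_sections_iff:
  "x \<in> cont_sections word_system ambient (\<lambda>t y. y) \<longleftrightarrow>
    (\<forall>t\<ge>0. x t \<in> code ` level t) \<and> continuous_on {0..} (\<lambda>t. decode (x t))"
proof -
  have "norm_continuous_on ambient {0..} x \<longleftrightarrow> continuous_on {0..} (\<lambda>t. decode (x t))"
    if "\<forall>t\<ge>0. x t \<in> code ` level t"
    using that level_completion by (intro norm_continuous_ambient) fastforce
  then show ?thesis unfolding cont_sections_def by auto
qed

lemma continuous_word_system: "continuous_product_system word_system ambient (\<lambda>t y. y)"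
  unfolding continuous_product_system_def
proof (intro conjI allI impI ballI)
  show "product_system word_system" by (rule product_system_word_system)
  show "hilbert_module ambient" by (rule ambient_hilbert)
  show "right_isometry (fibre word_system t) ambient (\<lambda>y. y)" for t
    unfolding right_isometry_def by (auto intro: level_completion)
next
  fix s :: real and y assume s: "s \<ge> 0" and "y \<in> hcarrier (fibre word_system s)"
  then obtain y' where y: "y = code y'" "y' \<in> level s" by auto
  obtain x where "continuous_on {0..} x" "\<forall>t\<ge>0. x t \<in> level t" "x s = y'" using section_exists[OF s y(2)] by blast
  then show "\<exists>x\<in>cont_sections word_system ambient (\<lambda>t y. y). x s = y"
    by (intro bexI[of _ "\<lambda>t. code (x t)"]) (auto simp: cont_sections_iff y)
next
  fix x y assume x: "x \<in> cont_sections word_system ambient (\<lambda>t y. y)" and y: "y \<in> cont_sections word_system ambient (\<lambda>t y. y)"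
  have xl: "decode (x t) \<in> level t" "code (decode (x t)) = x t" and yl: "decode (y t) \<in> level t" "code (decode (y t)) = y t"
    if "t \<ge> 0" for t using x y that by (auto simp: cont_sections_iff)
  have xc: "continuous_on {0..} (\<lambda>t. decode (x t))" and yc: "continuous_on {0..} (\<lambda>t. decode (y t))"
    using x y by (auto simp: cont_sections_iff)
  have m: "psmult word_system s t (x s) (y t) = code (mul s (decode (x s)) (decode (y t)))" if "s \<ge> 0" "t \<ge> 0" for s t
    using psmult_word_system[OF xl(1) yl(1)] xl(2) yl(2) that by metis
  let ?A = "{0..} \<times> {0..} :: (real \<times> real) set"
  have "continuous_on ?A (\<lambda>p. mul (fst p) (decode (x (fst p))) (decode (y (snd p))))"
    by (rule mul_continuous[where f = "\<lambda>p. decode (x (fst p))" and g = "\<lambda>p. decode (y (snd p))" and \<sigma> = fst])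
      (auto intro!: continuous_intros continuous_on_compose2[OF xc] continuous_on_compose2[OF yc] xl yl level_completion[OF yl(1)])
  then have "continuous_on ?A (\<lambda>p. decode (case p of (s, t) \<Rightarrow> psmult word_system s t (x s) (y t)))"
    by (rule continuous_on_eq) (auto simp: m)
  moreover have "(case p of (s, t) \<Rightarrow> psmult word_system s t (x s) (y t)) \<in> code ` completion" if "p \<in> ?A" for p
    using that by (auto simp: m intro!: imageI mul_in[OF xl(1) level_completion[OF yl(1)]])
  ultimately show "norm_continuous_on ambient ?A (\<lambda>(s, t). psmult word_system s t (x s) (y t))"
    by (subst norm_continuous_ambient)
  fix b
  have "continuous_on {0..} (\<lambda>t. ip (decode (x t)) (mul 0 (base b) (decode (y t))))"
    by (intro ip_continuous lact_continuous xc yc)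
      (auto intro!: level_completion[OF xl(1)] level_completion[OF yl(1)] mul_in[OF base_level])
  then show "continuous_on {0..} (\<lambda>t. hinner (fibre word_system t) (x t) (lact (fibre word_system t) b (y t)))"
    by simp
qed

theorem spatial_word_system: "continuous_spatial_product_system word_system ambient (\<lambda>t y. y)"
  unfolding continuous_spatial_product_system_def
proof (intro conjI bexI)
  \<comment> \<open>In the completion \<omega> is constant, so it is a continuous section.\<close>
  let ?\<omega> = "\<lambda>t::real. code (base 1)"
  show "?\<omega> \<in> cont_sections word_system ambient (\<lambda>t y. y)"
    by (simp add: cont_sections_iff base_level' imageI)
  have "ps_unit word_system ?\<omega>"
    unfolding ps_unit_def by (simp add: base_level' psmult_word_system bract_one_level)
  then show "central_unit word_system ?\<omega>" "unital_unit word_system ?\<omega>"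
    by (auto simp: central_unit_def unital_unit_def mul_base_right base_level bract_base ip_base)
qed (rule continuous_word_system)

end

section \<open>Embedding the GNS-system\<close>

lemma product_system_correspondence: "product_system P \<Longrightarrow> t \<ge> 0 \<Longrightarrow> correspondence (fibre P t)"
  by (simp add: product_system_def)

lemma psmult_assoc:
  "\<lbrakk>product_system P; r \<ge> 0; s \<ge> 0; t \<ge> 0; x \<in> hcarrier (fibre P r); y \<in> hcarrier (fibre P s); z \<in> hcarrier (fibre P t)\<rbrakk>
    \<Longrightarrow> psmult P (r + s) t (psmult P r s x y) z = psmult P r (s + t) x (psmult P s t y z)"
  by (simp add: product_system_def)

lemma psmult_base:
  assumes "product_system P" "t \<ge> 0" "x \<in> hcarrier (fibre P t)"
  shows "psmult P 0 t (prodsys.base P b) x = lact (fibre P t) b x"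
    "psmult P t 0 x (prodsys.base P b) = ract (fibre P t) x b"
  using assms by (simp_all add: product_system_def)

lemma product_system_base:
  assumes "product_system P"
  shows "prodsys.base P b \<in> hcarrier (fibre P 0)"
    "x \<in> hcarrier (fibre P 0) \<Longrightarrow> \<exists>b. x = prodsys.base P b"
    "lact (fibre P 0) a (prodsys.base P b) = prodsys.base P (a * b)"
    "ract (fibre P 0) (prodsys.base P b) a = prodsys.base P (b * a)"
    "hinner (fibre P 0) (prodsys.base P a) (prodsys.base P b) = star a * b"
proof -
  have u: "bilinear_unitary self_corr (fibre P 0) (prodsys.base P)" using assms by (simp add: product_system_def)
  then have "prodsys.base P ` UNIV = hcarrier (fibre P 0)" by (simp add: bilinear_unitary_def self_corr_def)
  then show "prodsys.base P b \<in> hcarrier (fibre P 0)"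
    "x \<in> hcarrier (fibre P 0) \<Longrightarrow> \<exists>b. x = prodsys.base P b" by auto
  have "\<forall>x b. prodsys.base P (b * x) = lact (fibre P 0) b (prodsys.base P x)"
    using u by (simp add: bilinear_unitary_def bilinear_isometry_def self_corr_def)
  then show "lact (fibre P 0) a (prodsys.base P b) = prodsys.base P (a * b)" by simp
  have "\<forall>x b. prodsys.base P (x * b) = ract (fibre P 0) (prodsys.base P x) b"
    using u by (simp add: bilinear_unitary_def bilinear_isometry_def right_isometry_def self_corr_def)
  then show "ract (fibre P 0) (prodsys.base P b) a = prodsys.base P (b * a)" by simp
  show "hinner (fibre P 0) (prodsys.base P a) (prodsys.base P b) = star a * b"
    using u by (simp_all add: bilinear_unitary_def bilinear_isometry_def right_isometry_def self_corr_def)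
qed

text \<open>The left action of a is the product with the element a of the fibre at 0, so this is an
  instance of associativity.\<close>

lemma lact_psmult:
  assumes P: "product_system P" and st: "s \<ge> 0" "t \<ge> 0" and x: "x \<in> hcarrier (fibre P s)" and y: "y \<in> hcarrier (fibre P t)"
  shows "lact (fibre P (s + t)) a (psmult P s t x y) = psmult P s t (lact (fibre P s) a x) y"
  using psmult_assoc[OF P _ st product_system_base(1)[OF P] x y, of a] st
    psmult_base(1)[OF P st(1) x] psmult_base(1)[OF P _ psmult_closed[OF P st x y]] by simp

lemma ract_psmult:
  assumes P: "product_system P" and st: "s \<ge> 0" "t \<ge> 0" and x: "x \<in> hcarrier (fibre P s)" and y: "y \<in> hcarrier (fibre P t)"
  shows "ract (fibre P (s + t)) (psmult P s t x y) a = psmult P s t x (ract (fibre P t) y a)"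
  using psmult_assoc[OF P st _ x y product_system_base(1)[OF P], of a] st
    psmult_base(2)[OF P st(2) y] psmult_base(2)[OF P _ psmult_closed[OF P st x y]] by simp

locale spatial_gns = spatial_cp T c
  for T :: "real \<Rightarrow> 'b::cstar_algebra \<Rightarrow> 'b" and c :: "real \<Rightarrow> 'b" +
  fixes P :: "('e, 'b) prodsys" and \<xi> :: "real \<Rightarrow> 'e"
  assumes gns: "gns_system T P \<xi>"
begin

lemma ps: "product_system P" using gns by (simp add: gns_system_def)

lemma corr: "t \<ge> 0 \<Longrightarrow> correspondence (fibre P t)"
  by (rule product_system_correspondence[OF ps])

lemma \<xi>_in: "t \<ge> 0 \<Longrightarrow> \<xi> t \<in> hcarrier (fibre P t)"
  and \<xi>_mult: "s \<ge> 0 \<Longrightarrow> t \<ge> 0 \<Longrightarrow> psmult P s t (\<xi> s) (\<xi> t) = \<xi> (s + t)"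
  and \<xi>_0: "\<xi> 0 = prodsys.base P 1"
  and \<xi>_inner: "t \<ge> 0 \<Longrightarrow> hinner (fibre P t) (\<xi> t) (lact (fibre P t) b (\<xi> t)) = T t b"
  using gns by (simp_all add: gns_system_def ps_unit_def)

lemma lact_\<xi>_in: "t \<ge> 0 \<Longrightarrow> lact (fibre P t) x (\<xi> t) \<in> hcarrier (fibre P t)"
  using correspondence.lact_closed[OF corr \<xi>_in] .

section \<open>Words in the unit \<xi> of the GNS-system\<close>

abbreviation "total_time w \<equiv> sum_list (map snd w)"

definition nonneg_word :: "('b \<times> real) list \<Rightarrow> bool" where
  "nonneg_word w \<longleftrightarrow> (\<forall>p\<in>set w. snd p \<ge> 0)"

definition colour :: "('b \<times> real) list \<Rightarrow> ('b \<times> bool \<times> real) list" where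
  "colour w = map (\<lambda>(b, t). (b, True, t)) w"

lemma nonneg_word_simps [simp]: "nonneg_word []" "nonneg_word ((x, s) # w) \<longleftrightarrow> s \<ge> 0 \<and> nonneg_word w"
  "nonneg_word (u @ w) \<longleftrightarrow> nonneg_word u \<and> nonneg_word w"
  by (auto simp: nonneg_word_def)

lemma colour_simps [simp]: "colour [] = []" "colour ((x, s) # w) = (x, True, s) # colour w"
  "colour (u @ w) = colour u @ colour w"
  by (auto simp: colour_def)

lemma total_nonneg: "nonneg_word w \<Longrightarrow> total_time w \<ge> 0"
  by (induction w) auto

lemma valid_colour: "valid (colour w) \<longleftrightarrow> nonneg_word w"
  by (induction w) auto

lemma duration_colour: "duration (colour w) = total_time w"
  by (induction w) auto

lemma unit_word_in: "nonneg_word w \<Longrightarrow> unit_word P \<xi> b w \<in> hcarrier (fibre P (total_time w))"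
proof (induction w)
  case Nil
  then show ?case by (simp add: product_system_base(1)[OF ps])
next
  case (Cons p w)
  then show ?case
    by (cases p) (auto intro!: psmult_closed[OF ps] lact_\<xi>_in total_nonneg)
qed

lemma unit_word_zero:
  assumes "nonneg_word w"
  shows "unit_word P \<xi> b ((x, 0) # w) = lact (fibre P (total_time w)) x (unit_word P \<xi> b w)"
  using assms by (simp add: \<xi>_0 product_system_base(3)[OF ps] psmult_base[OF ps total_nonneg unit_word_in])

lemma unit_word_split:
  assumes "0 \<le> s" "s \<le> s'" "nonneg_word w"
  shows "unit_word P \<xi> b ((x, s') # w) =
    psmult P s (s' - s + total_time w) (lact (fibre P s) x (\<xi> s)) (unit_word P \<xi> b ((1, s' - s) # w))"
proof -
  have d: "0 \<le> s' - s" using assms by simp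
  have "lact (fibre P s') x (\<xi> s') = lact (fibre P (s + (s' - s))) x (psmult P s (s' - s) (\<xi> s) (\<xi> (s' - s)))"
    using assms d by (simp add: \<xi>_mult)
  also have "\<dots> = psmult P s (s' - s) (lact (fibre P s) x (\<xi> s)) (\<xi> (s' - s))"
    using assms d by (intro lact_psmult[OF ps] \<xi>_in)
  finally have "unit_word P \<xi> b ((x, s') # w) =
      psmult P (s + (s' - s)) (total_time w) (psmult P s (s' - s) (lact (fibre P s) x (\<xi> s)) (\<xi> (s' - s))) (unit_word P \<xi> b w)"
    by simp
  also have "\<dots> = psmult P s (s' - s + total_time w) (lact (fibre P s) x (\<xi> s))
      (psmult P (s' - s) (total_time w) (\<xi> (s' - s)) (unit_word P \<xi> b w))"
    using assms d by (intro psmult_assoc[OF ps] lact_\<xi>_in \<xi>_in unit_word_in total_nonneg)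
  also have "psmult P (s' - s) (total_time w) (\<xi> (s' - s)) (unit_word P \<xi> b w) = unit_word P \<xi> b ((1, s' - s) # w)"
    using d by (simp add: correspondence.lact_one[OF corr \<xi>_in])
  finally show ?thesis .
qed

text \<open>The right coefficient of u survives as a letter of duration 0 between the two
  words.\<close>

lemma unit_word_append:
  assumes "nonneg_word u" "nonneg_word w"
  shows "psmult P (total_time u) (total_time w) (unit_word P \<xi> b u) (unit_word P \<xi> d w) = unit_word P \<xi> d (u @ (b, 0) # w)"
  using assms(1)
proof (induction u)
  case Nil
  show ?case unfolding append_Nil unit_word_zero[OF assms(2)]
    by (simp add: psmult_base(1)[OF ps total_nonneg[OF assms(2)] unit_word_in[OF assms(2)]])
next
  case (Cons p u)
  obtain x s where p: "p = (x, s)" by (cases p)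
  then show ?case using Cons assms(2)
    by (simp add: psmult_assoc[OF ps] total_nonneg unit_word_in lact_\<xi>_in del: unit_word.simps(1))
qed

lemma unit_word_ract:
  "nonneg_word w \<Longrightarrow> ract (fibre P (total_time w)) (unit_word P \<xi> b w) a = unit_word P \<xi> (b * a) w"
proof (induction w)
  case Nil
  then show ?case by (simp add: product_system_base(4)[OF ps])
next
  case (Cons p w)
  then show ?case
    by (cases p) (simp add: ract_psmult[OF ps] total_nonneg unit_word_in lact_\<xi>_in)
qed

lemma unit_word_inner_step:
  assumes "s \<ge> 0" "r \<ge> 0" "Y \<in> hcarrier (fibre P r)" "Y' \<in> hcarrier (fibre P r)"
  shows "hinner (fibre P (s + r)) (psmult P s r (lact (fibre P s) x (\<xi> s)) Y)
      (lact (fibre P (s + r)) a (psmult P s r (lact (fibre P s) x' (\<xi> s)) Y'))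
    = hinner (fibre P r) Y (lact (fibre P r) (T s (star x * a * x')) Y')"
proof -
  interpret s: correspondence "fibre P s" using assms by (intro corr)
  have "hinner (fibre P s) (lact (fibre P s) x (\<xi> s)) (lact (fibre P s) a (lact (fibre P s) x' (\<xi> s)))
      = T s (star x * a * x')"
    using assms(1) by (simp add: s.lact_adjoint s.lact_lact s.lact_closed \<xi>_in \<xi>_inner mult.assoc)
  then show ?thesis using assms
    by (simp add: lact_psmult[OF ps] lact_\<xi>_in psmult_inner[OF ps] s.lact_closed)
qed

text \<open>The unit and the inner product formula for products force the recursion of
  \<open>kern\<close>: the shorter leading duration is stripped, after the longer letter has been
  cut. Uniqueness of the GNS-system rests on this: its inner products are those of the words in
  \<xi>.\<close>

lemma unit_word_inner:
  assumes "nonneg_word w" "nonneg_word w'" "total_time w = total_time w'"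
  shows "hinner (fibre P (total_time w)) (unit_word P \<xi> b w) (lact (fibre P (total_time w)) a (unit_word P \<xi> b' w'))
    = star b * kern (colour w) (colour w') a * b'"
  using assms
proof (induction "length w + length w'" arbitrary: w w' a rule: less_induct)
  case less
  consider "w = []" "w' = []" | x' s' w1' where "w = []" "w' = (x', s') # w1'"
    | x s w1 where "w = (x, s) # w1" "w' = []" | x s w1 x' s' w1' where "w = (x, s) # w1" "w' = (x', s') # w1'"
    by (cases w; cases w') auto
  then show ?case
  proof cases
    case 1
    then show ?thesis by (simp add: product_system_base[OF ps] mult.assoc)
  next
    case 2
    then have z: "s' = 0" "nonneg_word w1'" "total_time w1' = 0" using less.prems total_nonneg[of w1'] by auto
    interpret t: correspondence "fibre P 0" by (rule corr) simp
    have "unit_word P \<xi> b' w' = lact (fibre P 0) x' (unit_word P \<xi> b' w1')"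
      using unit_word_zero[OF z(2)] by (simp only: 2 z(1,3))
    then show ?thesis
      using less.hyps[of w w1' "a * x'"] less.prems z 2 unit_word_in[OF z(2), of b']
      by (simp add: t.lact_lact)
  next
    case 3
    then have z: "s = 0" "nonneg_word w1" "total_time w1 = 0" using less.prems total_nonneg[of w1] by auto
    interpret t: correspondence "fibre P 0" by (rule corr) simp
    have "unit_word P \<xi> b w = lact (fibre P 0) x (unit_word P \<xi> b w1)"
      using unit_word_zero[OF z(2)] by (simp only: 3 z(1,3))
    then show ?thesis
      using less.hyps[of w1 w' "star x * a"] less.prems z 3 unit_word_in[OF z(2), of b]
      by (simp add: t.lact_lact t.lact_adjoint product_system_base(1)[OF ps] t.lact_closed)
  next
    case 4
    have n: "s \<ge> 0" "s' \<ge> 0" "nonneg_word w1" "nonneg_word w1'" "s + total_time w1 = s' + total_time w1'"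
      using less.prems 4 by auto
    note tot = total_nonneg[OF n(3)] total_nonneg[OF n(4)]
    note inw = unit_word_in[OF n(3), of b] unit_word_in[OF n(4), of b']
    consider "s = s'" | "s < s'" | "s > s'" by linarith
    then show ?thesis
    proof cases
      case 1
      then have e: "total_time w1' = total_time w1" using n by simp
      show ?thesis
        using unit_word_inner_step[OF n(1) tot(1) inw(1), of "unit_word P \<xi> b' w1'" x a x']
          less.hyps[of w1 w1' "T s (star x * a * x')"] n inw 4 1 e
        by (simp add: transfer_def)
    next
      case 2
      have e: "s' - s + total_time w1' = total_time w1" using n by simp
      have n': "nonneg_word ((1, s' - s) # w1')" using n 2 by simp
      define V where "V = unit_word P \<xi> b' ((1, s' - s) # w1')"
      have w': "unit_word P \<xi> b' w' = psmult P s (total_time w1) (lact (fibre P s) x' (\<xi> s)) V"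
        using unit_word_split[OF n(1) less_imp_le[OF 2] n(4), of b' x'] by (simp only: 4 e V_def)
      have V: "V \<in> hcarrier (fibre P (total_time w1))"
        using unit_word_in[OF n', of b'] e by (simp add: V_def)
      have w: "total_time w = s + total_time w1"
          "unit_word P \<xi> b w = psmult P s (total_time w1) (lact (fibre P s) x (\<xi> s)) (unit_word P \<xi> b w1)"
        by (simp_all add: 4)
      have "hinner (fibre P (total_time w1)) (unit_word P \<xi> b w1) (lact (fibre P (total_time w1)) (T s (star x * a * x')) V)
          = star b * kern (colour w1) (colour ((1, s' - s) # w1')) (T s (star x * a * x')) * b'"
        unfolding V_def using n n' e 4 by (intro less.hyps) simp_all
      then show ?thesis
        unfolding w w' unit_word_inner_step[OF n(1) tot(1) inw(1) V] using 4 2 by (simp add: transfer_def)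
    next
      case 3
      have e: "s - s' + total_time w1 = total_time w1'" using n by simp
      have n': "nonneg_word ((1, s - s') # w1)" using n 3 by simp
      define V where "V = unit_word P \<xi> b ((1, s - s') # w1)"
      have w: "unit_word P \<xi> b w = psmult P s' (total_time w1') (lact (fibre P s') x (\<xi> s')) V"
        using unit_word_split[OF n(2) less_imp_le[OF 3] n(3), of b x] by (simp only: 4 e V_def)
      have V: "V \<in> hcarrier (fibre P (total_time w1'))"
        using unit_word_in[OF n', of b] e by (simp add: V_def)
      have w': "total_time w = s' + total_time w1'"
          "unit_word P \<xi> b' w' = psmult P s' (total_time w1') (lact (fibre P s') x' (\<xi> s')) (unit_word P \<xi> b' w1')"
        using n by (simp_all add: 4)
      have h: "total_time ((1, s - s') # w1) = total_time w1'" using e by simp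
      have "hinner (fibre P (total_time ((1, s - s') # w1))) V
          (lact (fibre P (total_time ((1, s - s') # w1))) (T s' (star x * a * x')) (unit_word P \<xi> b' w1'))
          = star b * kern (colour ((1, s - s') # w1)) (colour w1') (T s' (star x * a * x')) * b'"
        unfolding V_def using n n' e 4 by (intro less.hyps) simp_all
      then show ?thesis
        unfolding h w w' unit_word_inner_step[OF n(2) tot(2) V inw(2)] using 4 3 by (simp add: transfer_def)
    qed
  qed
qed

section \<open>Formal sums and their two realisations\<close>

definition gns_combs :: "real \<Rightarrow> (('b \<times> real) list \<times> 'b) list set" where
  "gns_combs t = {U. \<forall>(w, b)\<in>set U. nonneg_word w \<and> total_time w = t}"

definition conv :: "(('b \<times> real) list \<times> 'b) list \<Rightarrow> (('b \<times> bool \<times> real) list \<times> 'b) list" where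
  "conv U = map (\<lambda>(w, b). (colour w, b)) U"

text \<open>A formal sum is realised in the given fibre by \<open>vec\<close> and, through
  \<open>conv\<close>, in the module of words.\<close>

primrec vec :: "real \<Rightarrow> (('b \<times> real) list \<times> 'b) list \<Rightarrow> 'e" where
  "vec t [] = hzero (fibre P t)"
| "vec t (p # U) = hadd (fibre P t) (unit_word P \<xi> (snd p) (fst p)) (vec t U)"

definition emb_fibre where
  "emb_fibre t = semi_module.emb (hcarrier (fibre P t)) (hinner (fibre P t))"

lemma gns_combs_simps [simp]: "[] \<in> gns_combs t"
  "(w, b) # U \<in> gns_combs t \<longleftrightarrow> nonneg_word w \<and> total_time w = t \<and> U \<in> gns_combs t"
  "U @ V \<in> gns_combs t \<longleftrightarrow> U \<in> gns_combs t \<and> V \<in> gns_combs t"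
  by (auto simp: gns_combs_def)

lemma conv_simps [simp]: "conv [] = []" "conv ((w, b) # U) = (colour w, b) # conv U" "conv (U @ V) = conv U @ conv V"
  by (auto simp: conv_def)

lemma conv_in: "U \<in> gns_combs t \<Longrightarrow> conv U \<in> combs_at t" "U \<in> gns_combs t \<Longrightarrow> conv U \<in> combs"
  by (induction U) (auto simp: valid_colour duration_colour)

lemma vec_in: "t \<ge> 0 \<Longrightarrow> U \<in> gns_combs t \<Longrightarrow> vec t U \<in> hcarrier (fibre P t)"
proof (induction U)
  case Nil
  interpret t: correspondence "fibre P t" by (rule corr[OF Nil(1)])
  show ?case by (simp add: t.zero_closed)
next
  case (Cons p U)
  interpret t: correspondence "fibre P t" by (rule corr[OF Cons.prems(1)])
  obtain w b where p: "p = (w, b)" by (cases p)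
  have w: "nonneg_word w" "total_time w = t" "U \<in> gns_combs t" using Cons.prems p by auto
  show ?case unfolding p vec.simps fst_conv snd_conv
    using Cons.IH[OF Cons.prems(1) w(3)] unit_word_in[OF w(1), of b] w(2) by (intro t.add_closed) simp_all
qed

lemma vec_inner:
  assumes t: "t \<ge> 0" and U: "U \<in> gns_combs t" and V: "V \<in> gns_combs t"
  shows "hinner (fibre P t) (vec t U) (lact (fibre P t) a (vec t V)) = comb_inner a (conv U) (conv V)"
proof -
  interpret t: correspondence "fibre P t" by (rule corr[OF t])
  have lz: "lact (fibre P t) a (hzero (fibre P t)) = hzero (fibre P t)"
    using t.norm_lact_le[OF t.zero_closed, of a] by (intro t.emb_eq_zero t.lact_closed t.zero_closed) (simp add: t.emb_zero)
  have z: "hinner (fibre P t) x (hzero (fibre P t)) = 0" "hinner (fibre P t) (hzero (fibre P t)) x = 0"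
    if "x \<in> hcarrier (fibre P t)" for x
    using t.norm_Q_le[OF that t.zero_closed] t.norm_Q_le[OF t.zero_closed that] by (simp_all add: t.emb_zero)
  have 1: "hinner (fibre P t) (unit_word P \<xi> b w) (lact (fibre P t) a (vec t V)) = comb_inner a [(colour w, b)] (conv V)"
    if w: "nonneg_word w" "total_time w = t" for w b
    using V
  proof (induction V)
    case Nil
    then show ?case using unit_word_in[OF w(1), of b] w(2) by (simp add: lz z)
  next
    case (Cons p V)
    obtain w' d where p: "p = (w', d)" by (cases p)
    have w': "nonneg_word w'" "total_time w' = t" "V \<in> gns_combs t" using Cons.prems p by auto
    show ?case
      using Cons.IH[OF w'(3)] w w' p unit_word_in[OF w(1), of b] unit_word_in[OF w'(1), of d] vec_in[OF t w'(3)]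
        unit_word_inner[OF w(1) w'(1), of b a d]
      by (simp add: t.lact_add_right t.inner_add t.lact_closed comb_inner_Cons)
  qed
  show ?thesis
    using U
  proof (induction U)
    case Nil
    then show ?case using vec_in[OF t V] by (simp add: z t.lact_closed)
  next
    case (Cons p U)
    obtain w b where p: "p = (w, b)" by (cases p)
    have w: "nonneg_word w" "total_time w = t" "U \<in> gns_combs t" using Cons.prems p by auto
    show ?case
      using Cons.IH[OF w(3)] w p unit_word_in[OF w(1), of b] vec_in[OF t w(3)] vec_in[OF t V]
        comb_inner_append_left[of a "[(colour w, b)]" "conv U" "conv V"] 1[OF w(1,2), of b]
      by (simp add: t.Q_add_left t.lact_closed)
  qed
qed

lemma vec_inner_one:
  assumes "t \<ge> 0" "U \<in> gns_combs t" "V \<in> gns_combs t"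
  shows "hinner (fibre P t) (vec t U) (vec t V) = comb_inner 1 (conv U) (conv V)"
  using vec_inner[OF assms, of 1] correspondence.lact_one[OF corr[OF assms(1)] vec_in[OF assms(1,3)]] by simp

text \<open>Both realisations have the same inner products, hence the same Cauchy sequences; so the
  passage from one to the other extends to limits.\<close>

lemma norm_vec_diff:
  assumes t: "t \<ge> 0" and U: "U \<in> gns_combs t" and V: "V \<in> gns_combs t"
  shows "norm (emb_fibre t (vec t U) - emb_fibre t (vec t V)) = norm (emb (conv U) - emb (conv V))"
proof -
  interpret t: correspondence "fibre P t" by (rule corr[OF t])
  have "(norm (emb_fibre t (vec t U) - emb_fibre t (vec t V)))\<^sup>2 = (norm (emb (conv U) - emb (conv V)))\<^sup>2"
    unfolding emb_fibre_def t.norm_emb_diff_sq[OF vec_in[OF t U] vec_in[OF t V]]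
      norm_emb_diff_sq[OF conv_in(2)[OF U] conv_in(2)[OF V]]
    by (simp only: vec_inner_one[OF t] U V)
  then show ?thesis by simp
qed

lemma vec_dense:
  assumes t: "t \<ge> 0" and x: "x \<in> hcarrier (fibre P t)"
  shows "\<exists>U. (\<forall>n. U n \<in> gns_combs t) \<and> (\<lambda>n. emb_fibre t (vec t (U n))) \<longlonglongrightarrow> emb_fibre t x"
proof -
  interpret t: correspondence "fibre P t" by (rule corr[OF t])
  show ?thesis
  \<comment> \<open>\<open>generated_by\<close> speaks of positive times only; at time 0 the fibre
    consists of the elements \<open>base b\<close>.\<close>
  proof (cases "t = 0")
    case True
    then obtain b where b: "x = prodsys.base P b" using product_system_base(2)[OF ps] x by blast
    have "vec t [([], b)] = x" using x t.add_zero[OF x] by (simp add: b)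
    then show ?thesis using True by (intro exI[of _ "\<lambda>_. [([], b)]"]) simp
  next
    case False
    then have t0: "t > 0" using t by simp
    let ?S = "{unit_word P \<xi> b0 w | b0 w. (\<forall>p\<in>set w. snd p > 0) \<and> total_time w = t}"
    have span: "\<exists>U\<in>gns_combs t. y = vec t U" if "y \<in> hspan (fibre P t) ?S" for y
      using that
    proof (induction rule: hspan.induct)
      case hspan_zero
      show ?case by (intro bexI[of _ "[]"]) simp_all
    next
      case (hspan_add s y z)
      then obtain U where U: "U \<in> gns_combs t" "y = vec t U" by blast
      obtain b0 w where w: "s = unit_word P \<xi> b0 w" "\<forall>p\<in>set w. snd p > 0" "total_time w = t" using hspan_add by blast
      have nw: "nonneg_word w" using w(2) by (auto simp: nonneg_word_def)
      \<comment> \<open>The complex scalar of the span is absorbed in the right coefficient.\<close>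
      show ?case
        using U w(3) nw unit_word_ract[OF nw, of b0 "z *\<^sub>C 1"]
        by (intro bexI[of _ "(w, b0 * (z *\<^sub>C 1)) # U"]) (simp_all add: w(1))
    qed
    have "hcarrier (fibre P t) = closed_hspan (fibre P t) ?S"
      using gns t0 by (simp add: gns_system_def generated_by_def)
    then have "x \<in> closed_hspan (fibre P t) ?S" using x by (simp only:)
    then have cl: "\<forall>\<epsilon>>0. \<exists>y\<in>hspan (fibre P t) ?S. hnorm (fibre P t) (hdiff (fibre P t) x y) < \<epsilon>"
      by (simp add: closed_hspan_def)
    have "\<exists>U. U \<in> gns_combs t \<and> norm (emb_fibre t (vec t U) - emb_fibre t x) < inverse (real (Suc n))" for n
    proof -
      obtain y where y: "y \<in> hspan (fibre P t) ?S" "hnorm (fibre P t) (hdiff (fibre P t) x y) < inverse (real (Suc n))"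
        using cl[rule_format, of "inverse (real (Suc n))"] by auto
      obtain U where U: "U \<in> gns_combs t" "y = vec t U" using span[OF y(1)] by blast
      have "norm (emb_fibre t x - emb_fibre t (vec t U)) < inverse (real (Suc n))"
        using y(2) t.hnorm_hdiff[OF x vec_in[OF t U(1)]] by (simp only: U(2) emb_fibre_def)
      then show ?thesis using U(1) by (intro exI[of _ U]) (simp only: norm_minus_commute simp_thms)
    qed
    then have "\<forall>n. \<exists>U. U \<in> gns_combs t \<and> norm (emb_fibre t (vec t U) - emb_fibre t x) < inverse (real (Suc n))" ..
    from choice[OF this]
obtain U where U: "\<And>n. U n \<in> gns_combs t"
      "\<And>n. norm (emb_fibre t (vec t (U n)) - emb_fibre t x) < inverse (real (Suc n))" by blast
    have "(\<lambda>n. emb_fibre t (vec t (U n)) - emb_fibre t x) \<longlonglongrightarrow> 0"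
      by (rule Lim_null_comparison[OF _ LIMSEQ_inverse_real_of_nat])
        (intro always_eventually allI less_imp_le U(2))
    then show ?thesis using U(1) by (intro exI[of _ U]) (simp add: LIM_zero_iff)
  qed
qed

section \<open>Extension to the whole fibre\<close>

definition ext where
  "ext t = (SOME v. \<forall>U x. (\<forall>n. U n \<in> gns_combs t) \<longrightarrow> (\<lambda>n. emb_fibre t (vec t (U n))) \<longlonglongrightarrow> x \<longrightarrow>
     (\<lambda>n. emb (conv (U n))) \<longlonglongrightarrow> v x)"

lemma ext_tendsto:
  assumes t: "t \<ge> 0" and U: "\<And>n. U n \<in> gns_combs t" "(\<lambda>n. emb_fibre t (vec t (U n))) \<longlonglongrightarrow> x"
  shows "(\<lambda>n. emb (conv (U n))) \<longlonglongrightarrow> ext t x"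
proof -
  have "\<exists>v. \<forall>U x. (\<forall>n. U n \<in> gns_combs t) \<longrightarrow> (\<lambda>n. emb_fibre t (vec t (U n))) \<longlonglongrightarrow> x \<longrightarrow>
     (\<lambda>n. emb (conv (U n))) \<longlonglongrightarrow> v x"
  proof (rule cauchy_extension)
    fix U :: "nat \<Rightarrow> _" assume V: "\<And>n. U n \<in> gns_combs t" and "Cauchy (\<lambda>n. emb_fibre t (vec t (U n)))"
    then show "Cauchy (\<lambda>n. emb (conv (U n)))" unfolding Cauchy_iff norm_vec_diff[OF t V V] by simp
  qed
  from someI_ex[OF this, folded ext_def, THEN spec[of _ U], THEN spec[of _ x]] show ?thesis using U by simp
qed

definition embed :: "real \<Rightarrow> 'e \<Rightarrow> _" where "embed t x = ext t (emb_fibre t x)"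

lemma embed_tendsto:
  "\<lbrakk>t \<ge> 0; \<And>n. U n \<in> gns_combs t; (\<lambda>n. emb_fibre t (vec t (U n))) \<longlonglongrightarrow> emb_fibre t x\<rbrakk>
    \<Longrightarrow> (\<lambda>n. emb (conv (U n))) \<longlonglongrightarrow> embed t x"
  unfolding embed_def by (rule ext_tendsto)

lemma embed_vec: "t \<ge> 0 \<Longrightarrow> U \<in> gns_combs t \<Longrightarrow> embed t (vec t U) = emb (conv U)"
proof -
  assume "t \<ge> 0" "U \<in> gns_combs t"
  then have "(\<lambda>n::nat. emb (conv U)) \<longlonglongrightarrow> embed t (vec t U)"
    by (intro embed_tendsto[where U = "\<lambda>_. U"]) simp_all
  then show ?thesis by (intro LIMSEQ_unique[OF _ tendsto_const])
qed

lemma embed_level: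
  assumes "t \<ge> 0" "x \<in> hcarrier (fibre P t)" shows "embed t x \<in> level t"
proof -
  obtain U where U: "\<And>n. U n \<in> gns_combs t" "(\<lambda>n. emb_fibre t (vec t (U n))) \<longlonglongrightarrow> emb_fibre t x"
    using vec_dense[OF assms] by blast
  show ?thesis by (rule level_limI[OF _ embed_tendsto[OF assms(1) U]]) (rule conv_in(1)[OF U(1)])
qed

lemma embed_inner:
  assumes t: "t \<ge> 0" and x: "x \<in> hcarrier (fibre P t)" and y: "y \<in> hcarrier (fibre P t)"
  shows "ip (embed t x) (embed t y) = hinner (fibre P t) x y"
proof -
  interpret t: correspondence "fibre P t" by (rule corr[OF t])
  obtain U where U: "\<And>n. U n \<in> gns_combs t" "(\<lambda>n. emb_fibre t (vec t (U n))) \<longlonglongrightarrow> emb_fibre t x"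
    using vec_dense[OF t x] by blast
  obtain V where V: "\<And>n. V n \<in> gns_combs t" "(\<lambda>n. emb_fibre t (vec t (V n))) \<longlonglongrightarrow> emb_fibre t y"
    using vec_dense[OF t y] by blast
  have "(\<lambda>n. comb_inner 1 (conv (U n)) (conv (V n))) \<longlonglongrightarrow> ip (embed t x) (embed t y)"
    using ip_tendsto[of "\<lambda>n. conv (U n)" "\<lambda>n. conv (V n)", OF conv_in(2)[OF U(1)] conv_in(2)[OF V(1)]
        embed_tendsto[OF t U] embed_tendsto[OF t V]] .
  moreover have "(\<lambda>n. hinner (fibre P t) (vec t (U n)) (vec t (V n))) \<longlonglongrightarrow> hinner (fibre P t) x y"
    using U(2) V(2) unfolding emb_fibre_def by (intro t.hinner_tendsto vec_in[OF t] U V x y)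
  ultimately show ?thesis unfolding vec_inner_one[OF t U(1) V(1)] by (rule LIMSEQ_unique)
qed

lemma emb_vec_append:
  assumes t: "t \<ge> 0" and "U \<in> gns_combs t" "V \<in> gns_combs t"
  shows "emb_fibre t (vec t (U @ V)) = emb_fibre t (vec t U) + emb_fibre t (vec t V)"
proof -
  interpret t: correspondence "fibre P t" by (rule corr[OF t])
  show ?thesis using assms(2)
  proof (induction U)
    case Nil
    then show ?case by (simp add: emb_fibre_def t.emb_zero)
  next
    case (Cons p U)
    obtain w b where p: "p = (w, b)" by (cases p)
    have w: "nonneg_word w" "total_time w = t" "U \<in> gns_combs t" using Cons.prems p by auto
    then show ?case using Cons.IH unit_word_in[OF w(1), of b] vec_in[OF t, of U] vec_in[OF t, of "U @ V"] assms(3)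
      by (simp add: p emb_fibre_def t.emb_hadd)
  qed
qed

lemma embed_add:
  assumes t: "t \<ge> 0" and x: "x \<in> hcarrier (fibre P t)" and y: "y \<in> hcarrier (fibre P t)"
  shows "embed t (hadd (fibre P t) x y) = embed t x + embed t y"
proof -
  interpret t: correspondence "fibre P t" by (rule corr[OF t])
  obtain U where U: "\<And>n. U n \<in> gns_combs t" "(\<lambda>n. emb_fibre t (vec t (U n))) \<longlonglongrightarrow> emb_fibre t x"
    using vec_dense[OF t x] by blast
  obtain V where V: "\<And>n. V n \<in> gns_combs t" "(\<lambda>n. emb_fibre t (vec t (V n))) \<longlonglongrightarrow> emb_fibre t y"
    using vec_dense[OF t y] by blast
  have e: "emb_fibre t (hadd (fibre P t) x y) = emb_fibre t x + emb_fibre t y"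
    unfolding emb_fibre_def by (rule t.emb_hadd[OF x y])
  have a: "emb (conv (U n @ V n)) = emb (conv (U n)) + emb (conv (V n))" for n
    using conv_in(2)[OF U(1)] conv_in(2)[OF V(1)] by (simp add: emb_add)
  have "(\<lambda>n. emb (conv (U n @ V n))) \<longlonglongrightarrow> embed t (hadd (fibre P t) x y)"
    by (rule embed_tendsto[OF t]) (simp_all add: U V e emb_vec_append[OF t] tendsto_add)
  moreover have "(\<lambda>n. emb (conv (U n)) + emb (conv (V n))) \<longlonglongrightarrow> embed t x + embed t y"
    by (intro tendsto_add embed_tendsto t U V)
  ultimately show ?thesis unfolding a by (rule LIMSEQ_unique)
qed

lemma embed_ract:
  assumes t: "t \<ge> 0" and x: "x \<in> hcarrier (fibre P t)"
  shows "embed t (ract (fibre P t) x a) = bract (embed t x) a"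
proof -
  interpret t: correspondence "fibre P t" by (rule corr[OF t])
  define R where "R U = map (\<lambda>(w, b). (w, b * a)) U" for U :: "(('b \<times> real) list \<times> 'b) list"
  have R: "R U \<in> gns_combs t \<and> conv (R U) = comb_ract (conv U) a \<and> emb_fibre t (vec t (R U)) = bract (emb_fibre t (vec t U)) a"
    if "U \<in> gns_combs t" for U
    using that
  proof (induction U)
    case Nil
    then show ?case by (simp add: R_def emb_fibre_def t.emb_zero bract.zero_left)
  next
    case (Cons p U)
    obtain w b where p: "p = (w, b)" by (cases p)
    have w: "nonneg_word w" "total_time w = t" "U \<in> gns_combs t" using Cons.prems p by auto
    have RC: "R (p # U) = (w, b * a) # R U" by (simp add: R_def p)
    have in1: "unit_word P \<xi> b w \<in> hcarrier (fibre P t)" using unit_word_in[OF w(1), of b] w(2) by simp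
    have "unit_word P \<xi> (b * a) w = ract (fibre P t) (unit_word P \<xi> b w) a" using unit_word_ract[OF w(1)] w(2) by simp
    then have "emb_fibre t (vec t (R (p # U))) = bract (emb_fibre t (unit_word P \<xi> b w)) a + emb_fibre t (vec t (R U))"
      using Cons.IH[OF w(3)] vec_in[OF t] in1 unfolding RC
      by (simp add: emb_fibre_def t.emb_hadd t.emb_rm t.ract_closed)
    also have "\<dots> = bract (emb_fibre t (vec t (p # U))) a"
      using Cons.IH[OF w(3)] vec_in[OF t w(3)] in1
      by (simp add: p emb_fibre_def t.emb_hadd bract.add_left)
    finally show ?case using Cons.IH[OF w(3)] w by (simp add: RC[unfolded p] p)
  qed
  obtain U where U: "\<And>n. U n \<in> gns_combs t" "(\<lambda>n. emb_fibre t (vec t (U n))) \<longlonglongrightarrow> emb_fibre t x"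
    using vec_dense[OF t x] by blast
  have e: "emb_fibre t (ract (fibre P t) x a) = bract (emb_fibre t x) a"
    unfolding emb_fibre_def by (rule t.emb_rm[OF x])
  have "(\<lambda>n. emb (conv (R (U n)))) \<longlonglongrightarrow> embed t (ract (fibre P t) x a)"
    by (rule embed_tendsto[OF t]) (simp_all add: U(1) R e bract.tendsto[OF U(2) tendsto_const])
  moreover have "emb (conv (R (U n))) = bract (emb (conv (U n))) a" for n
    using R[OF U(1)] emb_rm[OF conv_in(2)[OF U(1)]] by simp
  ultimately have "(\<lambda>n. bract (emb (conv (U n))) a) \<longlonglongrightarrow> embed t (ract (fibre P t) x a)" by simp
  moreover have "(\<lambda>n. bract (emb (conv (U n))) a) \<longlonglongrightarrow> bract (embed t x) a"
    by (intro bract.tendsto tendsto_const embed_tendsto t U)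
  ultimately show ?thesis by (rule LIMSEQ_unique)
qed

lemma embed_base: "embed 0 (prodsys.base P b) = base b"
proof -
  interpret t: correspondence "fibre P 0" by (rule corr) simp
  have "vec 0 [([], b)] = prodsys.base P b" using t.add_zero[OF product_system_base(1)[OF ps]] by simp
  then show ?thesis using embed_vec[of 0 "[([], b)]"] by (simp add: base_def)
qed

lemma embed_\<xi>: "t \<ge> 0 \<Longrightarrow> embed t (\<xi> t) = unit True t"
proof -
  assume t: "t \<ge> 0"
  interpret t: correspondence "fibre P t" by (rule corr[OF t])
  have "unit_word P \<xi> 1 [(1, t)] = \<xi> t"
    using \<xi>_in[OF t] by (simp add: t.lact_one psmult_base(2)[OF ps t] t.ract_one)
  then have "vec t [([(1, t)], 1)] = \<xi> t" using t.add_zero[OF \<xi>_in[OF t]] by simp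
  then show ?thesis using embed_vec[OF t, of "[([(1, t)], 1)]"] t by (simp add: unit_def)
qed

text \<open>A letter \<open>(b, 0)\<close> stands for \<open>b \<xi>\<^sub>0 = b\<close>.\<close>

definition gns_prefix :: "('b \<times> real) list \<Rightarrow> 'b \<Rightarrow> (('b \<times> real) list \<times> 'b) list \<Rightarrow> (('b \<times> real) list \<times> 'b) list" where
  "gns_prefix u b V = map (\<lambda>(w, d). (u @ (b, 0) # w, d)) V"

definition gns_mult :: "(('b \<times> real) list \<times> 'b) list \<Rightarrow> (('b \<times> real) list \<times> 'b) list \<Rightarrow> (('b \<times> real) list \<times> 'b) list" where
  "gns_mult U V = concat (map (\<lambda>(u, b). gns_prefix u b V) U)"

lemma gns_mult_simps [simp]: "gns_prefix u b [] = []" "gns_prefix u b ((w, d) # V) = (u @ (b, 0) # w, d) # gns_prefix u b V"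
  "gns_mult [] V = []" "gns_mult ((u, b) # U) V = gns_prefix u b V @ gns_mult U V"
  by (auto simp: gns_prefix_def gns_mult_def)

lemma gns_prefix_in: "nonneg_word u \<Longrightarrow> total_time u = s \<Longrightarrow> V \<in> gns_combs t \<Longrightarrow> gns_prefix u b V \<in> gns_combs (s + t)"
  by (induction V) auto

lemma gns_mult_in: "U \<in> gns_combs s \<Longrightarrow> V \<in> gns_combs t \<Longrightarrow> gns_mult U V \<in> gns_combs (s + t)"
  by (induction U) (auto intro: gns_prefix_in)

lemma kern_zero_mid:
  assumes "valid u" "valid x" "valid w"
  shows "kern u (x @ (b, e, 0) # w) a = kern u (x @ (b, e', 0) # w) a"
  using assms
proof (induction u x arbitrary: a rule: kern.induct)
  case (2 d f s u)
  then show ?case using kern_zero(2)[of "(d, f, s) # u" w b _ a] by (simp del: kern.simps)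
next
  case (4 d f s u d' f' s' w')
  then show ?case by (cases s s' rule: linorder_cases) auto
qed (simp_all add: kern_zero)

text \<open>The joining letters are b \<xi>_0 on one side and b \<omega>_0 on the other; both are
  b.\<close>

lemma emb_conv_mult:
  assumes U: "U \<in> gns_combs s" and V: "V \<in> gns_combs t"
  shows "emb (conv (gns_mult U V)) = emb (comb_mult (conv U) (conv V))"
proof -
  have 1: "emb (conv (gns_prefix u b V)) = emb (prefix (colour u) b (conv V))" if u: "nonneg_word u" for u b
    using V
  proof (induction V)
    case (Cons p V)
    obtain w d where p: "p = (w, d)" by (cases p)
    have w: "nonneg_word w" "V \<in> gns_combs t" using Cons.prems p by auto
    have "emb [(colour u @ (b, True, 0) # colour w, d)] = emb [(colour u @ (b, False, 0) # colour w, d)]"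
      using u w kern_zero_mid[of _ "colour u" "colour w" b True 1 False]
      by (intro emb_word_eqI) (simp_all add: valid_colour)
    moreover have "conv (gns_prefix u b V) \<in> combs" by (rule conv_in(2)[OF gns_prefix_in[OF u refl w(2)]])
    moreover have "prefix (colour u) b (conv V) \<in> combs" using u w by (simp add: prefix_in valid_colour conv_in)
    ultimately show ?case
      using Cons.IH[OF w(2)] u w emb_add[of "[(colour u @ (b, True, 0) # colour w, d)]" "conv (gns_prefix u b V)"]
        emb_add[of "[(colour u @ (b, False, 0) # colour w, d)]" "prefix (colour u) b (conv V)"]
      by (simp add: p valid_colour)
  qed simp
  show ?thesis
    using U
  proof (induction U)
    case (Cons p U)
    obtain u b where p: "p = (u, b)" by (cases p)
    have u: "nonneg_word u" "U \<in> gns_combs s" using Cons.prems p by auto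
    have "conv (gns_prefix u b V) \<in> combs" by (rule conv_in(2)[OF gns_prefix_in[OF u(1) refl V]])
    moreover have "conv (gns_mult U V) \<in> combs" by (rule conv_in(2)[OF gns_mult_in[OF u(2) V]])
    moreover have "prefix (colour u) b (conv V) \<in> combs" "comb_mult (conv U) (conv V) \<in> combs"
      using u V by (simp_all add: prefix_in valid_colour conv_in comb_mult_in)
    ultimately show ?case using Cons.IH[OF u(2)] by (simp add: p emb_add 1[OF u(1)])
  qed simp
qed

text \<open>A cross term in the distance between x y and the product of approximating sums. Each
  summand of \<open>gns_mult\<close> is a product of words by \<open>unit_word_append\<close>, so
  the inner product formula for \<open>psmult\<close> applies summand by summand, and no bilinearity
  of \<open>psmult\<close> has to be extracted from the tensor classes.\<close>

lemma psmult_vec_inner: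
  assumes st: "s \<ge> 0" "t \<ge> 0" and x: "x \<in> hcarrier (fibre P s)" and y: "y \<in> hcarrier (fibre P t)"
    and U: "U \<in> gns_combs s" and V: "V \<in> gns_combs t"
  shows "hinner (fibre P (s + t)) (psmult P s t x y) (vec (s + t) (gns_mult U V))
    = hinner (fibre P t) y (lact (fibre P t) (hinner (fibre P s) x (vec s U)) (vec t V))"
proof -
  have st': "s + t \<ge> 0" using st by simp
  interpret s: correspondence "fibre P s" by (rule corr[OF st(1)])
  interpret t: correspondence "fibre P t" by (rule corr[OF st(2)])
  interpret st: correspondence "fibre P (s + t)" by (rule corr[OF st'])
  let ?m = "psmult P s t x y"
  have m: "?m \<in> hcarrier (fibre P (s + t))" by (rule psmult_closed[OF ps st x y])
  have zero: "hinner E z (hzero E) = 0" if "correspondence E" "z \<in> hcarrier E" for E :: "('e, 'b) corr" and z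
  proof -
    interpret E: correspondence E by (rule that(1))
    show ?thesis using E.norm_Q_le[OF that(2) E.zero_closed] by (simp add: E.emb_zero)
  qed
  have app: "hinner (fibre P (s + t)) ?m (vec (s + t) (A @ B)) = hinner (fibre P (s + t)) ?m (vec (s + t) A) + hinner (fibre P (s + t)) ?m (vec (s + t) B)"
    if "A \<in> gns_combs (s + t)" "B \<in> gns_combs (s + t)" for A B
    using that(1)
  proof (induction A)
    case Nil
    then show ?case by (simp add: zero[OF st.correspondence_axioms m])
  next
    case (Cons p A)
    obtain w b where p: "p = (w, b)" by (cases p)
    have w: "nonneg_word w" "total_time w = s + t" "A \<in> gns_combs (s + t)" using Cons.prems p by auto
    have "unit_word P \<xi> b w \<in> hcarrier (fibre P (s + t))" using unit_word_in[OF w(1), of b] w(2) by simp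
    then show ?case using Cons.IH[OF w(3)] vec_in[OF st', of A] vec_in[OF st', of "A @ B"] w that(2) m
      by (simp add: p st.inner_add)
  qed
  have 1: "hinner (fibre P (s + t)) ?m (vec (s + t) (gns_prefix u b V)) = hinner (fibre P t) y (lact (fibre P t) (hinner (fibre P s) x (unit_word P \<xi> b u)) (vec t V))"
    if u: "nonneg_word u" "total_time u = s" for u b
    using V
  proof (induction V)
    case Nil
    let ?a = "hinner (fibre P s) x (unit_word P \<xi> b u)"
    have "lact (fibre P t) ?a (hzero (fibre P t)) = hzero (fibre P t)"
      using t.norm_lact_le[OF t.zero_closed, of ?a]
      by (intro t.emb_eq_zero t.lact_closed t.zero_closed) (simp add: t.emb_zero)
    then show ?case by (simp add: zero[OF st.correspondence_axioms m] zero[OF t.correspondence_axioms y])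
  next
    case (Cons p V)
    obtain w d where p: "p = (w, d)" by (cases p)
    have w: "nonneg_word w" "total_time w = t" "V \<in> gns_combs t" using Cons.prems p by auto
    have iu: "unit_word P \<xi> b u \<in> hcarrier (fibre P s)" using unit_word_in[OF u(1), of b] u(2) by simp
    have iw: "unit_word P \<xi> d w \<in> hcarrier (fibre P t)" using unit_word_in[OF w(1), of d] w(2) by simp
    have e: "unit_word P \<xi> d (u @ (b, 0) # w) = psmult P s t (unit_word P \<xi> b u) (unit_word P \<xi> d w)"
      using unit_word_append[OF u(1) w(1)] u(2) w(2) by simp
    have "vec (s + t) (gns_prefix u b V) \<in> hcarrier (fibre P (s + t))"
      by (rule vec_in[OF st' gns_prefix_in[OF u w(3)]])
    then show ?case
      using Cons.IH[OF w(3)] m vec_in[OF st(2) w(3)] iu iw x y st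
      by (simp add: p e st.inner_add psmult_closed[OF ps] psmult_inner[OF ps] t.lact_add_right t.inner_add t.lact_closed)
  qed
  show ?thesis
    using U
  proof (induction U)
    case Nil
    let ?z = "lact (fibre P t) 0 (vec t V)"
    have z: "?z \<in> hcarrier (fibre P t)" by (rule t.lact_closed[OF vec_in[OF st(2) V]])
    have "?z = hadd (fibre P t) ?z ?z"
      using t.lact_add_left[OF vec_in[OF st(2) V], of 0 0] by simp
    from trans[OF arg_cong[OF this, of "hinner (fibre P t) y"] t.inner_add[OF y z z]]
    have "hinner (fibre P t) y ?z = 0" by simp
    then show ?case by (simp add: zero[OF st.correspondence_axioms m] zero[OF s.correspondence_axioms x])
  next
    case (Cons p U)
    obtain u b where p: "p = (u, b)" by (cases p)
    have u: "nonneg_word u" "total_time u = s" "U \<in> gns_combs s" using Cons.prems p by auto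
    have iu: "unit_word P \<xi> b u \<in> hcarrier (fibre P s)" using unit_word_in[OF u(1), of b] u(2) by simp
    show ?case
      using Cons.IH[OF u(3)] app[OF gns_prefix_in[OF u(1,2) V, of b] gns_mult_in[OF u(3) V]] 1[OF u(1,2), of b]
        vec_in[OF st(2) V] vec_in[OF st(1) u(3)] iu x y
      by (simp add: p s.inner_add t.lact_add_left t.inner_add t.lact_closed)
  qed
qed

text \<open>With x and y approximated by formal sums, the squared distance between x y and the
  product of the sums expands into four inner products with the common limit <y, <x, x> y>.\<close>

lemma embed_mult:
  assumes st: "s \<ge> 0" "t \<ge> 0" and x: "x \<in> hcarrier (fibre P s)" and y: "y \<in> hcarrier (fibre P t)"
  shows "embed (s + t) (psmult P s t x y) = mul s (embed s x) (embed t y)"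
proof -
  have st': "s + t \<ge> 0" using st by simp
  interpret s: correspondence "fibre P s" by (rule corr[OF st(1)])
  interpret t: correspondence "fibre P t" by (rule corr[OF st(2)])
  interpret st: correspondence "fibre P (s + t)" by (rule corr[OF st'])
  obtain U where U: "\<And>n. U n \<in> gns_combs s" "(\<lambda>n. emb_fibre s (vec s (U n))) \<longlonglongrightarrow> emb_fibre s x"
    using vec_dense[OF st(1) x] by blast
  obtain V where V: "\<And>n. V n \<in> gns_combs t" "(\<lambda>n. emb_fibre t (vec t (V n))) \<longlonglongrightarrow> emb_fibre t y"
    using vec_dense[OF st(2) y] by blast
  define W where "W n = gns_mult (U n) (V n)" for n
  have W: "W n \<in> gns_combs (s + t)" for n unfolding W_def by (rule gns_mult_in[OF U(1) V(1)])
  let ?m = "psmult P s t x y" and ?L = "hinner (fibre P t) y (lact (fibre P t) (hinner (fibre P s) x x) y)"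
  have m: "?m \<in> hcarrier (fibre P (s + t))" by (rule psmult_closed[OF ps st x y])
  have mm: "hinner (fibre P (s + t)) ?m ?m = ?L" by (rule psmult_inner[OF ps st x x y y])
  note vU = vec_in[OF st(1) U(1)] and vV = vec_in[OF st(2) V(1)] and vW = vec_in[OF st' W]
  have Ulim: "(\<lambda>n. s.emb (vec s (U n))) \<longlonglongrightarrow> s.emb x" using U(2) by (simp add: emb_fibre_def)
  have Vlim: "(\<lambda>n. t.emb (vec t (V n))) \<longlonglongrightarrow> t.emb y" using V(2) by (simp add: emb_fibre_def)
  have lim1: "(\<lambda>n. hinner (fibre P (s + t)) ?m (vec (s + t) (W n))) \<longlonglongrightarrow> ?L"
    unfolding W_def psmult_vec_inner[OF st x y U(1) V(1)]
    by (intro t.hinner_tendsto t.lact_tendsto s.hinner_tendsto tendsto_const vU vV x y t.lact_closed Ulim Vlim)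
  have "(\<lambda>n. star (hinner (fibre P (s + t)) ?m (vec (s + t) (W n)))) \<longlonglongrightarrow> star ?L"
    by (rule bounded_linear.tendsto[OF bounded_linear_star lim1])
  then have lim2: "(\<lambda>n. hinner (fibre P (s + t)) (vec (s + t) (W n)) ?m) \<longlonglongrightarrow> ?L"
    using st.inner_star[OF m vW] st.inner_star[OF m m] by (simp add: mm)
  \<comment> \<open>This term is computed in the module of words, where the inner product of two
    products is already known.\<close>
  have WW: "hinner (fibre P (s + t)) (vec (s + t) (W n)) (vec (s + t) (W n))
      = hinner (fibre P t) (vec t (V n)) (lact (fibre P t) (hinner (fibre P s) (vec s (U n)) (vec s (U n))) (vec t (V n)))" for n
  proof -
    have cUV: "comb_mult (conv (U n)) (conv (V n)) \<in> combs" by (intro comb_mult_in conv_in(2)[OF U(1)] conv_in(2)[OF V(1)])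
    have "hinner (fibre P (s + t)) (vec (s + t) (W n)) (vec (s + t) (W n)) = ip (emb (conv (W n))) (emb (conv (W n)))"
      by (simp add: vec_inner_one[OF st' W W] ip_emb conv_in(2)[OF W])
    also have "\<dots> = comb_inner 1 (comb_mult (conv (U n)) (conv (V n))) (comb_mult (conv (U n)) (conv (V n)))"
      unfolding W_def emb_conv_mult[OF U(1) V(1)] by (rule ip_emb[OF cUV cUV])
    also have "\<dots> = comb_inner (comb_inner 1 (conv (U n)) (conv (U n))) (conv (V n)) (conv (V n))"
      by (rule comb_inner_mult[OF conv_in(1)[OF U(1)] conv_in(1)[OF U(1)] conv_in(2)[OF V(1)] conv_in(2)[OF V(1)]])
    finally show ?thesis
      by (simp only: vec_inner[OF st(2) V(1) V(1)] vec_inner_one[OF st(1) U(1) U(1)])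
  qed
  have lim3: "(\<lambda>n. hinner (fibre P (s + t)) (vec (s + t) (W n)) (vec (s + t) (W n))) \<longlonglongrightarrow> ?L"
    unfolding WW
    by (intro t.hinner_tendsto t.lact_tendsto s.hinner_tendsto tendsto_const vU vV x y t.lact_closed Ulim Vlim)
  have "(\<lambda>n. norm (?L - hinner (fibre P (s + t)) ?m (vec (s + t) (W n)) - (hinner (fibre P (s + t)) (vec (s + t) (W n)) ?m
      - hinner (fibre P (s + t)) (vec (s + t) (W n)) (vec (s + t) (W n))))) \<longlonglongrightarrow> norm (?L - ?L - (?L - ?L))"
    by (intro tendsto_norm tendsto_diff tendsto_const lim1 lim2 lim3)
  then have "(\<lambda>n. (norm (st.emb ?m - st.emb (vec (s + t) (W n))))\<^sup>2) \<longlonglongrightarrow> 0"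
    by (simp add: st.norm_emb_diff_sq[OF m vW] mm)
  then have "(\<lambda>n. sqrt ((norm (st.emb ?m - st.emb (vec (s + t) (W n))))\<^sup>2)) \<longlonglongrightarrow> sqrt 0"
    by (rule tendsto_real_sqrt)
  then have "(\<lambda>n. st.emb ?m - st.emb (vec (s + t) (W n))) \<longlonglongrightarrow> 0" by (simp add: tendsto_norm_zero_iff)
  from tendsto_diff[OF tendsto_const this, of "st.emb ?m"]
  have "(\<lambda>n. emb_fibre (s + t) (vec (s + t) (W n))) \<longlonglongrightarrow> emb_fibre (s + t) ?m" by (simp add: emb_fibre_def)
  then have "(\<lambda>n. emb (conv (W n))) \<longlonglongrightarrow> embed (s + t) ?m" by (intro embed_tendsto[OF st' W])
  then have "(\<lambda>n. emb (comb_mult (conv (U n)) (conv (V n)))) \<longlonglongrightarrow> embed (s + t) ?m"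
    unfolding W_def emb_conv_mult[OF U(1) V(1)] .
  moreover have "(\<lambda>n. emb (comb_mult (conv (U n)) (conv (V n)))) \<longlonglongrightarrow> mul s (embed s x) (embed t y)"
    by (intro mul_tendsto conv_in(1)[OF U(1)] conv_in(2)[OF V(1)] embed_tendsto st U V)
  ultimately show ?thesis by (rule LIMSEQ_unique)
qed

theorem gns_embedding_word_system:
  "gns_embedding P \<xi> word_system ambient (\<lambda>t y. y) (\<lambda>t x. code (embed t x))"
  unfolding gns_embedding_def
proof (intro conjI allI impI ballI)
  fix t :: real assume t: "t \<ge> 0"
  \<comment> \<open>Left linearity is multiplicativity with the left factor b taken in the fibre at
    0.\<close>
  have l: "embed t (lact (fibre P t) b x) = mul 0 (base b) (embed t x)" if x: "x \<in> hcarrier (fibre P t)" for b x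
    using embed_mult[OF order_refl t product_system_base(1)[OF ps] x, of b]
    by (simp add: psmult_base(1)[OF ps t x] embed_base)
  show "bilinear_isometry (fibre P t) (fibre word_system t) (\<lambda>x. code (embed t x))"
    unfolding bilinear_isometry_def right_isometry_def
    by (simp add: embed_level[OF t] embed_add[OF t] embed_ract[OF t] embed_inner[OF t] l imageI)
next
  show "code (embed 0 (prodsys.base P b)) = prodsys.base word_system b" for b by (simp add: embed_base)
next
  fix s t :: real and x y
  assume "s \<ge> 0" "t \<ge> 0" "x \<in> hcarrier (fibre P s)" "y \<in> hcarrier (fibre P t)"
  then show "code (embed (s + t) (psmult P s t x y)) = psmult word_system s t (code (embed s x)) (code (embed t y))"
    by (simp add: embed_mult psmult_word_system embed_level)
next
  have "continuous_on {0..} (\<lambda>t. decode (code (embed t (\<xi> t))))"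
    by (rule continuous_on_eq[OF unit_continuous[of True]]) (simp add: embed_\<xi>)
  then show "(\<lambda>t. code (embed t (\<xi> t))) \<in> cont_sections word_system ambient (\<lambda>t y. y)"
    by (simp add: cont_sections_iff embed_level \<xi>_in imageI)
qed

end

text \<open>The forward direction exhibits a system over a concrete type that depends on the algebra
  only. Spatiality follows from embeddability over arbitrary types, so the equivalence does not
  hinge on that choice.\<close>

theorem theorem4p4:
  fixes T :: "real \<Rightarrow> 'b::cstar_algebra \<Rightarrow> 'b"
    and E :: "('e, 'b) prodsys"
    and \<xi> :: "real \<Rightarrow> 'e"
  assumes "cp_semigroup T"
    and "strongly_continuous T"
    and "gns_system T E \<xi>"
  shows "(spatial_cp_semigroup T \<longleftrightarrow>
            spatially_embeddable TYPE('b list \<Rightarrow> 'b) TYPE('b list \<Rightarrow> 'b) E \<xi>) \<and>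
         (spatially_embeddable TYPE('g) TYPE('h) E \<xi> \<longrightarrow> spatial_cp_semigroup T)"
proof (intro conjI iffI impI)
  assume "spatial_cp_semigroup T"
  then obtain c where c: "continuous_on {0..} c" "c 0 = 1"
      "\<And>s t. s \<ge> 0 \<Longrightarrow> t \<ge> 0 \<Longrightarrow> c s * c t = c (s + t)"
      "\<And>t. t \<ge> 0 \<Longrightarrow> completely_positive (\<lambda>b. T t b - star (c t) * b * c t)"
    unfolding spatial_cp_semigroup_def by blast
  interpret spatial_gns T c E \<xi> by unfold_locales (fact assms c)+
  show "spatially_embeddable TYPE('b list \<Rightarrow> 'b) TYPE('b list \<Rightarrow> 'b) E \<xi>"
    unfolding spatially_embeddable_def
    using spatial_word_system gns_embedding_word_system by blast
next
  show "spatial_cp_semigroup T" if "spatially_embeddable TYPE('b list \<Rightarrow> 'b) TYPE('b list \<Rightarrow> 'b) E \<xi>"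
    using that spatial_if_embeddable[OF assms] unfolding spatially_embeddable_def by blast
  show "spatial_cp_semigroup T" if "spatially_embeddable TYPE('g) TYPE('h) E \<xi>"
    using that spatial_if_embeddable[OF assms] unfolding spatially_embeddable_def by blast
qed

end
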